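(* Let $\boldsymbol F=\rho^{-3}\bigl(X(\varphi)\boldsymbol e_\rho+Y(\varphi)\boldsymbol e_\varphi\bigr)$ be an axisymmetric, swirl-free vector field, homogeneous of degree $-3$ and of class $C^1$ on $\overline{\mathbb R^3_+}\setminus\{0\}$. For $\lambda\in\mathbb R$ consider the system $$-\Delta\boldsymbol u+(\boldsymbol u\cdot\nabla)\boldsymbol u+\nabla p=\lambda\boldsymbol F\ \text{ in }\mathbb R^3_+,\qquad \operatorname{div}\boldsymbol u=0\ \text{ in }\mathbb R^3_+,\qquad \boldsymbol u=0\ \text{ on }\partial\mathbb R^3_+\setminus\{0\}.\qquad(\mathrm{NS}_\lambda)$$ There exist $\underline\lambda\in[-\infty,0)$ and $\overline\lambda\in(0,+\infty]$ such that: for every $\lambda\in(\underline\lambda,\overline\lambda)$ the system $(\mathrm{NS}_\lambda)$ admits a unique axisymmetric self-similar solution $(\boldsymbol u,p)$, and it satisfies $\boldsymbol u\in C^{2,\alpha}_{\mathrm{loc}}(\overline{\mathbb R^3_+}\setminus\{0\})$, $p\in C^{1,\alpha}_{\mathrm{loc}}(\overline{\mathbb R^3_+}\setminus\{0\})$ for every $\alpha\in(0,1)$; whereas for every real $\lambda\notin(\underline\lambda,\overline\lambda)$ the system $(\mathrm{NS}_\lambda)$ admits no axisymmetric self-similar solution. Moreover, define for $\varphi\in[0,\frac\pi2]$ $$\mathcal N(\varphi)=\int_0^\varphi\bigl(G(\tau)+2\mathcal C\bigr)\sin\tau\,(\cos\varphi-\cos\tau)\,d\tau,$$ where $$G(\varphi)=X(\varphi)+2\int_0^\varphi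 Y(\tau)\,d\tau,\qquad \mathcal C=-\int_0^{\pi/2}G(\tau)\sin\tau\cos\tau\,d\tau .$$ Then: (1) if $\mathcal N\ge0$ and $\mathcal N\not\equiv0$, then $\underline\lambda\in(-\infty,0)$ and $\overline\lambda=+\infty$; (2) if $\mathcal N\le0$ and $\mathcal N\not\equiv0$, then $\underline\lambda=-\infty$ and $\overline\lambda\in(0,+\infty)$; (3) if $\mathcal N$ changes sign, then $\underline\lambda\in(-\infty,0)$ and $\overline\lambda\in(0,+\infty)$; (4) if $\mathcal N\equiv0$, then $\underline\lambda=-\infty$ and $\overline\lambda=+\infty$.
   Context: $\mathbb R^3_+=\{x\in\mathbb R^3:x_3>0\}$. Spherical coordinates: $\boldsymbol x=(\rho\sin\varphi\cos\theta,\rho\sin\varphi\sin\theta,\rho\cos\varphi)$, with orthonormal basis $\boldsymbol e_\rho=\boldsymbol x/\rho$, $\boldsymbol e_\theta=(-\sin\theta,\cos\theta,0)$, $\boldsymbol e_\varphi=\boldsymbol e_\theta\times\boldsymbol e_\rho$. A vector field $\boldsymbol v=v^\rho\boldsymbol e_\rho+v^\varphi\boldsymbol e_\varphi+v^\theta\boldsymbol e_\theta$ is axisymmetric if its components depend only on $(\rho,\varphi)$, and swirl-free if $v^\theta\equiv0$. A scalar function is axisymmetric if it depends only on $(\rho,\varphi)$. An axisymmetric self-similar solution is a pair $(\boldsymbol u,p)$ with $\boldsymbol u\in C^2(\overline{\mathbb R^3_+}\setminus\{0\})$, $p\in C^1(\overline{\mathbb R^3_+}\setminus\{0\})$, both axisymmetric,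 solving the system pointwise and satisfying $\boldsymbol u(\mu x)=\mu^{-1}\boldsymbol u(x)$, $p(\mu x)=\mu^{-2}p(x)$ for all $\mu>0$. In particular $\boldsymbol u=\rho^{-1}(f(\varphi)\boldsymbol e_\rho+g(\varphi)\boldsymbol e_\varphi+h(\varphi)\boldsymbol e_\theta)$ with angular profiles $f,g,h$ bounded on $[0,\pi/2]$ (a "bounded-profile" solution). "$\mathcal N$ changes sign" means that $\mathcal N$ takes both strictly positive and strictly negative values. *)

theory Defs
  imports "HOL-Analysis.Analysis"
begin

section \<open>Domains and spherical coordinates\<close>

definition half_space :: "(real^3) set" where
  "half_space = {x. 0 < x $ 3}"

definition punctured_closed_half_space :: "(real^3) set" where
  "punctured_closed_half_space = closure half_space - {0}"

definition punctured_boundary :: "(real^3) set" where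
  "punctured_boundary = frontier half_space - {0}"

definition e_rho :: "real \<Rightarrow> real \<Rightarrow> real^3" where
  "e_rho \<phi> \<theta> = vector [sin \<phi> * cos \<theta>, sin \<phi> * sin \<theta>, cos \<phi>]"

definition e_theta :: "real \<Rightarrow> real^3" where
  "e_theta \<theta> = vector [- sin \<theta>, cos \<theta>, 0]"

definition e_phi :: "real \<Rightarrow> real \<Rightarrow> real^3" where
  "e_phi \<phi> \<theta> = cross3 (e_theta \<theta>) (e_rho \<phi> \<theta>)"

definition spherical :: "real \<Rightarrow> real \<Rightarrow> real \<Rightarrow> real^3" where
  "spherical \<rho> \<phi> \<theta> = \<rho> *\<^sub>R e_rho \<phi> \<theta>"

text \<open>The angle \<open>\<theta>\<close> is not determined by the point on the axis \<open>\<phi> = 0\<close>. As the two conditions below are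
  imposed for all \<open>\<theta>\<close>, the components \<open>v\<^sup>\<phi>\<close> and \<open>v\<^sup>\<theta>\<close> vanish there, which for a field that is continuous
  on the axis follows from the condition off the axis.\<close>

definition axisymmetric_vector :: "(real^3 \<Rightarrow> real^3) \<Rightarrow> bool" where
  "axisymmetric_vector v \<longleftrightarrow>
     (\<exists>vr vp vt. \<forall>\<rho>>0. \<forall>\<phi>\<in>{0..pi/2}. \<forall>\<theta>.
        v (spherical \<rho> \<phi> \<theta>) =
          vr \<rho> \<phi> *\<^sub>R e_rho \<phi> \<theta> + vp \<rho> \<phi> *\<^sub>R e_phi \<phi> \<theta> + vt \<rho> \<phi> *\<^sub>R e_theta \<theta>)"

definition axisymmetric_scalar :: "(real^3 \<Rightarrow> real) \<Rightarrow> bool" where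
  "axisymmetric_scalar q \<longleftrightarrow>
     (\<exists>s. \<forall>\<rho>>0. \<forall>\<phi>\<in>{0..pi/2}. \<forall>\<theta>. q (spherical \<rho> \<phi> \<theta>) = s \<rho> \<phi>)"

section \<open>Function spaces up to the boundary\<close>

text \<open>The set \<open>S\<close> is meant to be \<^const>\<open>punctured_closed_half_space\<close>. Derivatives within it are unique also at
  boundary points, and the classes below are the usual ones: all derivatives up to the given order
  exist in the interior and extend continuously to \<open>S\<close>.\<close>

definition has_continuous_derivative_on ::
    "('a::real_normed_vector \<Rightarrow> 'b::real_normed_vector) \<Rightarrow> ('a \<Rightarrow> 'a \<Rightarrow>\<^sub>L 'b) \<Rightarrow> 'a set \<Rightarrow> bool" where
  "has_continuous_derivative_on f f' S \<longleftrightarrow>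
     (\<forall>x\<in>S. (f has_derivative blinfun_apply (f' x)) (at x within S)) \<and> continuous_on S f'"

definition C1_on :: "'a set \<Rightarrow> ('a::real_normed_vector \<Rightarrow> 'b::real_normed_vector) \<Rightarrow> bool" where
  "C1_on S f \<longleftrightarrow> (\<exists>f'. has_continuous_derivative_on f f' S)"

definition C2_on :: "'a set \<Rightarrow> ('a::real_normed_vector \<Rightarrow> 'b::real_normed_vector) \<Rightarrow> bool" where
  "C2_on S f \<longleftrightarrow>
     (\<exists>f' f''. has_continuous_derivative_on f f' S \<and> has_continuous_derivative_on f' f'' S)"

definition locally_Holder_on ::
    "real \<Rightarrow> 'a set \<Rightarrow> ('a::metric_space \<Rightarrow> 'b::metric_space) \<Rightarrow> bool" where
  "locally_Holder_on \<alpha> S f \<longleftrightarrow>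
     (\<forall>K. compact K \<and> K \<subseteq> S \<longrightarrow>
        (\<exists>L. \<forall>x\<in>K. \<forall>y\<in>K. dist (f x) (f y) \<le> L * dist x y powr \<alpha>))"

definition C1_Holder_loc_on ::
    "real \<Rightarrow> 'a set \<Rightarrow> ('a::real_normed_vector \<Rightarrow> 'b::real_normed_vector) \<Rightarrow> bool" where
  "C1_Holder_loc_on \<alpha> S f \<longleftrightarrow>
     (\<exists>f'. has_continuous_derivative_on f f' S \<and> locally_Holder_on \<alpha> S f')"

definition C2_Holder_loc_on ::
    "real \<Rightarrow> 'a set \<Rightarrow> ('a::real_normed_vector \<Rightarrow> 'b::real_normed_vector) \<Rightarrow> bool" where
  "C2_Holder_loc_on \<alpha> S f \<longleftrightarrow>
     (\<exists>f' f''. has_continuous_derivative_on f f' S \<and> has_continuous_derivative_on f' f'' S \<and>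
        locally_Holder_on \<alpha> S f'')"

section \<open>The Navier--Stokes system\<close>

definition partial :: "'n \<Rightarrow> (real^'n \<Rightarrow> 'b::real_normed_vector) \<Rightarrow> real^'n \<Rightarrow> 'b" where
  "partial i f x = vector_derivative (\<lambda>t. f (x + t *\<^sub>R axis i 1)) (at 0)"

definition laplacian :: "(real^'n \<Rightarrow> 'b::real_normed_vector) \<Rightarrow> real^'n \<Rightarrow> 'b" where
  "laplacian f x = (\<Sum>i\<in>UNIV. partial i (partial i f) x)"

definition grad :: "(real^'n \<Rightarrow> real) \<Rightarrow> real^'n \<Rightarrow> real^'n" where
  "grad q x = (\<chi> i. partial i q x)"

definition divergence :: "(real^'n \<Rightarrow> real^'n) \<Rightarrow> real^'n \<Rightarrow> real" where
  "divergence v x = (\<Sum>i\<in>UNIV. partial i v x $ i)"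

definition advection :: "(real^'n \<Rightarrow> real^'n) \<Rightarrow> (real^'n \<Rightarrow> real^'n) \<Rightarrow> real^'n \<Rightarrow> real^'n" where
  "advection v w x = (\<Sum>i\<in>UNIV. v x $ i *\<^sub>R partial i w x)"

definition solves_NS ::
    "(real^3 \<Rightarrow> real^3) \<Rightarrow> real \<Rightarrow> (real^3 \<Rightarrow> real^3) \<Rightarrow> (real^3 \<Rightarrow> real) \<Rightarrow> bool" where
  "solves_NS F lam u p \<longleftrightarrow>
     (\<forall>x\<in>half_space. - laplacian u x + advection u u x + grad p x = lam *\<^sub>R F x) \<and>
     (\<forall>x\<in>half_space. divergence u x = 0) \<and>
     (\<forall>x\<in>punctured_boundary. u x = 0)"

definition axisymmetric_self_similar_solution ::
    "(real^3 \<Rightarrow> real^3) \<Rightarrow> real \<Rightarrow> (real^3 \<Rightarrow> real^3) \<Rightarrow> (real^3 \<Rightarrow> real) \<Rightarrow> bool" where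
  "axisymmetric_self_similar_solution F lam u p \<longleftrightarrow>
     C2_on punctured_closed_half_space u \<and>
     C1_on punctured_closed_half_space p \<and>
     axisymmetric_vector u \<and> axisymmetric_scalar p \<and>
     solves_NS F lam u p \<and>
     (\<forall>\<mu>>0. \<forall>x\<in>punctured_closed_half_space.
        u (\<mu> *\<^sub>R x) = (1 / \<mu>) *\<^sub>R u x \<and> p (\<mu> *\<^sub>R x) = (1 / \<mu>^2) * p x)"

section \<open>The angular quantities determined by the force\<close>

definition force_G :: "(real \<Rightarrow> real) \<Rightarrow> (real \<Rightarrow> real) \<Rightarrow> real \<Rightarrow> real" where
  "force_G X Y \<phi> = X \<phi> + 2 * integral {0..\<phi>} Y"

definition force_C :: "(real \<Rightarrow> real) \<Rightarrow> (real \<Rightarrow> real) \<Rightarrow> real" where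
  "force_C X Y = - integral {0..pi/2} (\<lambda>\<tau>. force_G X Y \<tau> * sin \<tau> * cos \<tau>)"

definition force_N :: "(real \<Rightarrow> real) \<Rightarrow> (real \<Rightarrow> real) \<Rightarrow> real \<Rightarrow> real" where
  "force_N X Y \<phi> =
     integral {0..\<phi>} (\<lambda>\<tau>. (force_G X Y \<tau> + 2 * force_C X Y) * sin \<tau> * (cos \<phi> - cos \<tau>))"

end

theory Submission
  imports Defs
begin

text \<open>An axisymmetric field that is homogeneous of degree \<open>-1\<close> is governed by its angular profiles. The swirl component
  solves a linear equation that forces it to vanish. For the stream profile \<open>\<psi>(z)\<close>, with \<open>z = cos \<phi>\<close> and \<open>\<psi> = u\<^sup>\<phi> sin \<phi>\<close>
  on the unit sphere, the system can be integrated three times; the boundary conditions at \<open>z = 0\<close> and \<open>z = 1\<close> fix the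
  constants and leave \<open>(1 - z\<^sup>2) \<psi>' + 2 z \<psi> + \<psi>\<^sup>2 / 2 = \<lambda> N\<close>. With \<open>\<psi> = (1 - z\<^sup>2) y\<close> this is the Riccati equation
  \<open>y' = \<lambda> q - y\<^sup>2 / 2\<close>, \<open>y(0) = 0\<close>, where \<open>q = N / (1 - z\<^sup>2)\<^sup>2\<close> is continuous on \<open>[0,1]\<close>. It is solvable on all of \<open>[0,1]\<close>
  iff the solution of \<open>v'' = (\<lambda> q / 2) v\<close>, \<open>v(0) = 1\<close>, \<open>v'(0) = 0\<close> is positive there. Positivity is an open condition
  in \<open>\<lambda>\<close>, it is star-shaped about \<open>0\<close> by comparison with subsolutions, and it fails for large \<open>\<lambda>\<close> of the sign that makes
  \<open>\<lambda> q\<close> negative somewhere, because \<open>arctan (y / c)\<close> then decreases too fast.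

  Regularity on the axis rests on an elementary fact: a function of \<open>z\<close> whose second and third derivatives grow at most like
  \<open>(1 - z)\<^sup>-\<^sup>1\<^sup>/\<^sup>2\<close> and \<open>(1 - z)\<^sup>-\<^sup>3\<^sup>/\<^sup>2\<close> is, as a function of \<open>x\<close>, twice differentiable with locally Lipschitz
  second derivatives.\<close>

section \<open>The Riccati equation\<close>

text \<open>The obstacle is the axis. As the force is only C^1, the derivatives of q may blow up at
  z = 1. Two facts still give regular fields: N vanishes on the axis to second order in 1 - z with
  an explicit leading term and a remainder of higher order; and the velocity contains only y, one
  integration smoother than q, and (1 - z^2) q, where the factor gains the missing orders. The
  constant C in N is the one for which N vanishes at the boundary plane as well; \<lambda> C is the
  additive constant of the pressure profile. Of the three integration constants two are read off on
  the axis, and no slip then determines the pressure constant. The Riccati equation is linearised by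
  y = 2 v' / v. Expanding v in powers of \<lambda> gives continuity in (\<lambda>, z) jointly, which
  makes positivity on [0,1] an open condition. A given flow yields y on [0,1) only, together with a
  bound; the bound keeps v away from 0 at z = 1.\<close>

primrec picard :: "(real \<Rightarrow> real) \<Rightarrow> nat \<Rightarrow> real \<Rightarrow> real" where
  "picard q 0 = (\<lambda>z. 1)"
| "picard q (Suc n) = (\<lambda>z. integral {0..z} (\<lambda>s. integral {0..s} (\<lambda>t. q t * picard q n t)))"

primrec picard_deriv :: "(real \<Rightarrow> real) \<Rightarrow> nat \<Rightarrow> real \<Rightarrow> real" where
  "picard_deriv q 0 = (\<lambda>z. 0)"
| "picard_deriv q (Suc n) = (\<lambda>z. integral {0..z} (\<lambda>t. q t * picard q n t))"

text \<open>The solution of v'' = l q v, v(0) = 1, v'(0) = 0. Comparing powers of \<open>l\<close>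
  shows that its coefficients are the iterated integrals \<open>picard\<close>.\<close>

definition lin_sol :: "(real \<Rightarrow> real) \<Rightarrow> real \<Rightarrow> real \<Rightarrow> real" where
  "lin_sol q l z = (\<Sum>n. l ^ n * picard q n z)"

definition lin_sol_deriv :: "(real \<Rightarrow> real) \<Rightarrow> real \<Rightarrow> real \<Rightarrow> real" where
  "lin_sol_deriv q l z = (\<Sum>n. l ^ n * picard_deriv q n z)"

lemma has_real_derivative_integral_within:
  assumes "continuous_on {0..1::real} g" "z \<in> {0..1}"
  shows "((\<lambda>z. integral {0..z} g) has_real_derivative g z) (at z within {0..1})"
  using integral_has_real_derivative[OF assms] .

text \<open>Of the two integrations in each step the inner one turns M (M t)^n / n! into (M z)^(n+1)
  / (n+1)!; the outer one runs over an interval of length at most 1 and costs nothing. Hence one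
  bound serves both \<open>picard\<close> and \<open>picard_deriv\<close>.\<close>

lemma picard_bounds:
  assumes q: "continuous_on {0..1} q" and M': "\<forall>z\<in>{0..1}. \<bar>q z\<bar> \<le> M"
  shows "continuous_on {0..1} (picard q n) \<and> (\<forall>z\<in>{0..1}. \<bar>picard q n z\<bar> \<le> (M * z) ^ n / fact n) \<and>
    (\<forall>z\<in>{0..1}. \<bar>picard_deriv q n z\<bar> \<le> (M * z) ^ n / fact n)"
proof (induction n)
  case 0
  show ?case by simp
next
  case (Suc n)
  have M: "\<bar>q z\<bar> \<le> M" if "z \<in> {0..1}" for z using M' that by blast
  have M0: "M \<ge> 0" using M[of 0] by simp
  let ?d = "picard_deriv q (Suc n)"
  have c1: "continuous_on {0..1} (\<lambda>t. q t * picard q n t)"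
    using Suc q by (intro continuous_intros) auto
  have "(?d has_real_derivative q z * picard q n z) (at z within {0..1})" if "z \<in> {0..1}" for z
    using has_real_derivative_integral_within[OF c1 that] by simp
  from DERIV_continuous_on[OF this] have c2: "continuous_on {0..1} ?d" .
  have "(picard q (Suc n) has_real_derivative ?d z) (at z within {0..1})" if "z \<in> {0..1}" for z
    using has_real_derivative_integral_within[OF c2 that] by simp
  from DERIV_continuous_on[OF this] have c3: "continuous_on {0..1} (picard q (Suc n))" .
  have b2: "\<bar>?d z\<bar> \<le> (M * z) ^ Suc n / fact (Suc n)" if z: "z \<in> {0..1}" for z
  proof -
    have "((\<lambda>t. (M * t) ^ Suc n / fact (Suc n)) has_real_derivative M * ((M * t) ^ n / fact n)) (at t within {0..z})" for t
    proof -
      have "((\<lambda>t. (M * t) ^ Suc n) has_real_derivative real (Suc n) * M * (M * t) ^ n) (at t within {0..z})"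
        by (auto intro!: derivative_eq_intros simp del: power_Suc of_nat_Suc)
      from DERIV_cdivide[OF this, of "fact (Suc n)"] show ?thesis
        by (simp add: fact_Suc mult.assoc del: of_nat_Suc power_Suc)
    qed
    then have *: "((\<lambda>t. M * ((M * t) ^ n / fact n)) has_integral
        ((M * z) ^ Suc n / fact (Suc n) - (M * 0) ^ Suc n / fact (Suc n))) {0..z}"
      using z by (intro fundamental_theorem_of_calculus)
        (auto simp: has_real_derivative_iff_has_vector_derivative[symmetric])
    have "norm (?d z) \<le> integral {0..z} (\<lambda>t. M * ((M * t) ^ n / fact n))"
      unfolding picard_deriv.simps
    proof (rule integral_norm_bound_integral)
      show "(\<lambda>t. q t * picard q n t) integrable_on {0..z}"
        using z by (intro integrable_continuous_real continuous_on_subset[OF c1]) auto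
      show "(\<lambda>t. M * ((M * t) ^ n / fact n)) integrable_on {0..z}"
        using * by blast
      fix t assume t: "t \<in> {0..z}"
      show "norm (q t * picard q n t) \<le> M * ((M * t) ^ n / fact n)"
        using t z M[of t] Suc M0 unfolding norm_mult by (intro mult_mono) auto
    qed
    also have "\<dots> = (M * z) ^ Suc n / fact (Suc n)"
      unfolding integral_unique[OF *] by simp
    finally show ?thesis by simp
  qed
  have "\<bar>picard q (Suc n) z\<bar> \<le> (M * z) ^ Suc n / fact (Suc n)" if z: "z \<in> {0..1}" for z
  proof -
    have "norm (integral {0..z} ?d) \<le> (M * z) ^ Suc n / fact (Suc n) * (z - 0)"
    proof (rule integral_bound)
      show "continuous_on {0..z} ?d" using z by (intro continuous_on_subset[OF c2]) auto
      fix t assume t: "t \<in> {0..z}"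
      have "norm (?d t) \<le> (M * t) ^ Suc n / fact (Suc n)" using b2[of t] t z by simp
      also have "\<dots> \<le> (M * z) ^ Suc n / fact (Suc n)"
        using t M0 by (intro divide_right_mono power_mono mult_left_mono) auto
      finally show "norm (?d t) \<le> (M * z) ^ Suc n / fact (Suc n)" .
    qed (use z in auto)
    also have "\<dots> \<le> (M * z) ^ Suc n / fact (Suc n) * 1"
      using z M0 by (intro mult_left_mono) auto
    finally show ?thesis by simp
  qed
  with c3 b2 show ?case by blast
qed

lemma continuous_on_unit_bounded:
  assumes "continuous_on {0..1::real} q"
  obtains M where "M \<ge> 0" "\<forall>z\<in>{0..1}. \<bar>q z\<bar> \<le> (M::real)"
proof -
  have "compact (q ` {0..1})" using assms compact_continuous_image by blast
  then have "bounded (q ` {0..1})" by (rule compact_imp_bounded)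
  then obtain M where "\<And>x. x \<in> q ` {0..1} \<Longrightarrow> norm x \<le> M" by (meson bounded_iff)
  then show ?thesis by (intro that[of "\<bar>M\<bar>"]) force+
qed

context
  fixes q :: "real \<Rightarrow> real"
  assumes q: "continuous_on {0..1} q"
begin

lemma picard_has_derivative:
  assumes z: "z \<in> {0..1}"
  shows "(picard q n has_real_derivative picard_deriv q n z) (at z within {0..1})"
    "(picard_deriv q (Suc n) has_real_derivative q z * picard q n z) (at z within {0..1})"
proof -
  obtain M where M: "\<forall>z\<in>{0..1}. \<bar>q z\<bar> \<le> M"
    using continuous_on_unit_bounded[OF q] by metis
  have c1: "continuous_on {0..1} (\<lambda>t. q t * picard q n t)" for n
    using picard_bounds[OF q M] q by (intro continuous_intros) auto
  have d: "(picard_deriv q (Suc n) has_real_derivative q z * picard q n z) (at z within {0..1})"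
    if "z \<in> {0..1}" for z n
    using has_real_derivative_integral_within[OF c1 that] by simp
  then show "(picard_deriv q (Suc n) has_real_derivative q z * picard q n z) (at z within {0..1})"
    using z by blast
  show "(picard q n has_real_derivative picard_deriv q n z) (at z within {0..1})"
  proof (cases n)
    case (Suc m)
    have "continuous_on {0..1} (picard_deriv q (Suc m))"
      by (rule DERIV_continuous_on, erule d)
    from has_real_derivative_integral_within[OF this z] show ?thesis by (simp add: Suc)
  qed simp
qed

lemma summable_exp_like: "summable (\<lambda>n. (a::real) ^ n / fact n)"
  using summable_exp[of a] by (simp add: field_simps)

lemma picard_term_bound:
  assumes M: "M \<ge> 0" "\<forall>z\<in>{0..1}. \<bar>q z\<bar> \<le> M" and z: "z \<in> {0..1}" and l: "\<bar>l\<bar> \<le> L"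
  shows "norm (l ^ n * picard q n z) \<le> (L * M) ^ n / fact n"
    "norm (l ^ n * picard_deriv q n z) \<le> (L * M) ^ n / fact n"
proof -
  have le: "(M * z) ^ n / fact n \<le> M ^ n / fact n"
    using z M by (intro divide_right_mono power_mono) (auto simp: mult_left_le)
  have "norm (l ^ n * a) \<le> (L * M) ^ n / fact n" if "\<bar>a\<bar> \<le> (M * z) ^ n / fact n" for a
  proof -
    have "norm (l ^ n * a) = \<bar>l\<bar> ^ n * \<bar>a\<bar>" by (simp add: abs_mult power_abs)
    also have "\<dots> \<le> L ^ n * (M ^ n / fact n)"
      using that le l by (intro mult_mono power_mono) auto
    finally show ?thesis by (simp add: power_mult_distrib)
  qed
  with picard_bounds[OF q M(2), of n] z
  show "norm (l ^ n * picard q n z) \<le> (L * M) ^ n / fact n"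
    "norm (l ^ n * picard_deriv q n z) \<le> (L * M) ^ n / fact n" by auto
qed

lemma lin_sol_has_derivative:
  assumes z: "z \<in> {0..1}"
  shows "(lin_sol q l has_real_derivative lin_sol_deriv q l z) (at z within {0..1})"
    "(lin_sol_deriv q l has_real_derivative l * q z * lin_sol q l z) (at z within {0..1})"
proof -
  obtain M where M: "M \<ge> 0" "\<forall>z\<in>{0..1}. \<bar>q z\<bar> \<le> M"
    using continuous_on_unit_bounded[OF q] by metis
  note bd = picard_term_bound[OF M, of _ l "\<bar>l\<bar>", OF _ order_refl]
  note sm = summable_exp_like[of "\<bar>l\<bar> * M"]
  have sum1: "summable (\<lambda>n. l ^ n * picard q n z)" "summable (\<lambda>n. l ^ n * picard_deriv q n z)"
    if "z \<in> {0..1}" for z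
    using bd[OF that] by (auto intro: summable_comparison_test'[OF sm])
  have u1: "uniform_limit {0..1} (\<lambda>n z. \<Sum>i<n. l ^ i * picard_deriv q i z) (lin_sol_deriv q l) sequentially"
    unfolding lin_sol_deriv_def[abs_def] by (rule Weierstrass_m_test[OF bd(2) sm])
  have "\<exists>g. \<forall>x\<in>{0..1}. (\<lambda>n. l ^ n * picard q n x) sums g x \<and>
      (g has_field_derivative lin_sol_deriv q l x) (at x within {0..1})"
    by (rule has_field_derivative_series[OF _ _ u1, of _ 0])
      (use sum1 in \<open>auto intro!: DERIV_cmult picard_has_derivative\<close>)
  then obtain g where g: "\<And>x. x \<in> {0..1} \<Longrightarrow> (\<lambda>n. l ^ n * picard q n x) sums g x"
     "\<And>x. x \<in> {0..1} \<Longrightarrow> (g has_field_derivative lin_sol_deriv q l x) (at x within {0..1})" by blast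
  show "(lin_sol q l has_real_derivative lin_sol_deriv q l z) (at z within {0..1})"
    by (rule has_field_derivative_transform_within[OF g(2)[OF z], of 1])
      (use z g(1) in \<open>auto simp: lin_sol_def sums_iff\<close>)
  \<comment> \<open>\<open>picard_deriv\<close> at n + 1 differentiates to \<open>q\<close> times
    \<open>picard\<close> at n, so the differentiated series is shifted by one index; its term at 0
    is 0 because \<open>picard_deriv q 0\<close> is constant. The majorant \<open>m\<close> is
    shifted in the same way.\<close>
  define e where "e n x = (case n of 0 \<Rightarrow> 0 | Suc m \<Rightarrow> q x * picard q m x)" for n x
  define m where "m n = (case n of 0 \<Rightarrow> 0 | Suc k \<Rightarrow> \<bar>l\<bar> * M * ((\<bar>l\<bar> * M) ^ k / fact k))" for n
  have m: "summable m"
    using summable_mult[OF sm, of "\<bar>l\<bar> * M"] by (subst summable_Suc_iff[symmetric]) (simp add: m_def)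
  have em: "norm (l ^ n * e n x) \<le> m n" if "x \<in> {0..1}" for n x
  proof (cases n)
    case (Suc k)
    have "norm (l ^ n * e n x) = \<bar>l\<bar> * \<bar>q x\<bar> * norm (l ^ k * picard q k x)"
      by (simp add: Suc e_def abs_mult)
    also have "\<dots> \<le> \<bar>l\<bar> * M * ((\<bar>l\<bar> * M) ^ k / fact k)"
      using bd(1)[OF that] M that by (intro mult_mono) auto
    finally show ?thesis by (simp add: m_def Suc)
  qed (simp add: e_def m_def)
  have esum: "(\<lambda>n. l ^ n * e n x) sums (l * q x * lin_sol q l x)" if "x \<in> {0..1}" for x
  proof -
    have "(\<lambda>n. l * q x * (l ^ n * picard q n x)) sums (l * q x * lin_sol q l x)"
      unfolding lin_sol_def by (intro sums_mult summable_sums sum1 that)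
    then have "(\<lambda>n. l ^ Suc n * e (Suc n) x) sums (l * q x * lin_sol q l x)"
      by (simp add: e_def mult_ac)
    then show ?thesis by (subst (asm) sums_Suc_iff) (simp add: e_def)
  qed
  have u2: "uniform_limit {0..1} (\<lambda>n x. \<Sum>i<n. l ^ i * e i x) (\<lambda>x. l * q x * lin_sol q l x) sequentially"
  proof (rule uniform_limit_cong'[THEN iffD1, rotated 2])
    show "uniform_limit {0..1} (\<lambda>n x. \<Sum>i<n. l ^ i * e i x) (\<lambda>x. \<Sum>n. l ^ n * e n x) sequentially"
      by (rule Weierstrass_m_test[OF em m])
  qed (use esum in \<open>auto simp: sums_iff\<close>)
  have de: "(picard_deriv q n has_real_derivative e n x) (at x within {0..1})" if "x \<in> {0..1}" for n x
    by (cases n) (use picard_has_derivative(2)[OF that] in \<open>auto simp: e_def\<close>)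
  have "\<exists>g. \<forall>x\<in>{0..1}. (\<lambda>n. l ^ n * picard_deriv q n x) sums g x \<and>
      (g has_field_derivative l * q x * lin_sol q l x) (at x within {0..1})"
    by (rule has_field_derivative_series[OF _ _ u2, of _ 0])
      (use sum1 in \<open>auto intro!: DERIV_cmult de\<close>)
  then obtain h where h: "\<And>x. x \<in> {0..1} \<Longrightarrow> (\<lambda>n. l ^ n * picard_deriv q n x) sums h x"
     "\<And>x. x \<in> {0..1} \<Longrightarrow> (h has_field_derivative l * q x * lin_sol q l x) (at x within {0..1})" by blast
  show "(lin_sol_deriv q l has_real_derivative l * q z * lin_sol q l z) (at z within {0..1})"
    by (rule has_field_derivative_transform_within[OF h(2)[OF z], of 1])
      (use z h(1) in \<open>auto simp: lin_sol_deriv_def sums_iff\<close>)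
qed

lemma lin_sol_0: "lin_sol q l 0 = 1" "lin_sol_deriv q l 0 = 0"
proof -
  have "(\<lambda>n. l ^ n * picard q n 0) = (\<lambda>n. if n = 0 then 1 else 0)"
  proof
    fix n show "l ^ n * picard q n 0 = (if n = 0 then 1 else 0)" by (cases n) auto
  qed
  then show "lin_sol q l 0 = 1" unfolding lin_sol_def using sums_If_finite[of "\<lambda>n. n = 0" "\<lambda>_. 1::real"] by (simp add: sums_iff)
  have "(\<lambda>n. l ^ n * picard_deriv q n 0) = (\<lambda>n. 0)"
  proof
    fix n show "l ^ n * picard_deriv q n 0 = 0" by (cases n) auto
  qed
  then show "lin_sol_deriv q l 0 = 0" unfolding lin_sol_deriv_def by simp
qed

text \<open>On a bounded range of parameters the series has a summable majorant that depends on
  neither variable, so the convergence is uniform on the rectangle.\<close>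

lemma lin_sol_jointly_continuous:
  "continuous_on ({-L..L} \<times> {0..1}) (\<lambda>(l, z). lin_sol q l z)"
proof -
  obtain M where M: "M \<ge> 0" "\<forall>z\<in>{0..1}. \<bar>q z\<bar> \<le> M"
    using continuous_on_unit_bounded[OF q] by metis
  have "uniform_limit ({-L..L} \<times> {0..1}) (\<lambda>n x. \<Sum>i<n. (fst x) ^ i * picard q i (snd x))
      (\<lambda>x. \<Sum>i. (fst x) ^ i * picard q i (snd x)) sequentially"
    by (rule Weierstrass_m_test[OF _ summable_exp_like[of "L * M"]])
      (use picard_term_bound[OF M, of _ _ L] in auto)
  then have "continuous_on ({-L..L} \<times> {0..1}) (\<lambda>x. \<Sum>i. (fst x) ^ i * picard q i (snd x))"
  proof (rule uniform_limit_theorem[rotated])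
    have c: "continuous_on {0..1} (picard q i)" for i
      using picard_bounds[OF q M(2)] by blast
    have "continuous_on ({-L..L} \<times> {0..1}) (\<lambda>x. picard q i (snd x))" for i
      by (rule continuous_on_compose2[OF c]) (auto intro!: continuous_intros)
    then show "\<forall>\<^sub>F n in sequentially. continuous_on ({-L..L} \<times> {0..1}) (\<lambda>x. \<Sum>i<n. (fst x) ^ i * picard q i (snd x))"
      by (intro always_eventually allI continuous_intros)
  qed simp
  then show ?thesis by (simp add: lin_sol_def case_prod_unfold)
qed

end

lemma nondecreasing_on_unit:
  fixes f :: "real \<Rightarrow> real"
  assumes "0 \<le> z" "z \<le> 1" "continuous_on {0..z} f"
    and "\<And>x. 0 < x \<Longrightarrow> x < z \<Longrightarrow> (f has_real_derivative f' x) (at x within {0..1})"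
    and "\<And>x. 0 < x \<Longrightarrow> x < z \<Longrightarrow> f' x \<ge> 0"
  shows "f 0 \<le> f z"
proof (rule DERIV_nonneg_imp_increasing_open[OF assms(1)])
  fix x assume x: "0 < x" "x < z"
  have "at x within {0..1} = at x" using x assms by (intro at_within_interior) auto
  then show "\<exists>y. (f has_real_derivative y) (at x) \<and> y \<ge> 0" using assms x by metis
qed (use assms in auto)

section \<open>Solvability of the Riccati equation and positivity of the linear solution\<close>

definition riccati_solution :: "(real \<Rightarrow> real) \<Rightarrow> real \<Rightarrow> (real \<Rightarrow> real) \<Rightarrow> bool" where
  "riccati_solution q l y \<longleftrightarrow> y 0 = 0 \<and>
     (\<forall>z\<in>{0..1}. (y has_real_derivative l * q z - (y z)\<^sup>2 / 2) (at z within {0..1}))"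

definition riccati_solvable :: "(real \<Rightarrow> real) \<Rightarrow> real \<Rightarrow> bool" where
  "riccati_solvable q l \<longleftrightarrow> (\<exists>y. riccati_solution q l y)"

context
  fixes q :: "real \<Rightarrow> real"
  assumes q: "continuous_on {0..1} q"
begin

abbreviation (input) "ric_lin \<equiv> lin_sol (\<lambda>z. q z / 2)"
abbreviation (input) "ric_lin_deriv \<equiv> lin_sol_deriv (\<lambda>z. q z / 2)"

lemma half_continuous: "continuous_on {0..1} (\<lambda>z. q z / 2)"
  using q by (intro continuous_intros) auto

lemmas ric_lin_has_derivative = lin_sol_has_derivative[OF half_continuous]
lemmas ric_lin_0 = lin_sol_0[OF half_continuous]

lemma ric_lin_continuous: "continuous_on {0..1} (ric_lin l)" "continuous_on {0..1} (ric_lin_deriv l)"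
  by (rule DERIV_continuous_on, erule ric_lin_has_derivative)+

text \<open>Write v for the linear solution and H for the primitive of \<eta>/2. The derivative of
  (2 v' - \<eta> v) e^H is v (l q - \<eta>' - \<eta>^2/2) e^H, which is nonnegative as long as v is.
  So 2 v' \<ge> \<eta> v, which makes v e^(-H) nondecreasing and gives v \<ge> e^H up to and
  including the first point where v could vanish.\<close>

lemma subsolution_imp_positive:
  assumes e0: "\<eta> 0 \<le> 0"
    and e: "\<And>z. z \<in> {0..1} \<Longrightarrow> (\<eta> has_real_derivative \<eta>' z) (at z within {0..1})"
    and le: "\<And>z. z \<in> {0..1} \<Longrightarrow> \<eta>' z \<le> l * q z - (\<eta> z)\<^sup>2 / 2"
    and z: "z \<in> {0..1}"
  shows "ric_lin l z > 0"
proof -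
  have ce: "continuous_on {0..1} \<eta>" by (rule DERIV_continuous_on, erule e)
  define H where "H z = integral {0..z} (\<lambda>t. \<eta> t / 2)" for z
  have H: "(H has_real_derivative \<eta> z / 2) (at z within {0..1})" if "z \<in> {0..1}" for z
    unfolding H_def using ce that by (intro has_real_derivative_integral_within continuous_intros) auto
  have cH: "continuous_on {0..1} H" by (rule DERIV_continuous_on, erule H)
  have H0: "H 0 = 0" by (simp add: H_def)
  have step: "ric_lin l z \<ge> exp (H z)" if z: "z \<in> {0..1}" and pos: "\<And>t. 0 \<le> t \<Longrightarrow> t < z \<Longrightarrow> ric_lin l t > 0" for z
  proof -
    define m where "m t = (2 * ric_lin_deriv l t - \<eta> t * ric_lin l t) * exp (H t)" for t
    have m: "m t \<ge> 0" if t: "t \<in> {0..z}" for t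
    proof -
      have "m 0 \<le> m t"
      proof (rule nondecreasing_on_unit)
        show "continuous_on {0..t} m" unfolding m_def
          using t z by (intro continuous_intros continuous_on_subset[OF ce]
             continuous_on_subset[OF cH] continuous_on_subset[OF ric_lin_continuous(1)]
             continuous_on_subset[OF ric_lin_continuous(2)]) auto
        fix x assume x: "0 < x" "x < t"
        then have x1: "x \<in> {0..1}" using t z by auto
        show "(m has_real_derivative ric_lin l x * (l * q x - \<eta>' x - (\<eta> x)\<^sup>2 / 2) * exp (H x)) (at x within {0..1})"
          unfolding m_def
          by (rule derivative_eq_intros ric_lin_has_derivative[OF x1] e[OF x1] H[OF x1] refl)+
            (simp add: algebra_simps power2_eq_square)
        show "ric_lin l x * (l * q x - \<eta>' x - (\<eta> x)\<^sup>2 / 2) * exp (H x) \<ge> 0"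
          using le[OF x1] pos[of x] x t by auto
      qed (use t z in auto)
      moreover have "m 0 \<ge> 0" using e0 by (simp add: m_def ric_lin_0 H0)
      ultimately show ?thesis by simp
    qed
    have "ric_lin l 0 * exp (- H 0) \<le> ric_lin l z * exp (- H z)"
    proof (rule nondecreasing_on_unit)
      show "continuous_on {0..z} (\<lambda>z. ric_lin l z * exp (- H z))"
        using z by (intro continuous_intros
           continuous_on_subset[OF cH] continuous_on_subset[OF ric_lin_continuous(1)]) auto
      fix x assume x: "0 < x" "x < z"
      then have x1: "x \<in> {0..1}" using z by auto
      show "((\<lambda>z. ric_lin l z * exp (- H z)) has_real_derivative (2 * ric_lin_deriv l x - \<eta> x * ric_lin l x) * exp (- H x) / 2) (at x within {0..1})"
        by (rule derivative_eq_intros ric_lin_has_derivative[OF x1] e[OF x1] H[OF x1] refl)+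
          (simp add: algebra_simps power2_eq_square)
      have "2 * ric_lin_deriv l x - \<eta> x * ric_lin l x \<ge> 0"
        using m[of x] x by (simp add: m_def zero_le_mult_iff)
      then show "(2 * ric_lin_deriv l x - \<eta> x * ric_lin l x) * exp (- H x) / 2 \<ge> 0" by simp
    qed (use z in auto)
    then have "1 \<le> ric_lin l z * exp (- H z)" by (simp add: ric_lin_0 H0)
    then have "1 * exp (H z) \<le> ric_lin l z * exp (- H z) * exp (H z)" by (intro mult_right_mono) auto
    also have "\<dots> = ric_lin l z" by (simp add: exp_minus)
    finally show ?thesis by simp
  qed
  show ?thesis
  proof (rule ccontr)
    assume neg: "\<not> ?thesis"
    \<comment> \<open>Before the least point of \<open>S\<close> the linear solution is positive, so
      \<open>step\<close> applies at that point and contradicts membership in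
      \<open>S\<close>.\<close>
    define S where "S = {t \<in> {0..1}. ric_lin l t \<le> 0}"
    have "closed ({0..1} \<inter> ric_lin l -` {..0})"
      by (rule continuous_closed_preimage[OF ric_lin_continuous(1)]) auto
    moreover have "{0..1} \<inter> ric_lin l -` {..0} = S" by (auto simp: S_def)
    ultimately have "closed S" by simp
    moreover have "bounded S" by (rule bounded_subset[of "{0..1}"]) (auto simp: S_def)
    ultimately have "compact S" by (simp add: compact_eq_bounded_closed)
    moreover have "S \<noteq> {}" using neg z by (auto simp: S_def)
    ultimately obtain w where w: "w \<in> S" "\<And>t. t \<in> S \<Longrightarrow> w \<le> t"
      using compact_attains_inf by metis
    have "ric_lin l w \<ge> exp (H w)"
    proof (rule step)
      fix t assume t: "0 \<le> t" "t < w"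
      show "ric_lin l t > 0"
      proof (rule ccontr)
        assume "\<not> ric_lin l t > 0"
        then have "t \<in> S" using t w(1) by (auto simp: S_def)
        then show False using w(2)[of t] t by simp
      qed
    qed (use w in \<open>auto simp: S_def\<close>)
    moreover have "ric_lin l w \<le> 0" using w by (simp add: S_def)
    ultimately show False using exp_gt_zero[of "H w"] by linarith
  qed
qed

lemma positive_imp_riccati_solution:
  assumes pos: "\<And>z. z \<in> {0..1} \<Longrightarrow> ric_lin l z > 0"
  shows "riccati_solution q l (\<lambda>z. 2 * ric_lin_deriv l z / ric_lin l z)"
  unfolding riccati_solution_def
proof safe
  show "2 * ric_lin_deriv l 0 / ric_lin l 0 = 0" by (simp add: ric_lin_0)
  fix z :: real assume z: "z \<in> {0..1}"
  show "((\<lambda>z. 2 * ric_lin_deriv l z / ric_lin l z) has_real_derivative l * q z - (2 * ric_lin_deriv l z / ric_lin l z)\<^sup>2 / 2) (at z within {0..1})"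
    using pos[OF z]
    by (auto intro!: derivative_eq_intros ric_lin_has_derivative[OF z] simp: field_simps power2_eq_square)
qed

lemma riccati_solvable_iff: "riccati_solvable q l \<longleftrightarrow> (\<forall>z\<in>{0..1}. ric_lin l z > 0)"
proof
  assume "riccati_solvable q l"
  then obtain y where y: "riccati_solution q l y" by (auto simp: riccati_solvable_def)
  show "\<forall>z\<in>{0..1}. ric_lin l z > 0"
    by (intro ballI subsolution_imp_positive[of y])
      (use y in \<open>auto simp: riccati_solution_def\<close>)
next
  assume "\<forall>z\<in>{0..1}. ric_lin l z > 0"
  then show "riccati_solvable q l"
    unfolding riccati_solvable_def using positive_imp_riccati_solution by blast
qed

lemma subsolution_imp_solvable:
  assumes "\<eta> 0 \<le> 0"
    and "\<And>z. z \<in> {0..1} \<Longrightarrow> (\<eta> has_real_derivative \<eta>' z) (at z within {0..1})"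
    and "\<And>z. z \<in> {0..1} \<Longrightarrow> \<eta>' z \<le> l * q z - (\<eta> z)\<^sup>2 / 2"
  shows "riccati_solvable q l"
  unfolding riccati_solvable_iff using subsolution_imp_positive[of \<eta> \<eta>' l] assms by blast

text \<open>Meant for a function read off from a flow, which is known on [0,1) only. The two
  monotone quantities of the comparison argument are now constant: 2 v' = y v and v = e^H on [0,1).
  The bound on y gives v \<ge> e^(-M/2) there, and this lower bound passes to z = 1.\<close>

lemma bounded_riccati_unique:
  assumes y0: "y 0 = 0" and cy: "continuous_on {0..<1} y"
    and y: "\<And>z. 0 < z \<Longrightarrow> z < 1 \<Longrightarrow> (y has_real_derivative l * q z - (y z)\<^sup>2 / 2) (at z)"
    and M: "\<And>z. 0 \<le> z \<Longrightarrow> z < 1 \<Longrightarrow> \<bar>y z\<bar> \<le> M"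
  shows "riccati_solvable q l" "\<And>z. 0 \<le> z \<Longrightarrow> z < 1 \<Longrightarrow> y z = 2 * ric_lin_deriv l z / ric_lin l z"
proof -
  define H where "H z = integral {0..z} (\<lambda>t. y t / 2)" for z
  have cyb: "continuous_on {0..b} (\<lambda>t. y t / 2)" if "b < 1" for b
    using that by (intro continuous_intros continuous_on_subset[OF cy]) auto
  have Hb: "(H has_real_derivative y z / 2) (at z within {0..b})" if "b < 1" "z \<in> {0..b}" for z b
    unfolding H_def using integral_has_real_derivative[OF cyb[OF that(1)] that(2)] .
  have H: "(H has_real_derivative y z / 2) (at z)" if "0 < z" "z < 1" for z
  proof -
    have "at z within {0..(z+1)/2} = at z" using that by (intro at_within_interior) auto
    with Hb[of "(z+1)/2" z] that show ?thesis by simp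
  qed
  have cH: "continuous_on {0..b} H" if "b < 1" for b
    by (rule DERIV_continuous_on, erule Hb[OF that])
  have H0: "H 0 = 0" by (simp add: H_def)
  have V1: "(ric_lin l has_real_derivative ric_lin_deriv l z) (at z)"
      "(ric_lin_deriv l has_real_derivative l * (q z / 2) * ric_lin l z) (at z)" if "0 < z" "z < 1" for z
  proof -
    have "at z within {0..1} = at z" using that by (intro at_within_interior) auto
    with ric_lin_has_derivative[of z l] that show "(ric_lin l has_real_derivative ric_lin_deriv l z) (at z)"
      "(ric_lin_deriv l has_real_derivative l * (q z / 2) * ric_lin l z) (at z)" by simp_all
  qed
  have cV: "continuous_on {0..b} (ric_lin l)" "continuous_on {0..b} (ric_lin_deriv l)" if "b < 1" for b
    using that by (auto intro!: continuous_on_subset[OF ric_lin_continuous(1)] continuous_on_subset[OF ric_lin_continuous(2)])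
  have m: "2 * ric_lin_deriv l b - y b * ric_lin l b = 0" if b: "0 \<le> b" "b < 1" for b
  proof -
    have "(2 * ric_lin_deriv l b - y b * ric_lin l b) * exp (H b) = (2 * ric_lin_deriv l 0 - y 0 * ric_lin l 0) * exp (H 0)"
    proof (cases "b = 0")
      case False
      show ?thesis
      proof (rule DERIV_isconst2[of 0 b])
        show "continuous_on {0..b} (\<lambda>b. (2 * ric_lin_deriv l b - y b * ric_lin l b) * exp (H b))"
          using b by (intro continuous_intros cV cH continuous_on_subset[OF cy]) auto
        fix x assume x: "0 < x" "x < b"
        then have x1: "0 < x" "x < 1" using b by auto
        show "((\<lambda>b. (2 * ric_lin_deriv l b - y b * ric_lin l b) * exp (H b)) has_real_derivative 0) (at x)"
          by (rule derivative_eq_intros V1[OF x1] H[OF x1] y[OF x1] refl)+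
            (simp add: algebra_simps power2_eq_square)
      qed (use False b in auto)
    qed simp
    then show ?thesis by (simp add: ric_lin_0 y0)
  qed
  have e: "ric_lin l b = exp (H b)" if b: "0 \<le> b" "b < 1" for b
  proof -
    have "ric_lin l b * exp (- H b) = ric_lin l 0 * exp (- H 0)"
    proof (cases "b = 0")
      case False
      show ?thesis
      proof (rule DERIV_isconst2[of 0 b])
        show "continuous_on {0..b} (\<lambda>b. ric_lin l b * exp (- H b))"
          using b by (intro continuous_intros cV cH) auto
        fix x assume x: "0 < x" "x < b"
        then have x1: "0 < x" "x < 1" using b by auto
        have "2 * ric_lin_deriv l x = y x * ric_lin l x" using m[of x] x1 by simp
        then show "((\<lambda>b. ric_lin l b * exp (- H b)) has_real_derivative 0) (at x)"
          by (auto intro!: derivative_eq_intros V1[OF x1] H[OF x1] simp: algebra_simps)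
      qed (use False b in auto)
    qed simp
    then have "ric_lin l b * exp (- H b) = 1" by (simp add: ric_lin_0 H0)
    then show ?thesis by (simp add: exp_minus field_simps)
  qed
  have low: "ric_lin l b \<ge> exp (- M / 2)" if b: "0 \<le> b" "b < 1" for b
  proof -
    have M0: "M \<ge> 0" using M[of 0] by simp
    have "norm (H b) \<le> M / 2 * (b - 0)" unfolding H_def
      by (rule integral_bound[OF _ cyb]) (use b M in auto)
    also have "\<dots> \<le> M / 2 * 1" using b M0 by (intro mult_left_mono) auto
    finally show ?thesis using e[OF b] by auto
  qed
  have "ric_lin l z > 0" if z: "z \<in> {0..1}" for z
  proof (cases "z < 1")
    case True
    then show ?thesis using e[of z] z by auto
  next
    case False
    then have z1: "z = 1" using z by simp
    have "(ric_lin l \<longlongrightarrow> ric_lin l 1) (at 1 within {0..1})"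
      using ric_lin_continuous(1)[of l] by (auto simp: continuous_on_def)
    then have "(ric_lin l \<longlongrightarrow> ric_lin l 1) (at_left 1)"
      by (simp add: at_within_Icc_at_left)
    moreover have "eventually (\<lambda>x. ric_lin l x \<ge> exp (- M / 2)) (at_left 1)"
      using eventually_at_left_real[of 0 1] by (rule eventually_mono) (use low in auto)
    ultimately have "ric_lin l 1 \<ge> exp (- M / 2)"
      by (rule tendsto_lowerbound) simp
    then show ?thesis unfolding z1 using exp_gt_zero[of "-M/2"] by linarith
  qed
  then show "riccati_solvable q l" by (simp add: riccati_solvable_iff)
  fix z :: real assume z: "0 \<le> z" "z < 1"
  show "y z = 2 * ric_lin_deriv l z / ric_lin l z"
    using m[OF z] e[OF z] by (simp add: field_simps)
qed

lemma riccati_solution_unique: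
  assumes "riccati_solution q l y" "0 \<le> z" "z < 1"
  shows "y z = 2 * ric_lin_deriv l z / ric_lin l z"
proof -
  have d: "(y has_real_derivative l * q z - (y z)\<^sup>2 / 2) (at z within {0..1})" if "z \<in> {0..1}" for z
    using that assms by (auto simp: riccati_solution_def)
  then have c: "continuous_on {0..1} y" by (intro DERIV_continuous_on)
  obtain M where M: "\<forall>z\<in>{0..1}. \<bar>y z\<bar> \<le> M"
    using continuous_on_unit_bounded[OF c] by metis
  show ?thesis
  proof (rule bounded_riccati_unique(2)[of y l M])
    show "continuous_on {0..<1} y" by (rule continuous_on_subset[OF c]) auto
    fix z :: real assume z: "0 < z" "z < 1"
    have "at z within {0..1} = at z" using z by (intro at_within_interior) auto
    then show "(y has_real_derivative l * q z - (y z)\<^sup>2 / 2) (at z)" using d[of z] z by simp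
  qed (use assms M in \<open>auto simp: riccati_solution_def\<close>)
qed

section \<open>Dependence of solvability on the parameter\<close>

lemma riccati_solvable_scale:
  assumes "riccati_solvable q l" "0 \<le> t" "t \<le> 1"
  shows "riccati_solvable q (t * l)"
proof -
  obtain y where y: "riccati_solution q l y" using assms by (auto simp: riccati_solvable_def)
  show ?thesis
  proof (rule subsolution_imp_solvable)
    fix z :: real assume z: "z \<in> {0..1}"
    show "((\<lambda>z. t * y z) has_real_derivative t * (l * q z - (y z)\<^sup>2 / 2)) (at z within {0..1})"
      using y z by (intro DERIV_cmult) (auto simp: riccati_solution_def)
    \<comment> \<open>The inequality t^2 \<le> t makes t y a subsolution for the parameter t
      l.\<close>
    have "t * t * (y z)\<^sup>2 \<le> t * (y z)\<^sup>2"
      using assms by (intro mult_right_mono) (auto simp: mult_left_le)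
    then show "t * (l * q z - (y z)\<^sup>2 / 2) \<le> t * l * q z - (t * y z)\<^sup>2 / 2"
      by (simp add: algebra_simps power2_eq_square)
  qed (use y in \<open>auto simp: riccati_solution_def\<close>)
qed

lemma riccati_solvable_nonneg:
  assumes "\<And>z. z \<in> {0..1} \<Longrightarrow> l * q z \<ge> 0"
  shows "riccati_solvable q l"
  by (rule subsolution_imp_solvable[of "\<lambda>_. 0" "\<lambda>_. 0"]) (use assms in auto)

text \<open>Where l q \<le> -c^2/2, the equation gives y' \<le> -(c^2 + y^2)/2. Thus arctan (y/c)
  falls at a rate of at least c/2, while all its values lie in an open interval of length
  \<pi>.\<close>

lemma riccati_solvable_length_bound:
  assumes "riccati_solvable q l" and ab: "0 \<le> a" "a < b" "b \<le> 1" and c: "c > 0"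
    and le: "\<And>z. z \<in> {a..b} \<Longrightarrow> l * q z \<le> - c\<^sup>2 / 2"
  shows "c * (b - a) < 2 * pi"
proof -
  obtain y where y: "\<And>z. z \<in> {0..1} \<Longrightarrow> (y has_real_derivative l * q z - (y z)\<^sup>2 / 2) (at z within {0..1})"
    using assms(1) unfolding riccati_solvable_def riccati_solution_def by blast
  have cy: "continuous_on {a..b} y"
    using ab by (intro continuous_on_subset[OF DERIV_continuous_on[OF y]]) auto
  define T where "T z = arctan (y z / c) + c / 2 * z" for z
  have "T b \<le> T a"
  proof (rule DERIV_nonpos_imp_decreasing_open[of a b T])
    show "continuous_on {a..b} T" unfolding T_def using c cy by (intro continuous_intros) auto
    fix x assume x: "a < x" "x < b"
    have "at x within {0..1} = at x" using x ab by (intro at_within_interior) auto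
    then have y1: "(y has_real_derivative l * q x - (y x)\<^sup>2 / 2) (at x)" using y[of x] x ab by simp
    have "(T has_real_derivative ((l * q x - (y x)\<^sup>2 / 2) / c) / (1 + (y x / c)\<^sup>2) + c / 2) (at x)"
      unfolding T_def using DERIV_add[OF DERIV_chain2[OF DERIV_arctan DERIV_cdivide[OF y1, of c]] DERIV_cmult_Id[of "c / 2"]]
      by (rule DERIV_cong) (metis divide_inverse mult.commute)
    moreover have "((l * q x - (y x)\<^sup>2 / 2) / c) / (1 + (y x / c)\<^sup>2) \<le> - c / 2"
    proof -
      have pos: "1 + (y x / c)\<^sup>2 > 0" by (simp add: add_pos_nonneg)
      have "l * q x - (y x)\<^sup>2 / 2 \<le> - c\<^sup>2 / 2 - (y x)\<^sup>2 / 2" using le[of x] x by simp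
      then have "(l * q x - (y x)\<^sup>2 / 2) / c \<le> (- c\<^sup>2 / 2 - (y x)\<^sup>2 / 2) / c"
        using c by (intro divide_right_mono) auto
      also have "\<dots> = - c / 2 * (1 + (y x / c)\<^sup>2)" using c by (simp add: field_simps power2_eq_square)
      finally show ?thesis using pos by (subst pos_divide_le_eq) auto
    qed
    ultimately show "\<exists>d. (T has_real_derivative d) (at x) \<and> d \<le> 0" by (intro exI conjI) auto
  qed (use ab in auto)
  moreover have "arctan (y a / c) < pi / 2" "- (pi / 2) < arctan (y b / c)"
    using arctan_bounded by blast+
  ultimately show ?thesis by (auto simp: T_def algebra_simps)
qed

text \<open>The points of a compact rectangle at which the linear solution is not positive form a
  compact set; its projection to the parameter axis is closed and misses \<open>l\<close>. The
  rectangle reaches one unit beyond \<open>l\<close>, so it covers \<open>ball l 1\<close>.\<close>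

lemma open_riccati_solvable: "open {l. riccati_solvable q l}"
proof (rule openI)
  fix l assume "l \<in> {l. riccati_solvable q l}"
  then have l: "\<forall>z\<in>{0..1}. ric_lin l z > 0" by (simp add: riccati_solvable_iff)
  define L where "L = \<bar>l\<bar> + 1"
  define B where "B = {x \<in> {-L..L} \<times> {0..1}. ric_lin (fst x) (snd x) \<le> 0}"
  have "closed B" unfolding B_def
    using continuous_closed_preimage[OF lin_sol_jointly_continuous[OF half_continuous, of L], of "{..0}"]
    by (simp add: vimage_def Int_def closed_Times case_prod_unfold)
  moreover have "bounded B"
    by (rule bounded_subset[of "{-L..L} \<times> {0..1}"]) (auto simp: B_def bounded_Times)
  ultimately have "compact B" by (simp add: compact_eq_bounded_closed)
  then have "compact (fst ` B)" by (intro compact_continuous_image continuous_intros)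
  then have cl: "closed (fst ` B)" by (rule compact_imp_closed)
  have "l \<notin> fst ` B" using l by (auto simp: B_def)
  then have "l \<in> ball l 1 \<inter> - fst ` B" by simp
  moreover have "open (ball l 1 \<inter> - fst ` B)" using cl by auto
  ultimately obtain e where e: "e > 0" "ball l e \<subseteq> ball l 1 \<inter> - fst ` B"
    by (meson open_contains_ball)
  have "riccati_solvable q m" if m: "m \<in> ball l e" for m
    unfolding riccati_solvable_iff
  proof
    fix z :: real assume z: "z \<in> {0..1}"
    have "m \<in> ball l 1" "m \<notin> fst ` B" using m e by auto
    then have "m \<in> {-L..L}" by (auto simp: L_def dist_real_def)
    then show "ric_lin m z > 0" using \<open>m \<notin> fst ` B\<close> z by (force simp: B_def)
  qed
  then show "\<exists>e>0. ball l e \<subseteq> {l. riccati_solvable q l}" using e by blast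
qed

text \<open>The sign \<open>\<sigma>\<close> treats both ends of the parameter range at once. On an
  interval of length r containing \<open>z0\<close> continuity gives \<open>\<sigma>\<close> q \<le>
  -m, hence l q \<le> -(\<open>\<sigma>\<close> l) m for positive \<open>\<sigma>\<close> l. With c
  = 2 \<pi> / r the length bound is violated as soon as 2 m (\<open>\<sigma>\<close> l) > c^2, which
  explains the constant.\<close>

lemma riccati_solvable_negative_bound:
  assumes z0: "z0 \<in> {0..1}" and neg: "\<sigma> * q z0 < 0" and \<sigma>: "\<bar>\<sigma>\<bar> = 1"
  obtains C where "\<And>l. riccati_solvable q l \<Longrightarrow> \<sigma> * l \<le> C"
proof -
  define m where "m = - \<sigma> * q z0 / 2"
  have m: "m > 0" using neg by (simp add: m_def)
  have "continuous_on {0..1} (\<lambda>z. \<sigma> * q z)" using q by (intro continuous_intros)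
  then obtain d where d: "d > 0" "\<And>z. z \<in> {0..1} \<Longrightarrow> \<bar>z - z0\<bar> < d \<Longrightarrow> \<bar>\<sigma> * q z - \<sigma> * q z0\<bar> < m"
    using z0 m unfolding continuous_on_iff dist_real_def by metis
  \<comment> \<open>Halving \<open>d\<close> makes the closed interval fit into the neighbourhood; r
    \<le> 1/2 allows it to be laid to the right or to the left of \<open>z0\<close> inside
    [0,1].\<close>
  define r where "r = min (d / 2) (1 / 2)"
  have r: "0 < r" "r < d" "r \<le> 1 / 2" using d by (auto simp: r_def)
  obtain a where a: "0 \<le> a" "a + r \<le> 1" "a \<le> z0" "z0 \<le> a + r"
  proof (cases "z0 \<le> 1/2")
    case True then show ?thesis using that[of z0] z0 r by auto
  next
    case False then show ?thesis using that[of "z0 - r"] z0 r by auto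
  qed
  show ?thesis
  proof (rule that[of "(2 * pi / r)\<^sup>2 / (2 * m)"])
    fix l assume l: "riccati_solvable q l"
    show "\<sigma> * l \<le> (2 * pi / r)\<^sup>2 / (2 * m)"
    proof (rule ccontr)
      assume "\<not> ?thesis"
      then have gt: "\<sigma> * l * (2 * m) > (2 * pi / r)\<^sup>2" using m by (simp add: not_le pos_divide_less_eq)
      have "0 \<le> (2 * pi / r)\<^sup>2" by simp
      with gt have "0 < \<sigma> * l * (2 * m)" by linarith
      then have sl: "\<sigma> * l > 0" using m by (simp add: zero_less_mult_iff)
      have "(2 * pi / r) * (a + r - a) < 2 * pi"
      proof (rule riccati_solvable_length_bound[OF l])
        fix z assume z: "z \<in> {a..a+r}"
        have "\<bar>\<sigma> * q z - \<sigma> * q z0\<bar> < m" using z a r by (intro d(2)) auto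
        then have "\<sigma> * q z \<le> - m" by (simp add: m_def abs_if field_simps split: if_splits)
        then have "(\<sigma> * l) * (\<sigma> * q z) \<le> (\<sigma> * l) * (- m)" using sl by (intro mult_left_mono) auto
        moreover have "\<sigma> * \<sigma> = 1" using \<sigma> by (metis abs_mult_self mult_1)
        moreover have "(\<sigma> * l) * (\<sigma> * q z) = (\<sigma> * \<sigma>) * (l * q z)" by (simp add: mult_ac)
        ultimately have "l * q z \<le> - (\<sigma> * l * m)" by simp
        then show "l * q z \<le> - (2 * pi / r)\<^sup>2 / 2" using gt by simp
      qed (use a r in auto)
      then show False using r by simp
    qed
  qed
qed

text \<open>An open set that is star-shaped about 0 is an open interval. Its ends are taken as
  infimum and supremum in \<open>ereal\<close>, so bounded and unbounded cases are treated alike;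
  openness excludes the ends themselves.\<close>

lemma riccati_interval:
  obtains lo hi :: ereal where "lo < 0" "0 < hi"
    "\<And>l. lo < ereal l \<and> ereal l < hi \<longleftrightarrow> riccati_solvable q l"
    "\<And>z. z \<in> {0..1} \<Longrightarrow> q z > 0 \<Longrightarrow> lo > -\<infinity>"
    "\<And>z. z \<in> {0..1} \<Longrightarrow> q z < 0 \<Longrightarrow> hi < \<infinity>"
    "(\<And>z. z \<in> {0..1} \<Longrightarrow> q z \<ge> 0) \<Longrightarrow> hi = \<infinity>"
    "(\<And>z. z \<in> {0..1} \<Longrightarrow> q z \<le> 0) \<Longrightarrow> lo = -\<infinity>"
proof -
  define S where "S = {l. riccati_solvable q l}"
  define lo where "lo = Inf (ereal ` S)"
  define hi where "hi = Sup (ereal ` S)"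
  have S0: "0 \<in> S" by (auto simp: S_def intro: riccati_solvable_nonneg)
  have op: "\<exists>e>0. \<forall>m. \<bar>m - l\<bar> < e \<longrightarrow> m \<in> S" if "l \<in> S" for l
  proof -
    have "open S" unfolding S_def by (rule open_riccati_solvable)
    then obtain e where "e > 0" "ball l e \<subseteq> S"
      by (rule openE[OF _ \<open>l \<in> S\<close>])
    moreover have "m \<in> ball l e" if "\<bar>m - l\<bar> < e" for m
      using that by (simp add: dist_real_def abs_minus_commute)
    ultimately show ?thesis by blast
  qed
  have "l \<in> S" if lt: "lo < ereal l" "ereal l < hi" for l
  proof -
    \<comment> \<open>On the side away from 0 some element of \<open>S\<close> lies beyond
      \<open>l\<close>, and \<open>l\<close> is that element scaled by a factor in [0,1].\<close>
    obtain a where a: "a \<in> S" "a < l" using lt(1) unfolding lo_def Inf_less_iff by auto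
    obtain b where b: "b \<in> S" "l < b" using lt(2) unfolding hi_def less_Sup_iff by auto
    show ?thesis
    proof (cases "l \<ge> 0")
      case True
      have "riccati_solvable q (l / b * b)"
        using b True by (intro riccati_solvable_scale) (auto simp: S_def)
      then show ?thesis using b True by (simp add: S_def)
    next
      case False
      have "riccati_solvable q (l / a * a)"
        using a False by (intro riccati_solvable_scale) (auto simp: S_def divide_le_eq divide_nonpos_neg)
      then show ?thesis using a False by (simp add: S_def)
    qed
  qed
  moreover have ends: "lo < ereal l" "ereal l < hi" if "l \<in> S" for l
  proof -
    obtain e where e: "e > 0" "\<And>m. \<bar>m - l\<bar> < e \<Longrightarrow> m \<in> S" using op[OF \<open>l \<in> S\<close>] by auto
    have "lo \<le> ereal (l - e/2)" unfolding lo_def using e by (intro Inf_lower imageI e) auto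
    also have "\<dots> < ereal l" using e by simp
    finally show "lo < ereal l" .
    have "ereal l < ereal (l + e/2)" using e by simp
    also have "\<dots> \<le> hi" unfolding hi_def using e by (intro Sup_upper imageI e) auto
    finally show "ereal l < hi" .
  qed
  ultimately have iff: "lo < ereal l \<and> ereal l < hi \<longleftrightarrow> riccati_solvable q l" for l
    by (auto simp: S_def)
  show ?thesis
  proof (rule that[OF _ _ iff])
    show "lo < 0" "0 < hi" using ends[OF S0] by (auto simp: zero_ereal_def)
  next
    fix z :: real assume z: "z \<in> {0..1}" "q z > 0"
    obtain C where "\<And>l. riccati_solvable q l \<Longrightarrow> -1 * l \<le> C"
      using riccati_solvable_negative_bound[OF z(1), of "-1"] z by auto
    then have "- C \<le> l" if "l \<in> S" for l
      using that unfolding S_def by force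
    then have "ereal (- C) \<le> lo"
      unfolding lo_def by (intro Inf_greatest) auto
    moreover have "- \<infinity> < ereal (- C)" by simp
    ultimately show "- \<infinity> < lo" by (rule less_le_trans[rotated])
  next
    fix z :: real assume z: "z \<in> {0..1}" "q z < 0"
    obtain C where "\<And>l. riccati_solvable q l \<Longrightarrow> 1 * l \<le> C"
      using riccati_solvable_negative_bound[OF z(1), of "1"] z by auto
    then have "hi \<le> ereal C"
      unfolding hi_def by (intro Sup_least) (auto simp: S_def)
    moreover have "ereal C < \<infinity>" by simp
    ultimately show "hi < \<infinity>" by (rule le_less_trans)
  next
    assume q0: "\<And>z. z \<in> {0..1} \<Longrightarrow> q z \<ge> 0"
    have "ereal r \<le> hi" for r
    proof -
      have "max r 0 \<in> S" unfolding S_def using q0 by (auto intro!: riccati_solvable_nonneg)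
      then have "ereal (max r 0) \<le> hi" unfolding hi_def by (intro Sup_upper imageI)
      then show ?thesis by (meson ereal_less_eq(3) max.cobounded1 order_trans)
    qed
    then show "hi = \<infinity>" by (meson ereal_top)
  next
    assume q0: "\<And>z. z \<in> {0..1} \<Longrightarrow> q z \<le> 0"
    have "lo \<le> ereal r" for r
    proof -
      have "min r 0 \<in> S" unfolding S_def using q0
        by (auto intro!: riccati_solvable_nonneg mult_nonpos_nonpos)
      then have "lo \<le> ereal (min r 0)" unfolding lo_def by (intro Inf_lower imageI)
      then show ?thesis by (meson ereal_less_eq(3) min.cobounded1 order_trans)
    qed
    then show "lo = - \<infinity>" by (meson ereal_bot)
  qed
qed

end

section \<open>Local Lipschitz regularity on the punctured closed half space\<close>

abbreviation S3 :: "(real^3) set" where "S3 \<equiv> punctured_closed_half_space"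

lemma closure_half_space: "closure half_space = {x. 0 \<le> x $ 3}"
  using closure_halfspace_component_gt[of 0 "3::3"] by (simp add: half_space_def)

lemma mem_S3: "x \<in> S3 \<longleftrightarrow> 0 \<le> x $ 3 \<and> x \<noteq> 0"
  by (auto simp: punctured_closed_half_space_def closure_half_space)

text \<open>Puncturing destroys convexity. A radius of at most the distance to the origin keeps the
  origin out of the open ball, so mean value estimates become available on the intersection.\<close>

lemma convex_S3_ball: "r \<le> norm x \<Longrightarrow> convex (S3 \<inter> ball x r)"
proof -
  assume r: "r \<le> norm x"
  have "0 \<notin> ball x r" using r by simp
  then have "S3 \<inter> ball x r = {x. x $ 3 \<ge> 0} \<inter> ball x r"
    by (auto simp: mem_S3 simp del: mem_ball)
  moreover have "convex {x::real^3. x $ 3 \<ge> 0}" by (auto simp: convex_def)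
  ultimately show ?thesis by (simp add: convex_Int)
qed

section \<open>Locally Lipschitz maps\<close>

definition loc_lipschitz :: "'a set \<Rightarrow> ('a::metric_space \<Rightarrow> 'b::real_normed_vector) \<Rightarrow> bool" where
  "loc_lipschitz S f \<longleftrightarrow> (\<forall>x\<in>S. \<exists>r>0. \<exists>L. \<forall>y\<in>S \<inter> ball x r. \<forall>z\<in>S \<inter> ball x r.
     norm (f y - f z) \<le> L * dist y z)"

text \<open>A single nonnegative constant bounds the difference quotients and the values; with it
  products and quotients can be estimated without tracking several constants.\<close>

definition lipschitz_near :: "'a set \<Rightarrow> ('a::metric_space \<Rightarrow> 'b::real_normed_vector) \<Rightarrow> 'a \<Rightarrow> real \<Rightarrow> real \<Rightarrow> bool" where
  "lipschitz_near S f x r L \<longleftrightarrow> r > 0 \<and> L \<ge> 0 \<and>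
     (\<forall>y\<in>S \<inter> ball x r. \<forall>z\<in>S \<inter> ball x r. norm (f y - f z) \<le> L * dist y z) \<and>
     (\<forall>y\<in>S \<inter> ball x r. norm (f y) \<le> L)"

lemma lipschitz_near_mono:
  assumes "lipschitz_near S f x r L" "0 < r'" "r' \<le> r" "L \<le> L'"
  shows "lipschitz_near S f x r' L'"
proof -
  have "norm (f y - f z) \<le> L' * dist y z" if "y \<in> S \<inter> ball x r'" "z \<in> S \<inter> ball x r'" for y z
  proof -
    have "norm (f y - f z) \<le> L * dist y z" using assms that by (auto simp: lipschitz_near_def)
    also have "\<dots> \<le> L' * dist y z" using assms by (intro mult_right_mono) auto
    finally show ?thesis .
  qed
  then show ?thesis using assms unfolding lipschitz_near_def by force
qed

lemma loc_lipschitzE: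
  assumes "loc_lipschitz S f" "x \<in> S"
  obtains r L where "lipschitz_near S f x r L"
proof -
  obtain r L where r: "r > 0" and L: "\<And>y z. y \<in> S \<inter> ball x r \<Longrightarrow> z \<in> S \<inter> ball x r \<Longrightarrow> norm (f y - f z) \<le> L * dist y z"
    using assms unfolding loc_lipschitz_def by metis
  show ?thesis
  \<comment> \<open>The given \<open>L\<close> may be negative, hence the absolute value. A radius
    of at most 1 turns |L| into a bound for the distance of \<open>f y\<close> from
    \<open>f x\<close>.\<close>
  proof (rule that[of "min r 1" "norm (f x) + \<bar>L\<bar>"], unfold lipschitz_near_def, intro conjI ballI)
    show "min r 1 > 0" "norm (f x) + \<bar>L\<bar> \<ge> 0" using r by auto
  next
    fix y z assume *: "y \<in> S \<inter> ball x (min r 1)" "z \<in> S \<inter> ball x (min r 1)"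
    have "norm (f y - f z) \<le> L * dist y z" using * by (intro L) auto
    also have "\<dots> \<le> (norm (f x) + \<bar>L\<bar>) * dist y z"
    proof (rule mult_right_mono)
      show "L \<le> norm (f x) + \<bar>L\<bar>" using norm_ge_zero[of "f x"] by linarith
    qed simp
    finally show "norm (f y - f z) \<le> (norm (f x) + \<bar>L\<bar>) * dist y z" .
  next
    fix y assume *: "y \<in> S \<inter> ball x (min r 1)"
    have "norm (f y - f x) \<le> L * dist y x" using * r assms by (intro L) auto
    also have "\<dots> \<le> \<bar>L\<bar> * dist y x" by (intro mult_right_mono) auto
    also have "\<dots> \<le> \<bar>L\<bar> * 1" using * by (intro mult_left_mono) (auto simp: dist_commute)
    finally have "norm (f y - f x) \<le> \<bar>L\<bar>" by simp
    moreover have "norm (f y) \<le> norm (f x) + norm (f y - f x)" by (metis norm_triangle_sub)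
    ultimately show "norm (f y) \<le> norm (f x) + \<bar>L\<bar>" by linarith
  qed
qed

lemma loc_lipschitz_pairE:
  assumes "loc_lipschitz S f" "loc_lipschitz S g" "x \<in> S"
  obtains r L where "lipschitz_near S f x r L" "lipschitz_near S g x r L"
proof -
  obtain r1 L1 where 1: "lipschitz_near S f x r1 L1" using loc_lipschitzE assms by blast
  obtain r2 L2 where 2: "lipschitz_near S g x r2 L2" using loc_lipschitzE assms by blast
  show ?thesis
    by (rule that[of "min r1 r2" "max L1 L2"]; rule lipschitz_near_mono[OF 1] lipschitz_near_mono[OF 2])
      (use 1 2 in \<open>auto simp: lipschitz_near_def\<close>)
qed

lemma loc_lipschitzI:
  assumes "\<And>x. x \<in> S \<Longrightarrow> \<exists>r>0. \<exists>L. \<forall>y\<in>S \<inter> ball x r. \<forall>z\<in>S \<inter> ball x r. norm (f y - f z) \<le> L * dist y z"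
  shows "loc_lipschitz S f"
  using assms unfolding loc_lipschitz_def by blast

lemma loc_lipschitz_continuous:
  assumes "loc_lipschitz S f" shows "continuous_on S f"
  unfolding continuous_on_iff
proof safe
  fix x e assume x: "x \<in> S" "0 < (e::real)"
  obtain r L where rL: "lipschitz_near S f x r L" by (rule loc_lipschitzE[OF assms x(1)])
  then have r: "r > 0" "L \<ge> 0" and L: "\<And>y z. y \<in> S \<inter> ball x r \<Longrightarrow> z \<in> S \<inter> ball x r \<Longrightarrow> norm (f y - f z) \<le> L * dist y z"
    unfolding lipschitz_near_def by auto
  show "\<exists>d>0. \<forall>x'\<in>S. dist x' x < d \<longrightarrow> dist (f x') (f x) < e"
  proof (intro exI[of _ "min r (e / (L + 1))"] conjI ballI impI)
    show "0 < min r (e / (L + 1))" using r x by auto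
    fix y assume y: "y \<in> S" "dist y x < min r (e / (L + 1))"
    have "norm (f y - f x) \<le> L * dist y x" using y x r by (intro L) (auto simp: dist_commute)
    also have "\<dots> \<le> (L + 1) * dist y x" by (intro mult_right_mono) auto
    also have "\<dots> < e" using y r by (auto simp: field_simps)
    finally show "dist (f y) (f x) < e" by (simp add: dist_norm)
  qed
qed

lemma loc_lipschitz_const [intro]: "loc_lipschitz S (\<lambda>_. c)"
  by (rule loc_lipschitzI, rule exI[of _ 1], simp, rule exI[of _ 0], simp)

lemma loc_lipschitz_add [intro]:
  assumes "loc_lipschitz S f" "loc_lipschitz S g" shows "loc_lipschitz S (\<lambda>x. f x + g x)"
proof (rule loc_lipschitzI)
  fix x assume x: "x \<in> S"
  obtain r L where 1: "lipschitz_near S f x r L" "lipschitz_near S g x r L"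
    by (rule loc_lipschitz_pairE[OF assms x])
  have "norm (f y + g y - (f z + g z)) \<le> 2 * L * dist y z" if "y \<in> S \<inter> ball x r" "z \<in> S \<inter> ball x r" for y z
  proof -
    have "norm (f y + g y - (f z + g z)) \<le> norm (f y - f z) + norm (g y - g z)"
      by (metis add_diff_add norm_triangle_ineq)
    also have "\<dots> \<le> L * dist y z + L * dist y z"
      using 1 that unfolding lipschitz_near_def by (intro add_mono) blast+
    finally show ?thesis by simp
  qed
  then show "\<exists>r>0. \<exists>L. \<forall>y\<in>S \<inter> ball x r. \<forall>z\<in>S \<inter> ball x r. norm (f y + g y - (f z + g z)) \<le> L * dist y z"
    using 1 unfolding lipschitz_near_def by blast
qed

lemma loc_lipschitz_scaleR [intro]:
  assumes "loc_lipschitz S f" "loc_lipschitz S g" shows "loc_lipschitz S (\<lambda>x. (f x::real) *\<^sub>R g x)"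
proof (rule loc_lipschitzI)
  fix x assume x: "x \<in> S"
  obtain r L where 1: "lipschitz_near S f x r L" "lipschitz_near S g x r L"
    by (rule loc_lipschitz_pairE[OF assms x])
  have "norm (f y *\<^sub>R g y - f z *\<^sub>R g z) \<le> 2 * L * L * dist y z" if "y \<in> S \<inter> ball x r" "z \<in> S \<inter> ball x r" for y z
  proof -
    have "f y *\<^sub>R g y - f z *\<^sub>R g z = (f y - f z) *\<^sub>R g y + f z *\<^sub>R (g y - g z)"
      by (simp add: algebra_simps)
    also have "norm \<dots> \<le> norm (f y - f z) * norm (g y) + norm (f z) * norm (g y - g z)"
      by (rule order_trans[OF norm_triangle_ineq]) simp
    also have "\<dots> \<le> (L * dist y z) * L + L * (L * dist y z)"
      using 1 that unfolding lipschitz_near_def by (intro add_mono mult_mono) (blast | simp)+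
    finally show ?thesis by (simp add: algebra_simps)
  qed
  then show "\<exists>r>0. \<exists>L. \<forall>y\<in>S \<inter> ball x r. \<forall>z\<in>S \<inter> ball x r. norm (f y *\<^sub>R g y - f z *\<^sub>R g z) \<le> L * dist y z"
    using 1 unfolding lipschitz_near_def by blast
qed

lemma loc_lipschitz_mult [intro]:
  assumes "loc_lipschitz S f" "loc_lipschitz S g" shows "loc_lipschitz S (\<lambda>x. (f x::real) * g x)"
  using loc_lipschitz_scaleR[OF assms] by simp

lemma loc_lipschitz_bounded_linear:
  assumes "bounded_linear T" "loc_lipschitz S f" shows "loc_lipschitz S (\<lambda>x. T (f x))"
proof (rule loc_lipschitzI)
  fix x assume x: "x \<in> S"
  obtain K where K: "K \<ge> 0" "\<And>v. norm (T v) \<le> norm v * K"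
    using bounded_linear.nonneg_bounded[OF assms(1)] by blast
  obtain r L where r: "r > 0" and L: "\<And>y z. y \<in> S \<inter> ball x r \<Longrightarrow> z \<in> S \<inter> ball x r \<Longrightarrow> norm (f y - f z) \<le> L * dist y z"
    using assms(2) x unfolding loc_lipschitz_def by metis
  have "norm (T (f y) - T (f z)) \<le> L * K * dist y z" if y: "y \<in> S \<inter> ball x r" "z \<in> S \<inter> ball x r" for y z
  proof -
    have "norm (T (f y) - T (f z)) \<le> norm (f y - f z) * K"
      using K(2)[of "f y - f z"] by (simp add: linear_diff[OF bounded_linear.linear[OF assms(1)]])
    also have "\<dots> \<le> L * dist y z * K" using L[OF y] K by (intro mult_right_mono)
    finally show ?thesis by (simp add: mult_ac)
  qed
  then show "\<exists>r>0. \<exists>L. \<forall>y\<in>S \<inter> ball x r. \<forall>z\<in>S \<inter> ball x r. norm (T (f y) - T (f z)) \<le> L * dist y z"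
    using r by blast
qed

lemma loc_lipschitz_id: "loc_lipschitz S (\<lambda>x::'a::real_normed_vector. x)"
  unfolding loc_lipschitz_def by (auto intro!: exI[of _ 1] simp: dist_norm)

lemma loc_lipschitz_sum [intro]:
  assumes "\<And>i. i \<in> I \<Longrightarrow> loc_lipschitz S (f i)" shows "loc_lipschitz S (\<lambda>x. \<Sum>i\<in>I. f i x)"
  using assms by (induction I rule: infinite_finite_induct) auto

lemma loc_lipschitz_norm:
  assumes "loc_lipschitz S f" shows "loc_lipschitz S (\<lambda>x. norm (f x))"
  using assms unfolding loc_lipschitz_def real_norm_def by (meson norm_triangle_ineq3 order_trans)

text \<open>The compact set need not be convex, so the local constants are joined by a Lebesgue
  number. Points closer than e \<le> 1 share a ball of the cover, and there t \<le> t^\<alpha>. For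
  points farther apart the bound N on the values suffices, since 2 N = (2 N / e) e and e \<le>
  e^\<alpha>.\<close>

lemma loc_lipschitz_imp_Holder:
  assumes f: "loc_lipschitz (S::'a::real_normed_vector set) f" and a: "\<alpha> \<in> {0<..<1::real}"
  shows "locally_Holder_on \<alpha> S f"
  unfolding locally_Holder_on_def
proof safe
  fix K assume K: "compact K" "K \<subseteq> S"
  define \<C> where "\<C> = {ball x r | x r. r > 0 \<and> (\<exists>L. \<forall>y\<in>S \<inter> ball x r. \<forall>z\<in>S \<inter> ball x r. norm (f y - f z) \<le> L * dist y z)}"
  have cov: "\<exists>B\<in>\<C>. x \<in> B" if "x \<in> K" for x
  proof -
    have "x \<in> S" using that K by auto
    then obtain r where "r > 0" "\<exists>L. \<forall>y\<in>S \<inter> ball x r. \<forall>z\<in>S \<inter> ball x r. norm (f y - f z) \<le> L * dist y z"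
      using f unfolding loc_lipschitz_def by blast
    then show ?thesis unfolding \<C>_def by (intro bexI[of _ "ball x r"]) auto
  qed
  have open_\<C>: "\<And>B. B \<in> \<C> \<Longrightarrow> open B" by (auto simp: \<C>_def)
  obtain \<D> where D: "\<D> \<subseteq> \<C>" "finite \<D>" "K \<subseteq> \<Union>\<D>"
  proof -
    have "K \<subseteq> \<Union>\<C>" using cov by auto
    from compactE[OF K(1) this open_\<C>] show ?thesis using that by metis
  qed
  obtain L where L: "\<And>B y z. B \<in> \<D> \<Longrightarrow> y \<in> S \<inter> B \<Longrightarrow> z \<in> S \<inter> B \<Longrightarrow> norm (f y - f z) \<le> L B * dist y z"
  proof -
    have "\<forall>B\<in>\<D>. \<exists>L. \<forall>y\<in>S \<inter> B. \<forall>z\<in>S \<inter> B. norm (f y - f z) \<le> L * dist y z"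
      using D by (auto simp: \<C>_def)
    then show ?thesis using that by metis
  qed
  define M where "M = (\<Sum>B\<in>\<D>. \<bar>L B\<bar>)"
  have LM: "L B \<le> M" if "B \<in> \<D>" for B
    using member_le_sum[of B \<D> "\<lambda>B. \<bar>L B\<bar>"] that D(2) unfolding M_def by auto
  have M0: "M \<ge> 0" unfolding M_def by (intro sum_nonneg) auto
  have "bounded (f ` K)"
    by (intro compact_imp_bounded compact_continuous_image
      continuous_on_subset[OF loc_lipschitz_continuous[OF f] K(2)] K(1))
  then obtain N where N: "\<And>x. x \<in> K \<Longrightarrow> norm (f x) \<le> N" unfolding bounded_iff by blast
  show "\<exists>L. \<forall>x\<in>K. \<forall>y\<in>K. dist (f x) (f y) \<le> L * dist x y powr \<alpha>"
  proof (cases "K = {}")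
    case False
    then have N0: "N \<ge> 0" using N by (meson all_not_in_conv norm_ge_zero order_trans)
    have "\<D> \<noteq> {}" using False D(3) by auto
    obtain \<delta> where d: "0 < \<delta>" "\<And>T. T \<subseteq> K \<Longrightarrow> diameter T < \<delta> \<Longrightarrow> \<exists>B\<in>\<D>. T \<subseteq> B"
    proof (rule Lebesgue_number_lemma[OF K(1) \<open>\<D> \<noteq> {}\<close> D(3)])
      show "open B" if "B \<in> \<D>" for B using that D(1) open_\<C> by auto
    qed (use that in auto)
    define e where "e = min \<delta> 1"
    have e: "e > 0" "e \<le> 1" "e \<le> \<delta>" using d by (auto simp: e_def)
    show ?thesis
    proof (intro exI[of _ "M + 2 * N / e"] ballI)
      fix x y assume xy: "x \<in> K" "y \<in> K"
      show "dist (f x) (f y) \<le> (M + 2 * N / e) * dist x y powr \<alpha>"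
      proof (cases "dist x y < e")
        case True
        have "diameter {x, y} \<le> dist x y"
          by (rule diameter_le) (auto simp: dist_norm norm_minus_commute)
        then obtain B where B: "B \<in> \<D>" "{x, y} \<subseteq> B" using d(2)[of "{x,y}"] xy True e by auto
        have "norm (f x - f y) \<le> L B * dist x y" using B xy K by (intro L) auto
        also have "\<dots> \<le> M * dist x y" using LM[OF B(1)] by (intro mult_right_mono) auto
        also have "\<dots> \<le> M * dist x y powr \<alpha>"
        proof (cases "x = y")
          case False
          have "dist x y powr 1 \<le> dist x y powr \<alpha>"
            using True e a False by (intro powr_mono') auto
          then show ?thesis using M0 False by (intro mult_left_mono) (auto simp: powr_one)
        qed simp
        also have "\<dots> \<le> (M + 2 * N / e) * dist x y powr \<alpha>"
          using N0 e by (intro mult_right_mono) auto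
        finally show ?thesis by (simp add: dist_norm)
      next
        case False
        have "e powr 1 \<le> e powr \<alpha>" using e a by (intro powr_mono') auto
        also have "\<dots> \<le> dist x y powr \<alpha>" using False e a by (intro powr_mono2) auto
        finally have le: "e \<le> dist x y powr \<alpha>" using e by simp
        have "norm (f x - f y) \<le> norm (f x) + norm (f y)" by (rule norm_triangle_ineq4)
        also have "\<dots> \<le> 2 * N" using N[OF xy(1)] N[OF xy(2)] by simp
        also have "\<dots> = 2 * N / e * e" using e by simp
        also have "\<dots> \<le> 2 * N / e * dist x y powr \<alpha>" using le e N0 by (intro mult_left_mono) auto
        also have "\<dots> \<le> (M + 2 * N / e) * dist x y powr \<alpha>"
          using M0 by (intro mult_right_mono) auto
        finally show ?thesis by (simp add: dist_norm)
      qed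
    qed
  qed simp
qed

section \<open>Gradients, and functions whose highest derivatives are Lipschitz\<close>

definition has_grad :: "('a::real_inner \<Rightarrow> real) \<Rightarrow> 'a \<Rightarrow> 'a \<Rightarrow> 'a set \<Rightarrow> bool" where
  "has_grad f v x S \<longleftrightarrow> (f has_derivative (\<lambda>h. inner v h)) (at x within S)"

lemma has_grad_const: "has_grad (\<lambda>_. c) 0 x S"
  by (simp add: has_grad_def)

lemma has_grad_inner: "has_grad (\<lambda>x. inner a x) a x S"
  unfolding has_grad_def by (auto intro!: derivative_eq_intros)

lemma has_grad_nth: "has_grad (\<lambda>x::real^'n. x $ i) (axis i 1) x S"
  using has_grad_inner[of "axis i (1::real)"] by (simp add: inner_axis')

lemma has_grad_add: "has_grad f v x S \<Longrightarrow> has_grad g w x S \<Longrightarrow> has_grad (\<lambda>x. f x + g x) (v + w) x S"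
  unfolding has_grad_def by (auto intro!: derivative_eq_intros simp: inner_add_left)

lemma has_grad_mult:
  "has_grad f v x S \<Longrightarrow> has_grad g w x S \<Longrightarrow> has_grad (\<lambda>x. f x * g x) (f x *\<^sub>R w + g x *\<^sub>R v) x S"
  unfolding has_grad_def by (auto intro!: derivative_eq_intros simp: inner_add_left algebra_simps)

lemma has_grad_compose:
  assumes "has_grad f v x S" "(R has_real_derivative r) (at (f x) within T)" "f ` S \<subseteq> T"
  shows "has_grad (\<lambda>x. R (f x)) (r *\<^sub>R v) x S"
proof -
  have "(R has_derivative (\<lambda>h. r * h)) (at (f x) within f ` S)"
    using has_derivative_subset[OF assms(2)[unfolded has_field_derivative_def] assms(3)] by simp
  from has_derivative_in_compose[OF assms(1)[unfolded has_grad_def] this] show ?thesis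
    unfolding has_grad_def by (simp add: inner_scaleR_left[abs_def])
qed

lemma has_grad_inverse_norm:
  assumes "x \<noteq> 0"
  shows "has_grad (\<lambda>x. inverse (norm x)) (- (inverse (norm x) ^ 3) *\<^sub>R x) x S"
proof -
  have "has_grad norm (sgn x) x S"
    unfolding has_grad_def using has_derivative_at_withinI[OF has_derivative_norm[OF assms]]
    by (simp add: inner_commute[of _ "sgn x"])
  from has_grad_compose[OF this DERIV_inverse, of UNIV] assms show ?thesis
    by (simp add: sgn_div_norm power3_eq_cube power2_eq_square mult_ac)
qed

lemma has_grad_eq: "has_grad f v x S \<Longrightarrow> v = w \<Longrightarrow> has_grad f w x S" by simp

text \<open>At a zero of g, continuity of f is enough for the product rule: the increment of f is
  multiplied by one of g, and the product is o(|y - x|). This serves on the axis and at the endpoint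
  z = 1, where a profile factor is known to be continuous only.\<close>

lemma has_grad_mult_vanishing:
  assumes g: "has_grad g w x S" and f: "continuous_on S f" and x: "x \<in> S" "g x = 0"
  shows "has_grad (\<lambda>x. f x * g x) (f x *\<^sub>R w) x S"
proof -
  let ?q = "\<lambda>y. norm (g y - g x - inner w (y - x)) / norm (y - x)"
  have t1: "((\<lambda>y. f y - f x) \<longlongrightarrow> 0) (at x within S)"
    using f x(1) by (metis Lim_null continuous_on_def)
  have t2: "(?q \<longlongrightarrow> 0) (at x within S)"
    using g unfolding has_grad_def has_derivative_iff_norm by simp
  have t3: "((\<lambda>y. \<bar>f y\<bar> * ?q y + \<bar>f y - f x\<bar> * norm w) \<longlongrightarrow> \<bar>f x\<bar> * 0 + 0 * norm w) (at x within S)"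
    using f x(1) by (intro tendsto_intros t2) (auto simp: continuous_on_def intro!: tendsto_rabs_zero t1)
  show ?thesis unfolding has_grad_def has_derivative_iff_norm
  proof (intro conjI)
    show "bounded_linear (inner (f x *\<^sub>R w))" by (rule bounded_linear_inner_right)
    show "((\<lambda>y. norm (f y * g y - f x * g x - inner (f x *\<^sub>R w) (y - x)) / norm (y - x)) \<longlongrightarrow> 0) (at x within S)"
    proof (rule tendsto_sandwich[OF _ _ tendsto_const])
      show "((\<lambda>y. \<bar>f y\<bar> * ?q y + \<bar>f y - f x\<bar> * norm w) \<longlongrightarrow> 0) (at x within S)" using t3 by simp
      show "\<forall>\<^sub>F y in at x within S. norm (f y * g y - f x * g x - inner (f x *\<^sub>R w) (y - x)) / norm (y - x)
          \<le> \<bar>f y\<bar> * ?q y + \<bar>f y - f x\<bar> * norm w"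
        unfolding eventually_at_filter
      proof (rule always_eventually, safe)
        fix y assume y: "y \<noteq> x"
        have "f y * g y - f x * g x - inner (f x *\<^sub>R w) (y - x)
           = f y * (g y - g x - inner w (y - x)) + (f y - f x) * inner w (y - x)"
          using x by (simp add: algebra_simps)
        also have "norm \<dots> \<le> \<bar>f y\<bar> * norm (g y - g x - inner w (y - x)) + \<bar>f y - f x\<bar> * (norm w * norm (y - x))"
          by (rule order_trans[OF norm_triangle_ineq])
            (auto simp: abs_mult intro!: add_mono mult_left_mono Cauchy_Schwarz_ineq2)
        finally show "norm (f y * g y - f x * g x - inner (f x *\<^sub>R w) (y - x)) / norm (y - x)
          \<le> \<bar>f y\<bar> * ?q y + \<bar>f y - f x\<bar> * norm w"
          using y by (simp add: divide_simps algebra_simps)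
      qed
    qed (auto intro!: always_eventually)
  qed
qed

text \<open>This and \<open>C2L\<close> are the local C^{1,1} and C^{2,1} classes for scalar
  functions. A locally Lipschitz derivative is locally Hoelder for every exponent, so \<alpha> does
  not enter the construction of the solution.\<close>

definition C1L :: "(real^3 \<Rightarrow> real) \<Rightarrow> bool" where
  "C1L f \<longleftrightarrow> (\<exists>g. (\<forall>x\<in>S3. has_grad f (g x) x S3) \<and> loc_lipschitz S3 g)"

definition C2L :: "(real^3 \<Rightarrow> real) \<Rightarrow> bool" where
  "C2L f \<longleftrightarrow> (\<exists>g. (\<forall>x\<in>S3. has_grad f (g x) x S3) \<and> (\<forall>i. C1L (\<lambda>x. g x $ i)))"

text \<open>Mean value inequality on \<open>S3 \<inter> ball x r\<close>, made convex by r \<le> |x|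
  and small enough that the gradient exceeds its size at \<open>x\<close> by at most 1.\<close>

lemma continuous_grad_imp_loc_lipschitz:
  assumes f: "\<And>x. x \<in> S3 \<Longrightarrow> has_grad f (g x) x S3" and g: "continuous_on S3 g"
  shows "loc_lipschitz S3 f"
  unfolding loc_lipschitz_def
proof
  fix x :: "real^3" assume x: "x \<in> S3"
  then have nx: "norm x > 0" by (simp add: mem_S3)
  obtain d where d: "d > 0" "\<And>y. y \<in> S3 \<Longrightarrow> dist y x < d \<Longrightarrow> dist (g y) (g x) < 1"
    using g x unfolding continuous_on_iff by (metis zero_less_one)
  define r where "r = min d (norm x)"
  have r: "r > 0" "r \<le> d" "r \<le> norm x" using d nx by (auto simp: r_def)
  have "norm (f y - f z) \<le> (norm (g x) + 1) * norm (y - z)"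
    if y: "y \<in> S3 \<inter> ball x r" "z \<in> S3 \<inter> ball x r" for y z
  proof (rule differentiable_bound[OF convex_S3_ball[OF r(3)] _ _ y])
    fix w assume w: "w \<in> S3 \<inter> ball x r"
    show "(f has_derivative inner (g w)) (at w within S3 \<inter> ball x r)"
      using f[of w] w unfolding has_grad_def by (auto intro: has_derivative_subset)
    have "norm (g w) \<le> norm (g x) + norm (g w - g x)" by (metis norm_triangle_sub)
    also have "norm (g w - g x) \<le> 1" using d(2)[of w] w r by (force simp: dist_norm norm_minus_commute)
    finally have "norm (g w) \<le> norm (g x) + 1" by simp
    then show "onorm (inner (g w)) \<le> norm (g x) + 1"
      by (intro onorm_le) (metis Cauchy_Schwarz_ineq2 mult_right_mono norm_ge_zero order_trans real_norm_def)
  qed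
  then show "\<exists>r>0. \<exists>L. \<forall>y\<in>S3 \<inter> ball x r. \<forall>z\<in>S3 \<inter> ball x r. norm (f y - f z) \<le> L * dist y z"
    using r unfolding dist_norm by blast
qed

lemma loc_lipschitz_vecI:
  assumes "\<And>i. loc_lipschitz S (\<lambda>x. g x $ i)" shows "loc_lipschitz S (g :: 'a::metric_space \<Rightarrow> real^3)"
proof -
  have "loc_lipschitz S (\<lambda>x. \<Sum>i\<in>UNIV. (g x $ i) *\<^sub>R axis i (1::real))"
    using assms by (intro loc_lipschitz_sum loc_lipschitz_scaleR) auto
  moreover have "(\<Sum>i\<in>UNIV. (g x $ i) *\<^sub>R axis i (1::real)) = g x" for x
    using basis_expansion[of "g x"] by (simp add: scalar_mult_eq_scaleR)
  ultimately show ?thesis by simp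
qed

lemma C1L_loc_lipschitz: "C1L f \<Longrightarrow> loc_lipschitz S3 f"
  unfolding C1L_def by (auto intro: continuous_grad_imp_loc_lipschitz loc_lipschitz_continuous)

lemma C2L_imp_C1L: "C2L f \<Longrightarrow> C1L f"
proof -
  assume "C2L f"
  then obtain g where g: "\<forall>x\<in>S3. has_grad f (g x) x S3" "\<forall>i. C1L (\<lambda>x. g x $ i)"
    unfolding C2L_def by blast
  then have "loc_lipschitz S3 g"
    by (intro loc_lipschitz_vecI C1L_loc_lipschitz) auto
  with g(1) show "C1L f" unfolding C1L_def by blast
qed

lemma C1L_const: "C1L (\<lambda>_. c)"
  unfolding C1L_def by (rule exI[of _ "\<lambda>_. 0"]) (auto intro: has_grad_const)

lemma C1L_add: assumes "C1L f" "C1L g" shows "C1L (\<lambda>x. f x + g x)"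
proof -
  obtain f' g' where "\<forall>x\<in>S3. has_grad f (f' x) x S3" "loc_lipschitz S3 f'"
    "\<forall>x\<in>S3. has_grad g (g' x) x S3" "loc_lipschitz S3 g'" using assms unfolding C1L_def by blast
  then show ?thesis unfolding C1L_def
    by (intro exI[of _ "\<lambda>x. f' x + g' x"]) (auto intro: has_grad_add)
qed

lemma C1L_mult: assumes "C1L f" "C1L g" shows "C1L (\<lambda>x. f x * g x)"
proof -
  obtain f' g' where "\<forall>x\<in>S3. has_grad f (f' x) x S3" "loc_lipschitz S3 f'"
    "\<forall>x\<in>S3. has_grad g (g' x) x S3" "loc_lipschitz S3 g'" using assms unfolding C1L_def by blast
  then show ?thesis unfolding C1L_def
    by (intro exI[of _ "\<lambda>x. f x *\<^sub>R g' x + g x *\<^sub>R f' x"])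
      (auto intro!: has_grad_mult loc_lipschitz_add loc_lipschitz_scaleR C1L_loc_lipschitz assms)
qed

lemma C2L_const: "C2L (\<lambda>_. c)"
  unfolding C2L_def by (rule exI[of _ "\<lambda>_. 0"]) (auto intro: has_grad_const C1L_const)

lemma C2L_add: assumes "C2L f" "C2L g" shows "C2L (\<lambda>x. f x + g x)"
proof -
  obtain f' g' where "\<forall>x\<in>S3. has_grad f (f' x) x S3" "\<forall>i. C1L (\<lambda>x. f' x $ i)"
    "\<forall>x\<in>S3. has_grad g (g' x) x S3" "\<forall>i. C1L (\<lambda>x. g' x $ i)" using assms unfolding C2L_def by blast
  then show ?thesis unfolding C2L_def
    by (intro exI[of _ "\<lambda>x. f' x + g' x"]) (auto intro: has_grad_add C1L_add)
qed

lemma C2L_mult: assumes "C2L f" "C2L g" shows "C2L (\<lambda>x. f x * g x)"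
proof -
  obtain f' g' where "\<forall>x\<in>S3. has_grad f (f' x) x S3" "\<forall>i. C1L (\<lambda>x. f' x $ i)"
    "\<forall>x\<in>S3. has_grad g (g' x) x S3" "\<forall>i. C1L (\<lambda>x. g' x $ i)" using assms unfolding C2L_def by blast
  then show ?thesis unfolding C2L_def
    by (intro exI[of _ "\<lambda>x. f x *\<^sub>R g' x + g x *\<^sub>R f' x"])
      (auto intro!: has_grad_mult C1L_add C1L_mult C2L_imp_C1L[OF assms(1)] C2L_imp_C1L[OF assms(2)])
qed

lemma C2L_cong: assumes "C2L f" "\<And>x. x \<in> S3 \<Longrightarrow> f x = g x" shows "C2L g"
proof -
  have "has_grad g v x S3" if "has_grad f v x S3" "x \<in> S3" for v x
    using that assms(2) unfolding has_grad_def by (auto intro: has_derivative_transform[rotated 2])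
  then show ?thesis using assms(1) unfolding C2L_def by blast
qed

lemma C1L_cong: assumes "C1L f" "\<And>x. x \<in> S3 \<Longrightarrow> f x = g x" shows "C1L g"
proof -
  have "has_grad g v x S3" if "has_grad f v x S3" "x \<in> S3" for v x
    using that assms(2) unfolding has_grad_def by (auto intro: has_derivative_transform[rotated 2])
  then show ?thesis using assms(1) unfolding C1L_def by blast
qed

lemma C2L_nth: "C2L (\<lambda>x. x $ i)"
  unfolding C2L_def by (rule exI[of _ "\<lambda>_. axis i 1"]) (auto intro: has_grad_nth C1L_const)

text \<open>A bootstrap: the gradient of 1/|x| is a polynomial in 1/|x| and the coordinates. Its
  continuity makes 1/|x| locally Lipschitz, which makes the gradient locally Lipschitz, and one more
  round reaches \<open>C2L\<close>.\<close>

lemma C2L_inverse_norm: "C2L (\<lambda>x. inverse (norm x))"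
proof -
  let ?\<iota> = "\<lambda>x::real^3. inverse (norm x)"
  let ?g = "\<lambda>x::real^3. - (?\<iota> x ^ 3) *\<^sub>R x"
  have g: "has_grad ?\<iota> (?g x) x S3" if "x \<in> S3" for x
    using that by (intro has_grad_inverse_norm) (simp add: mem_S3)
  have "continuous_on S3 ?g" by (intro continuous_intros) (auto simp: mem_S3)
  with g have l: "loc_lipschitz S3 ?\<iota>" by (rule continuous_grad_imp_loc_lipschitz)
  have "loc_lipschitz S3 (\<lambda>x. (-1 * (?\<iota> x * (?\<iota> x * ?\<iota> x))) *\<^sub>R x)"
    by (intro loc_lipschitz_scaleR loc_lipschitz_mult l loc_lipschitz_id loc_lipschitz_const)
  then have c1: "C1L ?\<iota>" unfolding C1L_def using g
    by (intro exI[of _ ?g]) (simp add: power3_eq_cube mult.assoc)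
  have "C1L (\<lambda>x. -1 * (?\<iota> x * (?\<iota> x * ?\<iota> x)) * x $ i)" for i
    by (intro C1L_mult c1 C1L_const C2L_imp_C1L[OF C2L_nth])
  then have "C1L (\<lambda>x. ?g x $ i)" for i by (simp add: power3_eq_cube mult.assoc)
  with g show ?thesis unfolding C2L_def by (intro exI[of _ ?g]) auto
qed

section \<open>The polar cosine, fields vanishing on the axis, and functions of z\<close>

definition zc :: "real^3 \<Rightarrow> real" where "zc x = x $ 3 * inverse (norm x)"

definition zgrad :: "real^3 \<Rightarrow> real^3" where
  "zgrad x = inverse (norm x) *\<^sub>R (axis 3 1 - (zc x * inverse (norm x)) *\<^sub>R x)"

text \<open>Up to the factor \<open>\<surd>2\<close> this is \<open>\<surd>(1 - cos \<phi>)\<close>, a Lipschitz substitute for the distance to the axis.\<close>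
definition sg :: "real^3 \<Rightarrow> real" where
  "sg x = norm (inverse (norm x) *\<^sub>R x - axis 3 1)"

lemma has_grad_zc: "x \<noteq> 0 \<Longrightarrow> has_grad zc (zgrad x) x S"
  unfolding zc_def[abs_def]
  by (rule has_grad_eq[OF has_grad_mult[OF has_grad_nth has_grad_inverse_norm]])
    (auto simp: zgrad_def zc_def algebra_simps power3_eq_cube)

lemma sg_sq: assumes "x \<noteq> 0" shows "(sg x)\<^sup>2 = 2 * (1 - zc x)"
proof -
  let ?n = "inverse (norm x) *\<^sub>R x"
  have "norm ?n = 1" using assms by simp
  then have "inner ?n ?n = 1" by (simp only: dot_square_norm) simp
  moreover have "inner ?n (axis 3 1) = zc x" by (simp add: inner_axis zc_def)
  moreover have "inner (axis 3 1) (axis 3 1 :: real^3) = 1" by (simp add: inner_axis)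
  ultimately show ?thesis
    unfolding sg_def power2_norm_eq_inner inner_diff_left inner_diff_right inner_commute[of "axis 3 1" ?n]
    by simp
qed

lemma inner_zgrad:
  assumes "x \<noteq> 0" shows "inner (zgrad x) (zgrad x) = (inverse (norm x))\<^sup>2 * (1 - (zc x)\<^sup>2)"
proof -
  let ?i = "inverse (norm x)"
  have 1: "?i * ?i * inner x x = 1" using assms by (simp add: dot_square_norm power2_eq_square field_simps)
  have 2: "inner x (axis 3 1) = x $ 3" "inner (axis 3 1) x = x $ 3" "inner (axis 3 1) (axis 3 1 :: real^3) = 1"
    by (simp_all add: inner_axis inner_axis')
  have "inner (zgrad x) (zgrad x) = ?i * ?i * (1 - 2 * zc x * (x $ 3 * ?i) + zc x * zc x * (?i * ?i * inner x x))"
    unfolding zgrad_def inner_scaleR_left inner_scaleR_right inner_diff_left inner_diff_right 2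
    by (simp add: algebra_simps)
  then show ?thesis unfolding 1 zc_def[symmetric] by (simp add: power2_eq_square algebra_simps)
qed

lemma zc_bounds: "x \<in> S3 \<Longrightarrow> zc x \<in> {0..1}"
proof -
  assume x: "x \<in> S3"
  have "\<bar>x $ 3\<bar> \<le> norm x" by (rule component_le_norm_cart)
  then show ?thesis using x by (auto simp: mem_S3 zc_def field_simps)
qed

lemma sg_nonneg [simp]: "sg x \<ge> 0" by (simp add: sg_def)

lemma sg_pos_iff: "x \<in> S3 \<Longrightarrow> 0 < sg x \<longleftrightarrow> zc x < 1"
  using sg_sq[of x] sg_nonneg[of x] zc_bounds[of x] by (auto simp: mem_S3 less_le)

lemma sg_eq_sqrt: "x \<in> S3 \<Longrightarrow> sg x = sqrt 2 * sqrt (1 - zc x)"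
  using sg_sq[of x] sg_nonneg[of x]
  by (metis mem_S3 real_sqrt_mult real_sqrt_unique)

text \<open>|grad z|^2 = (1 - z)(1 + z)/\<rho>^2 \<le> 2 (1 - z)/\<rho>^2. This vanishing on the
  axis compensates derivatives of profiles that blow up there.\<close>

lemma norm_zgrad_le: "x \<in> S3 \<Longrightarrow> norm (zgrad x) \<le> inverse (norm x) * sg x"
proof -
  assume x: "x \<in> S3"
  then have x0: "x \<noteq> 0" by (simp add: mem_S3)
  have z: "0 \<le> zc x" "zc x \<le> 1" using zc_bounds[OF x] by auto
  have "(1 - zc x) * (1 + zc x) \<le> (1 - zc x) * 2" using z by (intro mult_left_mono) auto
  then have "1 - (zc x)\<^sup>2 \<le> (sg x)\<^sup>2" using sg_sq[OF x0] by (simp add: algebra_simps power2_eq_square)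
  then have "inner (zgrad x) (zgrad x) \<le> (inverse (norm x) * sg x)\<^sup>2"
    unfolding inner_zgrad[OF x0] power_mult_distrib by (intro mult_left_mono) auto
  then have "(norm (zgrad x))\<^sup>2 \<le> (inverse (norm x) * sg x)\<^sup>2" by (simp add: power2_norm_eq_inner)
  then show ?thesis by (rule power2_le_imp_le) simp
qed

lemma C2L_zc: "C2L zc"
  unfolding zc_def[abs_def] by (intro C2L_mult C2L_nth C2L_inverse_norm)

lemma C1L_zgrad: "C1L (\<lambda>x. zgrad x $ i)"
proof -
  have "C1L (\<lambda>x. inverse (norm x) * (axis 3 1 $ i + (-1) * (zc x * inverse (norm x)) * x $ i))"
    by (intro C1L_mult C1L_add C1L_const C2L_imp_C1L[OF C2L_zc] C2L_imp_C1L[OF C2L_inverse_norm]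
      C2L_imp_C1L[OF C2L_nth])
  then show ?thesis by (simp add: zgrad_def)
qed

lemma loc_lipschitz_zgrad: "loc_lipschitz S3 zgrad"
  by (intro loc_lipschitz_vecI C1L_loc_lipschitz C1L_zgrad)

lemma loc_lipschitz_inverse_norm: "loc_lipschitz S3 (\<lambda>x. inverse (norm x))"
  by (intro C1L_loc_lipschitz C2L_imp_C1L C2L_inverse_norm)

lemma loc_lipschitz_sg: "loc_lipschitz S3 sg"
proof -
  have "loc_lipschitz S3 (\<lambda>x. inverse (norm x) *\<^sub>R x + (- axis 3 1))"
    by (intro loc_lipschitz_add loc_lipschitz_scaleR loc_lipschitz_inverse_norm loc_lipschitz_id loc_lipschitz_const)
  from loc_lipschitz_norm[OF this] show ?thesis by (simp add: sg_def[abs_def])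
qed

text \<open>Lipschitz fields of size O(\<open>sg\<close>): the ones that can absorb a factor of
  order (1 - z)^(-1/2).\<close>

definition axis_vanishing :: "(real^3 \<Rightarrow> 'b::real_normed_vector) \<Rightarrow> bool" where
  "axis_vanishing V \<longleftrightarrow> loc_lipschitz S3 V \<and>
     (\<forall>x\<in>S3. \<exists>r>0. \<exists>\<kappa>\<ge>0. \<forall>y\<in>S3 \<inter> ball x r. norm (V y) \<le> \<kappa> * sg y)"

lemma axis_vanishingE:
  assumes "axis_vanishing V" "x \<in> S3"
  obtains r L where "lipschitz_near S3 V x r L" "lipschitz_near S3 sg x r L"
    "\<forall>y\<in>S3 \<inter> ball x r. norm (V y) \<le> L * sg y"
proof -
  obtain r L where 1: "lipschitz_near S3 V x r L" "lipschitz_near S3 sg x r L"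
    using loc_lipschitz_pairE[of S3 V sg x] assms loc_lipschitz_sg unfolding axis_vanishing_def by metis
  obtain r' \<kappa> where 2: "r' > 0" "\<And>y. y \<in> S3 \<inter> ball x r' \<Longrightarrow> norm (V y) \<le> \<kappa> * sg y"
    using assms unfolding axis_vanishing_def by metis
  have 3: "0 < min r r'" using 1 2 by (auto simp: lipschitz_near_def)
  show ?thesis
  proof (rule that[of "min r r'" "max L \<kappa>"])
    show "lipschitz_near S3 V x (min r r') (max L \<kappa>)" "lipschitz_near S3 sg x (min r r') (max L \<kappa>)"
      using 3 by (auto intro: lipschitz_near_mono[OF 1(1)] lipschitz_near_mono[OF 1(2)])
    show "\<forall>y\<in>S3 \<inter> ball x (min r r'). norm (V y) \<le> max L \<kappa> * sg y"
    proof
    fix y assume y: "y \<in> S3 \<inter> ball x (min r r')"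
    have "norm (V y) \<le> \<kappa> * sg y" using y by (intro 2) auto
    also have "\<dots> \<le> max L \<kappa> * sg y" by (intro mult_right_mono) auto
    finally show "norm (V y) \<le> max L \<kappa> * sg y" .
    qed
  qed
qed

lemma axis_vanishing_zgrad: "axis_vanishing zgrad" "axis_vanishing (\<lambda>x. zgrad x $ i)"
proof -
  have *: "\<exists>r>0. \<exists>\<kappa>\<ge>0. \<forall>y\<in>S3 \<inter> ball x r. norm (zgrad y) \<le> \<kappa> * sg y" if x: "x \<in> S3" for x
  proof -
    obtain r L where rL: "lipschitz_near S3 (\<lambda>x. inverse (norm x)) x r L"
      by (rule loc_lipschitzE[OF loc_lipschitz_inverse_norm x])
    have "norm (zgrad y) \<le> L * sg y" if y: "y \<in> S3 \<inter> ball x r" for y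
    proof -
      have "norm (inverse (norm y)) \<le> L" using rL y unfolding lipschitz_near_def by blast
      then have "inverse (norm y) * sg y \<le> L * sg y" by (intro mult_right_mono) auto
      then show ?thesis using norm_zgrad_le[of y] y by auto
    qed
    then show ?thesis using rL unfolding lipschitz_near_def by blast
  qed
  show "axis_vanishing zgrad" unfolding axis_vanishing_def using * loc_lipschitz_zgrad by blast
  have c: "norm (zgrad y $ i) \<le> norm (zgrad y)" for y
    by (simp add: component_le_norm_cart)
  show "axis_vanishing (\<lambda>x. zgrad x $ i)" unfolding axis_vanishing_def
    using * C1L_loc_lipschitz[OF C1L_zgrad] order_trans[OF c] by meson
qed

text \<open>V/\<open>sg\<close> is bounded but may jump on the axis; the factor W =
  O(\<open>sg\<close>) repairs this. The two points are ordered by \<open>sg\<close>, and the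
  difference is split so that increments are divided only by the larger value \<open>sg z\<close>,
  which the bound W y = O(\<open>sg y\<close>) = O(\<open>sg z\<close>) cancels.\<close>

lemma axis_vanishing_div:
  assumes "axis_vanishing (V::_ \<Rightarrow> real)" "axis_vanishing W"
  shows "axis_vanishing (\<lambda>x. (V x / sg x) *\<^sub>R W x)"
  unfolding axis_vanishing_def
proof (intro conjI loc_lipschitzI ballI)
  fix x assume x: "x \<in> S3"
  obtain r1 L1 where 1: "lipschitz_near S3 V x r1 L1" "lipschitz_near S3 sg x r1 L1"
    "\<forall>y\<in>S3 \<inter> ball x r1. norm (V y) \<le> L1 * sg y" by (rule axis_vanishingE[OF assms(1) x])
  obtain r2 L2 where 2: "lipschitz_near S3 W x r2 L2" "lipschitz_near S3 sg x r2 L2"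
    "\<forall>y\<in>S3 \<inter> ball x r2. norm (W y) \<le> L2 * sg y" by (rule axis_vanishingE[OF assms(2) x])
  define r L where "r = min r1 r2" and "L = max L1 L2"
  have r: "r > 0" "r \<le> r1" "r \<le> r2" using 1 2 by (auto simp: r_def lipschitz_near_def)
  have l: "L1 \<le> L" "L2 \<le> L" "L \<ge> 0" using 1 by (auto simp: L_def lipschitz_near_def)
  have near: "lipschitz_near S3 V x r L" "lipschitz_near S3 W x r L" "lipschitz_near S3 sg x r L"
    using lipschitz_near_mono[OF 1(1) r(1,2) l(1)] lipschitz_near_mono[OF 2(1) r(1,3) l(2)]
      lipschitz_near_mono[OF 1(2) r(1,2) l(1)] by auto
  have lip: "norm (V y - V z) \<le> L * dist y z" "norm (W y - W z) \<le> L * dist y z" "\<bar>sg y - sg z\<bar> \<le> L * dist y z"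
    if "y \<in> S3 \<inter> ball x r" "z \<in> S3 \<inter> ball x r" for y z
    using near that unfolding lipschitz_near_def real_norm_def by blast+
  have Vb: "norm (V y) \<le> L * sg y" if y: "y \<in> S3 \<inter> ball x r" for y
    using bspec[OF 1(3), of y] y r mult_right_mono[OF l(1) sg_nonneg[of y]] by auto
  have Wb: "norm (W y) \<le> L * sg y" if y: "y \<in> S3 \<inter> ball x r" for y
    using bspec[OF 2(3), of y] y r mult_right_mono[OF l(2) sg_nonneg[of y]] by auto
  have Vs: "\<bar>V y / sg y\<bar> \<le> L" if y: "y \<in> S3 \<inter> ball x r" for y
  proof (cases "sg y = 0")
    case False
    then have "sg y > 0" using sg_nonneg[of y] by linarith
    then show ?thesis using Vb[OF y] by (simp add: pos_divide_le_eq)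
  qed (use l in simp)
  have b: "norm ((V y / sg y) *\<^sub>R W y) \<le> L * L * sg y" if y: "y \<in> S3 \<inter> ball x r" for y
    using mult_mono[OF Vs[OF y] Wb[OF y] l(3)] by (simp add: mult_ac)
  show "\<exists>r>0. \<exists>\<kappa>\<ge>0. \<forall>y\<in>S3 \<inter> ball x r. norm ((V y / sg y) *\<^sub>R W y) \<le> \<kappa> * sg y"
    using b r l by (meson mult_nonneg_nonneg)
  have ord: "norm ((V y / sg y) *\<^sub>R W y - (V z / sg z) *\<^sub>R W z) \<le> (L * L * L + 2 * L * L) * dist y z"
    if y: "y \<in> S3 \<inter> ball x r" and z: "z \<in> S3 \<inter> ball x r" and le: "sg y \<le> sg z" for y z
  proof (cases "sg y = 0")
    case True
    \<comment> \<open>The term at y is zero because division by \<open>sg y\<close> = 0 yields 0.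
      The term at z is O(\<open>sg z\<close>), and \<open>sg z\<close> is here the increment of
      \<open>sg\<close>.\<close>
    have "norm ((V z / sg z) *\<^sub>R W z) \<le> L * L * sg z" by (rule b[OF z])
    also have "\<dots> \<le> L * L * (L * dist y z)" using lip(3)[OF y z] True l by (intro mult_left_mono) auto
    also have "\<dots> \<le> (L * L * L + 2 * L * L) * dist y z"
      using l by (simp add: algebra_simps)
    finally show ?thesis using True by simp
  next
    case False
    then have sy: "0 < sg y" using sg_nonneg[of y] by linarith
    then have sz: "0 < sg z" using le by linarith
    have "(V y / sg y) *\<^sub>R W y - (V z / sg z) *\<^sub>R W z
      = ((sg z - sg y) / sg z * (V y / sg y)) *\<^sub>R W y + ((V y - V z) / sg z) *\<^sub>R W y + (V z / sg z) *\<^sub>R (W y - W z)"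
    proof -
      have "V y / sg y = (sg z - sg y) / sg z * (V y / sg y) + (V y - V z) / sg z + V z / sg z"
        using sy sz by (simp add: field_simps)
      then have "(V y / sg y) *\<^sub>R W y = ((sg z - sg y) / sg z * (V y / sg y) + (V y - V z) / sg z + V z / sg z) *\<^sub>R W y"
        by metis
      then show ?thesis by (simp add: scaleR_left_distrib scaleR_right_diff_distrib)
    qed
    also have "norm \<dots> \<le> L * L * L * dist y z + L * L * dist y z + L * L * dist y z"
    proof (intro order_trans[OF norm_triangle_ineq] add_mono)
      have Wz: "norm (W y) \<le> L * sg z"
        using order_trans[OF Wb[OF y] mult_left_mono[OF le l(3)]] .
      have "\<bar>(sg z - sg y) / sg z\<bar> * \<bar>V y / sg y\<bar> * norm (W y) \<le> (L * dist y z / sg z) * L * (L * sg z)"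
        using lip(3)[OF y z] Vs[OF y] Wz sz l
        by (intro mult_mono) (auto simp: divide_right_mono abs_minus_commute)
      also have "\<dots> = L * L * L * dist y z" using sz by simp
      finally show "norm (((sg z - sg y) / sg z * (V y / sg y)) *\<^sub>R W y) \<le> L * L * L * dist y z"
        by (simp add: abs_mult)
      have "\<bar>(V y - V z) / sg z\<bar> * norm (W y) \<le> (L * dist y z / sg z) * (L * sg z)"
        using lip(1)[OF y z] Wz sz l by (intro mult_mono) (auto simp: divide_right_mono)
      also have "\<dots> = L * L * dist y z" using sz by simp
      finally show "norm (((V y - V z) / sg z) *\<^sub>R W y) \<le> L * L * dist y z" by simp
      show "norm ((V z / sg z) *\<^sub>R (W y - W z)) \<le> L * L * dist y z"
        using mult_mono[OF Vs[OF z] lip(2)[OF y z]] l by (simp add: mult_ac)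
    qed
    finally show ?thesis by (simp add: algebra_simps)
  qed
  have "norm ((V y / sg y) *\<^sub>R W y - (V z / sg z) *\<^sub>R W z) \<le> (L * L * L + 2 * L * L) * dist y z"
    if y: "y \<in> S3 \<inter> ball x r" and z: "z \<in> S3 \<inter> ball x r" for y z
    using ord[OF y z] ord[OF z y] by (cases "sg y \<le> sg z") (auto simp: norm_minus_commute dist_commute)
  then show "\<exists>r>0. \<exists>L. \<forall>y\<in>S3 \<inter> ball x r. \<forall>z\<in>S3 \<inter> ball x r.
      norm ((V y / sg y) *\<^sub>R W y - (V z / sg z) *\<^sub>R W z) \<le> L * dist y z"
    using r by blast
qed

text \<open>In terms of s = sqrt (1 - z): if s1 is at most half of s2, boundedness of b suffices
  because s1 \<le> s2 - s1. Otherwise |b'| \<le> c/s1^2 between the two points, z1 - z2 = (s2 -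
  s1)(s2 + s1), and s2 + s1 \<le> 3 s1.\<close>

lemma weighted_difference:
  fixes b b' :: "real \<Rightarrow> real"
  assumes d: "\<And>z. 0 \<le> z \<Longrightarrow> z < 1 \<Longrightarrow> (b has_real_derivative b' z) (at z within {0..1})"
    and c: "\<And>z. 0 \<le> z \<Longrightarrow> z < 1 \<Longrightarrow> \<bar>b z\<bar> \<le> c" "\<And>z. 0 \<le> z \<Longrightarrow> z < 1 \<Longrightarrow> \<bar>b' z\<bar> * (1 - z) \<le> c"
    and z: "0 \<le> z2" "z2 \<le> z1" "z1 < 1"
  shows "\<bar>b z1 - b z2\<bar> * sqrt (1 - z1) \<le> 3 * c * (sqrt (1 - z2) - sqrt (1 - z1))"
proof -
  define s1 s2 where "s1 = sqrt (1 - z1)" and "s2 = sqrt (1 - z2)"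
  have s: "0 < s1" "s1 \<le> s2" "s1\<^sup>2 = 1 - z1" "s2\<^sup>2 = 1 - z2" using z by (auto simp: s1_def s2_def)
  have c0: "c \<ge> 0" using c(1)[of 0] by simp
  show ?thesis unfolding s1_def[symmetric] s2_def[symmetric]
  proof (cases "2 * s1 \<le> s2")
    case True
    have "\<bar>b z1 - b z2\<bar> \<le> 2 * c" using c(1)[of z1] c(1)[of z2] z by auto
    then have "\<bar>b z1 - b z2\<bar> * s1 \<le> 2 * c * (s2 - s1)" using True s c0 by (intro mult_mono) auto
    also have "\<dots> \<le> 3 * c * (s2 - s1)" using c0 s by (intro mult_right_mono) auto
    finally show "\<bar>b z1 - b z2\<bar> * s1 \<le> 3 * c * (s2 - s1)" .
  next
    case False
    have "norm (b z1 - b z2) \<le> c / (1 - z1) * norm (z1 - z2)"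
    proof (rule field_differentiable_bound[of "{z2..z1}" b b'])
      fix w assume w: "w \<in> {z2..z1}"
      show "(b has_real_derivative b' w) (at w within {z2..z1})"
        using w z by (intro DERIV_subset[OF d]) auto
      have "\<bar>b' w\<bar> * (1 - z1) \<le> \<bar>b' w\<bar> * (1 - w)" using w by (intro mult_left_mono) auto
      also have "\<dots> \<le> c" using w z by (intro c) auto
      finally show "norm (b' w) \<le> c / (1 - z1)" using z by (simp add: field_simps)
    qed (use z in auto)
    then have "\<bar>b z1 - b z2\<bar> * s1 \<le> c / s1\<^sup>2 * (s2\<^sup>2 - s1\<^sup>2) * s1"
      using s z by (intro mult_right_mono) auto
    also have "\<dots> = c * (s2 - s1) * ((s2 + s1) / s1)" using s by (simp add: field_simps power2_eq_square)
    also have "(s2 + s1) / s1 \<le> 3" using False s by (simp add: pos_divide_le_eq)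
    then have "c * (s2 - s1) * ((s2 + s1) / s1) \<le> c * (s2 - s1) * 3" using s c0 by (intro mult_left_mono) auto
    finally show "\<bar>b z1 - b z2\<bar> * s1 \<le> 3 * c * (s2 - s1)" by simp
  qed
qed

text \<open>The function b may oscillate near z = 1. In the difference of two values its increment
  is multiplied by V at the point with the smaller \<open>sg\<close>, where V = O(\<open>sg\<close>)
  supplies exactly the weight of \<open>weighted_difference\<close>. On the axis itself V is
  zero.\<close>

lemma loc_lipschitz_weighted:
  fixes b b' :: "real \<Rightarrow> real"
  assumes d: "\<And>z. 0 \<le> z \<Longrightarrow> z < 1 \<Longrightarrow> (b has_real_derivative b' z) (at z within {0..1})"
    and c: "\<And>z. 0 \<le> z \<Longrightarrow> z < 1 \<Longrightarrow> \<bar>b z\<bar> \<le> c" "\<And>z. 0 \<le> z \<Longrightarrow> z < 1 \<Longrightarrow> \<bar>b' z\<bar> * (1 - z) \<le> c"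
    and V: "axis_vanishing V"
  shows "loc_lipschitz S3 (\<lambda>x. b (zc x) *\<^sub>R V x)"
proof (rule loc_lipschitzI)
  fix x assume x: "x \<in> S3"
  obtain r L where 1: "lipschitz_near S3 V x r L" "lipschitz_near S3 sg x r L"
    "\<forall>y\<in>S3 \<inter> ball x r. norm (V y) \<le> L * sg y" by (rule axis_vanishingE[OF V x])
  have r: "r > 0" and L: "L \<ge> 0" using 1 by (auto simp: lipschitz_near_def)
  have c0: "c \<ge> 0" using c(1)[of 0] by simp
  have lip: "norm (V y - V z) \<le> L * dist y z" "\<bar>sg y - sg z\<bar> \<le> L * dist y z"
    if "y \<in> S3 \<inter> ball x r" "z \<in> S3 \<inter> ball x r" for y z
    using 1 that unfolding lipschitz_near_def real_norm_def by blast+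
  have zb: "0 \<le> zc y" "zc y \<le> 1" if "y \<in> S3 \<inter> ball x r" for y using zc_bounds[of y] that by auto
  define K where "K = c * L + 4 * c * L * L"
  have ord: "norm (b (zc y) *\<^sub>R V y - b (zc z) *\<^sub>R V z) \<le> K * dist y z"
    if y: "y \<in> S3 \<inter> ball x r" and z: "z \<in> S3 \<inter> ball x r" and le: "sg y \<le> sg z" for y z
  proof (cases "sg y = 0")
    case True
    then have Vy: "V y = 0" using bspec[OF 1(3) y] by simp
    have "norm (b (zc z) *\<^sub>R V z) \<le> c * (L * sg z)"
    proof (cases "sg z = 0")
      case True then show ?thesis using bspec[OF 1(3) z] by simp
    next
      case False
      then have "zc z < 1" using sg_pos_iff[of z] z sg_nonneg[of z] by auto
      then show ?thesis using bspec[OF 1(3) z] c(1)[of "zc z"] zb[OF z] c0 unfolding norm_scaleR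
        by (intro mult_mono) auto
    qed
    also have "\<dots> \<le> c * (L * (L * dist y z))"
      using lip(2)[OF y z] True c0 L by (intro mult_left_mono) auto
    also have "\<dots> \<le> K * dist y z" using c0 L by (simp add: K_def algebra_simps)
    finally show ?thesis using Vy by simp
  next
    case False
    then have sy: "0 < sg y" using sg_nonneg[of y] by linarith
    then have sz: "0 < sg z" using le by linarith
    have zy: "zc y < 1" "zc z < 1" using sg_pos_iff sy sz y z by auto
    have sq: "sg y = sqrt 2 * sqrt (1 - zc y)" "sg z = sqrt 2 * sqrt (1 - zc z)" using sg_eq_sqrt y z by auto
    have "zc z \<le> zc y" using le unfolding sq by simp
    then have "\<bar>b (zc y) - b (zc z)\<bar> * sqrt (1 - zc y) \<le> 3 * c * (sqrt (1 - zc z) - sqrt (1 - zc y))"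
      by (intro weighted_difference[OF d c] zb(1)[OF z] zy(1))
    then have "sqrt 2 * (\<bar>b (zc y) - b (zc z)\<bar> * sqrt (1 - zc y)) \<le> sqrt 2 * (3 * c * (sqrt (1 - zc z) - sqrt (1 - zc y)))"
      by (intro mult_left_mono) auto
    then have w: "\<bar>b (zc y) - b (zc z)\<bar> * sg y \<le> 3 * c * (sg z - sg y)" unfolding sq by (simp add: algebra_simps)
    have "b (zc y) *\<^sub>R V y - b (zc z) *\<^sub>R V z = b (zc z) *\<^sub>R (V y - V z) + (b (zc y) - b (zc z)) *\<^sub>R V y"
      by (simp add: algebra_simps)
    also have "norm \<dots> \<le> \<bar>b (zc z)\<bar> * norm (V y - V z) + \<bar>b (zc y) - b (zc z)\<bar> * norm (V y)"
      by (rule order_trans[OF norm_triangle_ineq]) simp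
    also have "\<dots> \<le> c * (L * dist y z) + \<bar>b (zc y) - b (zc z)\<bar> * (L * sg y)"
      using c(1)[of "zc z"] zb[OF z] zy lip(1)[OF y z] bspec[OF 1(3) y] L c0
      by (intro add_mono mult_mono) auto
    also have "\<bar>b (zc y) - b (zc z)\<bar> * (L * sg y) = L * (\<bar>b (zc y) - b (zc z)\<bar> * sg y)" by simp
    also have "\<dots> \<le> L * (3 * c * (L * dist y z))"
      using w lip(2)[OF z y] le c0 L by (intro mult_left_mono order_trans[OF w]) (auto simp: dist_commute)
    also have "c * (L * dist y z) + L * (3 * c * (L * dist y z)) \<le> K * dist y z"
      using c0 L by (simp add: K_def algebra_simps)
    finally show ?thesis by simp
  qed
  have "norm (b (zc y) *\<^sub>R V y - b (zc z) *\<^sub>R V z) \<le> K * dist y z"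
    if y: "y \<in> S3 \<inter> ball x r" and z: "z \<in> S3 \<inter> ball x r" for y z
    using ord[OF y z] ord[OF z y] by (cases "sg y \<le> sg z") (auto simp: norm_minus_commute dist_commute)
  then show "\<exists>r>0. \<exists>L. \<forall>y\<in>S3 \<inter> ball x r. \<forall>z\<in>S3 \<inter> ball x r.
      norm (b (zc y) *\<^sub>R V y - b (zc z) *\<^sub>R V z) \<le> L * dist y z"
    using r by blast
qed

lemma C1L_compose_zc:
  assumes Q: "\<And>z. z \<in> {0..1} \<Longrightarrow> (Q has_real_derivative Q1 z) (at z within {0..1})"
    and Q1: "\<And>z. 0 \<le> z \<Longrightarrow> z < 1 \<Longrightarrow> (Q1 has_real_derivative Q2 z) (at z within {0..1})"
    and c: "\<And>z. 0 \<le> z \<Longrightarrow> z < 1 \<Longrightarrow> \<bar>Q1 z\<bar> \<le> c" "\<And>z. 0 \<le> z \<Longrightarrow> z < 1 \<Longrightarrow> \<bar>Q2 z\<bar> * (1 - z) \<le> c"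
  shows "C1L (\<lambda>x. Q (zc x))"
  unfolding C1L_def
proof (intro exI conjI ballI)
  fix x assume x: "x \<in> S3"
  then have "x \<noteq> 0" by (simp add: mem_S3)
  then show "has_grad (\<lambda>x. Q (zc x)) (Q1 (zc x) *\<^sub>R zgrad x) x S3"
    by (rule has_grad_compose[OF has_grad_zc Q[OF zc_bounds[OF x]]]) (use zc_bounds in blast)
next
  show "loc_lipschitz S3 (\<lambda>x. Q1 (zc x) *\<^sub>R zgrad x)"
    by (rule loc_lipschitz_weighted[OF Q1 c axis_vanishing_zgrad(1)])
qed

text \<open>The function -2 c sqrt (1 - z) has derivative c / sqrt (1 - z), so adding R or -R gives
  nondecreasing functions. This replaces integration of the possibly singular R'.\<close>

lemma sqrt_lipschitz_bound:
  fixes R R' :: "real \<Rightarrow> real"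
  assumes R: "continuous_on {0..1} R"
    and d: "\<And>z. 0 \<le> z \<Longrightarrow> z < 1 \<Longrightarrow> (R has_real_derivative R' z) (at z within {0..1})"
    and c: "\<And>z. 0 \<le> z \<Longrightarrow> z < 1 \<Longrightarrow> \<bar>R' z\<bar> * sqrt (1 - z) \<le> c"
    and z: "0 \<le> z2" "z2 \<le> z1" "z1 \<le> 1"
  shows "\<bar>R z1 - R z2\<bar> \<le> 2 * c * (sqrt (1 - z2) - sqrt (1 - z1))"
proof -
  have "(- 2 * c * sqrt (1 - z2)) + \<sigma> * R z2 \<le> (- 2 * c * sqrt (1 - z1)) + \<sigma> * R z1" if s: "\<bar>\<sigma>\<bar> = 1" for \<sigma>
  proof (rule DERIV_nonneg_imp_increasing_open[OF z(2), of "\<lambda>z. (- 2 * c * sqrt (1 - z)) + \<sigma> * R z"])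
    show "continuous_on {z2..z1} (\<lambda>z. - 2 * c * sqrt (1 - z) + \<sigma> * R z)"
      using z by (intro continuous_intros continuous_on_subset[OF R]) auto
    fix w assume w: "z2 < w" "w < z1"
    have "at w within {0..1} = at w" using w z by (intro at_within_interior) auto
    then have "(R has_real_derivative R' w) (at w)" using d[of w] w z by auto
    then have "((\<lambda>z. - 2 * c * sqrt (1 - z) + \<sigma> * R z) has_real_derivative c / sqrt (1 - w) + \<sigma> * R' w) (at w)"
      using w z by (auto intro!: derivative_eq_intros simp: field_simps)
    moreover have "\<bar>\<sigma> * R' w\<bar> \<le> c / sqrt (1 - w)"
      using c[of w] w z s by (simp add: abs_mult field_simps)
    ultimately show "\<exists>y. ((\<lambda>z. - 2 * c * sqrt (1 - z) + \<sigma> * R z) has_real_derivative y) (at w) \<and> 0 \<le> y"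
      by (intro exI conjI) auto
  qed
  from this[of 1] this[of "-1"] show ?thesis by (simp add: algebra_simps abs_le_iff)
qed

lemma loc_lipschitz_compose_zc:
  assumes R: "continuous_on {0..1} R"
    and d: "\<And>z. 0 \<le> z \<Longrightarrow> z < 1 \<Longrightarrow> (R has_real_derivative R' z) (at z within {0..1})"
    and c: "\<And>z. 0 \<le> z \<Longrightarrow> z < 1 \<Longrightarrow> \<bar>R' z\<bar> * sqrt (1 - z) \<le> c"
  shows "loc_lipschitz S3 (\<lambda>x. R (zc x))"
proof (rule loc_lipschitzI)
  fix x assume x: "x \<in> S3"
  obtain r L where rL: "lipschitz_near S3 sg x r L" by (rule loc_lipschitzE[OF loc_lipschitz_sg x])
  have c0: "c \<ge> 0" using c[of 0] by simp
  have ord: "norm (R (zc y) - R (zc z)) \<le> 2 * c * L * dist y z"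
    if y: "y \<in> S3 \<inter> ball x r" and z: "z \<in> S3 \<inter> ball x r" and le: "sg y \<le> sg z" for y z
  proof -
    have sq: "sg y = sqrt 2 * sqrt (1 - zc y)" "sg z = sqrt 2 * sqrt (1 - zc z)" using sg_eq_sqrt y z by auto
    have "\<bar>R (zc y) - R (zc z)\<bar> \<le> 2 * c * (sqrt (1 - zc z) - sqrt (1 - zc y))"
    proof (rule sqrt_lipschitz_bound[OF R d c])
      show "zc z \<le> zc y" using le unfolding sq by simp
    qed (use zc_bounds[of y] zc_bounds[of z] y z in auto)
    also have "sqrt (1 - zc z) - sqrt (1 - zc y) = (sg z - sg y) / sqrt 2"
      unfolding sq by (simp add: field_simps)
    also have "\<dots> \<le> sg z - sg y"
      using divide_left_mono[of 1 "sqrt 2" "sg z - sg y"] le by simp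
    also have "\<dots> \<le> L * dist y z"
      using rL y z unfolding lipschitz_near_def real_norm_def by (metis abs_le_D1 dist_commute)
    finally show ?thesis using c0 by (simp add: mult_left_mono mult.assoc)
  qed
  have "norm (R (zc y) - R (zc z)) \<le> 2 * c * L * dist y z"
    if y: "y \<in> S3 \<inter> ball x r" and z: "z \<in> S3 \<inter> ball x r" for y z
    using ord[OF y z] ord[OF z y] by (cases "sg y \<le> sg z") (auto simp: norm_minus_commute dist_commute abs_minus_commute)
  then show "\<exists>r>0. \<exists>L. \<forall>y\<in>S3 \<inter> ball x r. \<forall>z\<in>S3 \<inter> ball x r. norm (R (zc y) - R (zc z)) \<le> L * dist y z"
    using rL unfolding lipschitz_near_def by blast
qed

lemma loc_lipschitz_cong:
  assumes "\<And>x. x \<in> S \<Longrightarrow> f x = g x" "loc_lipschitz S f" shows "loc_lipschitz S g"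
proof (rule loc_lipschitzI)
  fix x assume x: "x \<in> S"
  obtain r L where "lipschitz_near S f x r L" by (rule loc_lipschitzE[OF assms(2) x])
  then have "r > 0" "\<forall>y\<in>S \<inter> ball x r. \<forall>z\<in>S \<inter> ball x r. norm (g y - g z) \<le> L * dist y z"
    unfolding lipschitz_near_def using assms(1) by auto
  then show "\<exists>r>0. \<exists>L. \<forall>y\<in>S \<inter> ball x r. \<forall>z\<in>S \<inter> ball x r. norm (g y - g z) \<le> L * dist y z"
    by blast
qed

text \<open>The Hessian of R(z) is R1 times that of z plus R2 (grad z)(grad z)^T. In the first term
  R1 is Lipschitz in \<open>sg\<close>. In the second, R2 = O((1 - z)^(-1/2)) meets a product of
  size O(\<open>sg\<close>^2): writing it as b(z) (V/\<open>sg\<close>) W with b = R2 sqrt (1 - z),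
  both V and W vanishing on the axis, brings it under the weighted estimate.\<close>

lemma C2L_compose_zc:
  assumes R: "\<And>z. z \<in> {0..1} \<Longrightarrow> (R has_real_derivative R1 z) (at z within {0..1})"
    and R1c: "continuous_on {0..1} R1"
    and R1: "\<And>z. 0 \<le> z \<Longrightarrow> z < 1 \<Longrightarrow> (R1 has_real_derivative R2 z) (at z within {0..1})"
    and R2: "\<And>z. 0 \<le> z \<Longrightarrow> z < 1 \<Longrightarrow> (R2 has_real_derivative R3 z) (at z within {0..1})"
    and c: "\<And>z. 0 \<le> z \<Longrightarrow> z < 1 \<Longrightarrow> \<bar>R2 z\<bar> * sqrt (1 - z) \<le> c"
       "\<And>z. 0 \<le> z \<Longrightarrow> z < 1 \<Longrightarrow> \<bar>R3 z\<bar> * sqrt (1 - z) ^ 3 \<le> c"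
  shows "C2L (\<lambda>x. R (zc x))"
  unfolding C2L_def
proof (intro exI conjI ballI allI)
  fix x assume x: "x \<in> S3"
  then have "x \<noteq> 0" by (simp add: mem_S3)
  then show "has_grad (\<lambda>x. R (zc x)) (R1 (zc x) *\<^sub>R zgrad x) x S3"
    by (rule has_grad_compose[OF has_grad_zc R[OF zc_bounds[OF x]]]) (use zc_bounds in blast)
next
  fix i :: 3
  obtain w where w: "\<And>x. x \<in> S3 \<Longrightarrow> has_grad (\<lambda>x. zgrad x $ i) (w x) x S3" "loc_lipschitz S3 w"
    using C1L_zgrad[of i] unfolding C1L_def by blast
  have lR1: "loc_lipschitz S3 (\<lambda>x. R1 (zc x))" by (rule loc_lipschitz_compose_zc[OF R1c R1 c(1)])
  define b where "b z = R2 z * sqrt (1 - z)" for z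
  have "C1L (\<lambda>x. R1 (zc x) * zgrad x $ i)"
    unfolding C1L_def
  proof (intro exI conjI ballI)
    fix x assume x: "x \<in> S3"
    then have x0: "x \<noteq> 0" by (simp add: mem_S3)
    show "has_grad (\<lambda>x. R1 (zc x) * zgrad x $ i) (R1 (zc x) *\<^sub>R w x + (R2 (zc x) * zgrad x $ i) *\<^sub>R zgrad x) x S3"
    proof (cases "zc x < 1")
      case True
      have "has_grad (\<lambda>x. R1 (zc x)) (R2 (zc x) *\<^sub>R zgrad x) x S3"
        by (rule has_grad_compose[OF has_grad_zc[OF x0] R1]) (use zc_bounds[OF x] zc_bounds True in auto)
      from has_grad_mult[OF this w(1)[OF x]] show ?thesis by (simp add: mult.commute)
    next
      case False
      then have "sg x = 0" using sg_pos_iff[OF x] sg_nonneg[of x] by auto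
      then have z0: "zgrad x = 0" using norm_zgrad_le[OF x] by simp
      \<comment> \<open>On the axis R1 is only known to be continuous, but the component of grad z
        vanishes there.\<close>
      have "has_grad (\<lambda>x. R1 (zc x) * zgrad x $ i) (R1 (zc x) *\<^sub>R w x) x S3"
        by (rule has_grad_mult_vanishing[OF w(1)[OF x] loc_lipschitz_continuous[OF lR1] x]) (simp add: z0)
      then show ?thesis using z0 by simp
    qed
  next
    have c0: "c \<ge> 0" using c(1)[of 0] by simp
    \<comment> \<open>The constant \<open>2 * c\<close> covers c from R3 and c/2 from
      differentiating the root in \<open>b\<close>. The factor sqrt 2 inserted afterwards is the one
      relating \<open>sg\<close> to sqrt (1 - z).\<close>
    have "loc_lipschitz S3 (\<lambda>x. b (zc x) *\<^sub>R ((zgrad x $ i / sg x) *\<^sub>R zgrad x))"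
    proof (rule loc_lipschitz_weighted[where c = "2 * c"])
      fix z :: real assume z: "0 \<le> z" "z < 1"
      show "(b has_real_derivative R3 z * sqrt (1 - z) - R2 z / (2 * sqrt (1 - z))) (at z within {0..1})"
        unfolding b_def using z by (auto intro!: derivative_eq_intros R2 simp: field_simps)
      show "\<bar>b z\<bar> \<le> 2 * c" using c(1)[OF z] c0 z unfolding b_def abs_mult by simp
      have s: "sqrt (1 - z) > 0" "1 - z = sqrt (1 - z) * sqrt (1 - z)" using z by auto
      have "\<bar>R3 z * sqrt (1 - z) - R2 z / (2 * sqrt (1 - z))\<bar> * (1 - z)
          \<le> (\<bar>R3 z\<bar> * sqrt (1 - z) + \<bar>R2 z\<bar> / (2 * sqrt (1 - z))) * (1 - z)"
        using z s by (intro mult_right_mono order_trans[OF abs_triangle_ineq4] add_mono) (auto simp: abs_mult)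
      also have "\<dots> = \<bar>R3 z\<bar> * sqrt (1 - z) ^ 3 + \<bar>R2 z\<bar> * sqrt (1 - z) / 2"
        using s(1) by (subst (3) s(2)) (simp add: field_simps power3_eq_cube)
      also have "\<dots> \<le> 2 * c" using c(1)[OF z] c(2)[OF z] c0 by simp
      finally show "\<bar>R3 z * sqrt (1 - z) - R2 z / (2 * sqrt (1 - z))\<bar> * (1 - z) \<le> 2 * c" .
    next
      show "axis_vanishing (\<lambda>x. (zgrad x $ i / sg x) *\<^sub>R zgrad x)"
        by (rule axis_vanishing_div[OF axis_vanishing_zgrad(2,1)])
    qed
    from loc_lipschitz_scaleR[OF loc_lipschitz_const[of S3 "sqrt 2"] this]
    have lip: "loc_lipschitz S3 (\<lambda>x. R1 (zc x) *\<^sub>R w x + sqrt 2 *\<^sub>R b (zc x) *\<^sub>R ((zgrad x $ i / sg x) *\<^sub>R zgrad x))"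
      by (rule loc_lipschitz_add[OF loc_lipschitz_scaleR[OF lR1 w(2)]])
    have eq: "sqrt 2 *\<^sub>R b (zc x) *\<^sub>R ((zgrad x $ i / sg x) *\<^sub>R zgrad x) = (R2 (zc x) * zgrad x $ i) *\<^sub>R zgrad x"
      if x: "x \<in> S3" for x
    proof (cases "sg x = 0")
      case True
      then have z0: "zgrad x = 0" using norm_zgrad_le[OF x] by simp
      then show ?thesis by simp
    next
      case False
      then show ?thesis using sg_eq_sqrt[OF x] by (simp add: b_def field_simps)
    qed
    show "loc_lipschitz S3 (\<lambda>x. R1 (zc x) *\<^sub>R w x + (R2 (zc x) * zgrad x $ i) *\<^sub>R zgrad x)"
      by (rule loc_lipschitz_cong[OF _ lip]) (simp only: eq)
  qed
  then show "C1L (\<lambda>x. (R1 (zc x) *\<^sub>R zgrad x) $ i)" by simp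
qed

section \<open>Passing from gradients to operator-valued derivatives\<close>

definition coord_blinfun :: "3 \<Rightarrow> 'b::real_normed_vector \<Rightarrow> (real^3) \<Rightarrow>\<^sub>L 'b" where
  "coord_blinfun i e = blinfun_scaleR_left e o\<^sub>L blinfun_inner_left (axis i 1)"

lemma coord_blinfun_apply [simp]: "blinfun_apply (coord_blinfun i e) h = (h $ i) *\<^sub>R e"
  by (simp add: coord_blinfun_def inner_axis)

text \<open>The derivative is a finite sum of scalar functions times fixed elementary operators h
  \<mapsto> h_i e. It has the same shape as the function differentiated, so a second application
  gives the second derivative, and continuity or Lipschitz bounds reduce to scalar
  coefficients.\<close>

lemma has_continuous_derivative_on_sum:
  fixes e :: "'k \<Rightarrow> 'b::real_normed_vector"
  assumes fin: "finite I" and g: "\<And>k x. k \<in> I \<Longrightarrow> x \<in> S3 \<Longrightarrow> has_grad (\<phi> k) (g k x) x S3"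
    and cont: "\<And>k. k \<in> I \<Longrightarrow> continuous_on S3 (g k)"
  shows "has_continuous_derivative_on (\<lambda>x. \<Sum>k\<in>I. \<phi> k x *\<^sub>R e k)
     (\<lambda>x. \<Sum>(k, i)\<in>I \<times> UNIV. (g k x $ i) *\<^sub>R coord_blinfun i (e k)) S3"
  unfolding has_continuous_derivative_on_def
proof (intro conjI ballI)
  fix x assume x: "x \<in> S3"
  have "((\<lambda>x. \<Sum>k\<in>I. \<phi> k x *\<^sub>R e k) has_derivative (\<lambda>h. \<Sum>k\<in>I. inner (g k x) h *\<^sub>R e k)) (at x within S3)"
    by (intro has_derivative_sum has_derivative_scaleR_left g[unfolded has_grad_def] x)
  moreover have "(\<Sum>k\<in>I. inner (g k x) h *\<^sub>R e k) =
      blinfun_apply (\<Sum>(k, i)\<in>I \<times> UNIV. (g k x $ i) *\<^sub>R coord_blinfun i (e k)) h" for h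
    unfolding sum.cartesian_product[symmetric]
    by (simp add: blinfun.sum_left blinfun.scaleR_left inner_vec_def scaleR_sum_left)
  ultimately show "((\<lambda>x. \<Sum>k\<in>I. \<phi> k x *\<^sub>R e k) has_derivative
      blinfun_apply (\<Sum>(k, i)\<in>I \<times> UNIV. (g k x $ i) *\<^sub>R coord_blinfun i (e k))) (at x within S3)"
    by simp
next
  show "continuous_on S3 (\<lambda>x. \<Sum>(k, i)\<in>I \<times> UNIV. (g k x $ i) *\<^sub>R coord_blinfun i (e k))"
    unfolding case_prod_unfold by (intro continuous_intros cont) auto
qed

lemma C1L_imp_C1_Holder:
  assumes "C1L f" "\<alpha> \<in> {0<..<1}" shows "C1_Holder_loc_on \<alpha> S3 f"
proof -
  obtain g where g: "\<And>x. x \<in> S3 \<Longrightarrow> has_grad f (g x) x S3" "loc_lipschitz S3 g"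
    using assms unfolding C1L_def by blast
  let ?f' = "\<lambda>x. \<Sum>(k, i)\<in>{()} \<times> UNIV. (g x $ i) *\<^sub>R coord_blinfun i (1::real)"
  have "has_continuous_derivative_on (\<lambda>x. \<Sum>k\<in>{()}. f x *\<^sub>R 1) ?f' S3"
    by (rule has_continuous_derivative_on_sum) (use g loc_lipschitz_continuous in auto)
  then have "has_continuous_derivative_on f ?f' S3" by simp
  moreover have "loc_lipschitz S3 ?f'" unfolding case_prod_unfold
    by (intro loc_lipschitz_sum loc_lipschitz_scaleR loc_lipschitz_const
        loc_lipschitz_bounded_linear[OF bounded_linear_vec_nth] g(2))
  ultimately show ?thesis unfolding C1_Holder_loc_on_def using loc_lipschitz_imp_Holder assms(2) by blast
qed

lemma C2L_imp_C2_Holder: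
  fixes u :: "real^3 \<Rightarrow> real^3"
  assumes "\<And>k. C2L (\<lambda>x. u x $ k)"
  obtains f' f'' where "has_continuous_derivative_on u f' S3" "has_continuous_derivative_on f' f'' S3"
    "loc_lipschitz S3 f''"
proof -
  obtain g where g: "\<And>k x. x \<in> S3 \<Longrightarrow> has_grad (\<lambda>x. u x $ k) (g k x) x S3" "\<And>k i. C1L (\<lambda>x. g k x $ i)"
    using assms unfolding C2L_def by metis
  obtain w where w: "\<And>k i x. x \<in> S3 \<Longrightarrow> has_grad (\<lambda>x. g k x $ i) (w k i x) x S3" "\<And>k i. loc_lipschitz S3 (w k i)"
    using g(2) unfolding C1L_def by metis
  let ?f' = "\<lambda>x. \<Sum>(k, i)\<in>UNIV \<times> UNIV. (g k x $ i) *\<^sub>R coord_blinfun i (axis k 1 :: real^3)"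
  let ?f'' = "\<lambda>x. \<Sum>(p, j)\<in>(UNIV \<times> UNIV) \<times> UNIV. (w (fst p) (snd p) x $ j) *\<^sub>R coord_blinfun j (coord_blinfun (snd p) (axis (fst p) 1 :: real^3))"
  have cg: "continuous_on S3 (g k)" for k
    by (intro loc_lipschitz_continuous loc_lipschitz_vecI C1L_loc_lipschitz g(2))
  have "has_continuous_derivative_on (\<lambda>x. \<Sum>k\<in>UNIV. (u x $ k) *\<^sub>R axis k 1) ?f' S3"
    by (rule has_continuous_derivative_on_sum) (use g cg in auto)
  moreover have "(\<Sum>k\<in>UNIV. (u x $ k) *\<^sub>R axis k (1::real)) = u x" for x
    using basis_expansion[of "u x"] by (simp add: scalar_mult_eq_scaleR)
  ultimately have 1: "has_continuous_derivative_on u ?f' S3" by simp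
  have "has_continuous_derivative_on (\<lambda>x. \<Sum>p\<in>UNIV \<times> UNIV. (g (fst p) x $ snd p) *\<^sub>R coord_blinfun (snd p) (axis (fst p) 1 :: real^3)) ?f'' S3"
    by (rule has_continuous_derivative_on_sum) (use w in \<open>auto intro!: loc_lipschitz_continuous\<close>)
  then have 2: "has_continuous_derivative_on ?f' ?f'' S3" by (simp add: case_prod_unfold)
  have "loc_lipschitz S3 ?f''" unfolding case_prod_unfold
    by (intro loc_lipschitz_sum loc_lipschitz_scaleR loc_lipschitz_const
        loc_lipschitz_bounded_linear[OF bounded_linear_vec_nth] w(2))
  with 1 2 show ?thesis by (rule that)
qed

section \<open>The Navier--Stokes operators on homogeneous axisymmetric fields\<close>

lemma partial_eq:
  fixes f :: "real^'n \<Rightarrow> 'b::real_normed_vector"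
  assumes "(f has_derivative f') (at x)" shows "partial i f x = f' (axis i 1)"
proof -
  have 1: "((\<lambda>t::real. x + t *\<^sub>R axis i 1) has_derivative (\<lambda>t. t *\<^sub>R axis i 1)) (at 0)"
    by (auto intro!: derivative_eq_intros)
  have 2: "(f has_derivative f') (at (x + 0 *\<^sub>R axis i 1))" using assms by simp
  interpret f': bounded_linear f' using assms by (rule has_derivative_bounded_linear)
  have "((\<lambda>t. f (x + t *\<^sub>R axis i 1)) has_vector_derivative f' (axis i 1)) (at 0)"
    using has_derivative_compose[OF 1 2] unfolding has_vector_derivative_def by (simp add: f'.scaleR)
  then show ?thesis unfolding partial_def by (rule vector_derivative_at)
qed

lemma partial_cong:
  fixes f :: "real^'n \<Rightarrow> 'b::real_normed_vector"
  assumes "open U" "x \<in> U" "\<And>y. y \<in> U \<Longrightarrow> f y = g y"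
  shows "partial i f x = partial i g x"
  unfolding partial_def
proof (rule vector_derivative_cong_eq)
  have "((\<lambda>t::real. x + t *\<^sub>R axis i 1) \<longlongrightarrow> x + 0 *\<^sub>R axis i 1) (nhds 0)"
    by (intro tendsto_intros filterlim_ident)
  then have "\<forall>\<^sub>F t in nhds 0. x + t *\<^sub>R axis i (1::real) \<in> U"
    using assms(1,2) by (auto dest: topological_tendstoD)
  then show "\<forall>\<^sub>F t in nhds 0. t \<in> UNIV \<longrightarrow> f (x + t *\<^sub>R axis i 1) = g (x + t *\<^sub>R axis i 1)"
    by (rule eventually_mono) (use assms(3) in auto)
qed auto

lemma partial_partial_eq:
  fixes f :: "real^'n \<Rightarrow> 'b::real_normed_vector"
  assumes "open U" "x \<in> U" "\<And>y. y \<in> U \<Longrightarrow> partial i f y = g y" "(g has_derivative g') (at x)"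
  shows "partial i (partial i f) x = g' (axis i 1)"
  using partial_cong[OF assms(1-3)] partial_eq[OF assms(4)] by simp

lemma has_grad_partial: "has_grad f v x UNIV \<Longrightarrow> partial i f x = v $ i"
  unfolding has_grad_def by (drule partial_eq) (simp add: inner_axis)

lemma has_derivative_vecI:
  fixes f :: "'a::euclidean_space \<Rightarrow> real^'n"
  assumes "\<And>j. ((\<lambda>x. f x $ j) has_derivative (\<lambda>h. f' h $ j)) (at x within S)"
  shows "(f has_derivative f') (at x within S)"
  using assms unfolding has_derivative_componentwise_within[of f]
  by (auto simp: Basis_vec_def inner_axis)

text \<open>\<open>G\<close> is the gradient and \<open>L\<close> the Laplacian of \<open>f\<close>
  on \<open>U\<close>. The Hessian stays existential because only its trace has to be carried
  through the product and chain rules in explicit form.\<close>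

definition has_lap :: "(real^3) set \<Rightarrow> (real^3 \<Rightarrow> real) \<Rightarrow> (real^3 \<Rightarrow> real^3) \<Rightarrow> (real^3 \<Rightarrow> real) \<Rightarrow> bool" where
  "has_lap U f G L \<longleftrightarrow> (\<forall>x\<in>U. has_grad f (G x) x UNIV \<and>
     (\<exists>M. (\<forall>i. has_grad (\<lambda>x. G x $ i) (M i) x UNIV) \<and> (\<Sum>i\<in>UNIV. M i $ i) = L x))"

lemma has_grad_transform:
  assumes "open U" "x \<in> U" "\<And>y. y \<in> U \<Longrightarrow> f y = g y" "has_grad f v x UNIV"
  shows "has_grad g v x UNIV"
  using assms unfolding has_grad_def by (auto intro: has_derivative_transform_within_open)

lemma has_lap_cong:
  assumes "has_lap U f G L" "open U"
    and "\<And>x. x \<in> U \<Longrightarrow> f x = f' x" "\<And>x. x \<in> U \<Longrightarrow> G x = G' x" "\<And>x. x \<in> U \<Longrightarrow> L x = L' x"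
  shows "has_lap U f' G' L'"
  unfolding has_lap_def
proof
  fix x assume x: "x \<in> U"
  obtain M where 1: "has_grad f (G x) x UNIV" and 2: "\<And>i. has_grad (\<lambda>x. G x $ i) (M i) x UNIV"
    and 3: "(\<Sum>i\<in>UNIV. M i $ i) = L x" using assms(1) x unfolding has_lap_def by blast
  have "has_grad f' (G' x) x UNIV"
    using has_grad_transform[OF assms(2) x assms(3) 1] assms(4)[OF x] by simp
  moreover have "has_grad (\<lambda>x. G' x $ i) (M i) x UNIV" for i
    by (rule has_grad_transform[OF assms(2) x _ 2]) (simp add: assms(4))
  ultimately show "has_grad f' (G' x) x UNIV \<and>
     (\<exists>M. (\<forall>i. has_grad (\<lambda>x. G' x $ i) (M i) x UNIV) \<and> (\<Sum>i\<in>UNIV. M i $ i) = L' x)"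
    using 3 assms(5)[OF x] by auto
qed

lemma has_lap_const: "has_lap U (\<lambda>_. c) (\<lambda>_. 0) (\<lambda>_. 0)"
  unfolding has_lap_def by (auto intro!: has_grad_const exI[of _ "\<lambda>_. 0"])

lemma has_lap_nth: "has_lap U (\<lambda>x. x $ i) (\<lambda>_. axis i 1) (\<lambda>_. 0)"
  unfolding has_lap_def by (auto intro!: has_grad_const has_grad_nth exI[of _ "\<lambda>_. 0"])

lemma has_lap_add:
  assumes "has_lap U f F K" "has_lap U g G L"
  shows "has_lap U (\<lambda>x. f x + g x) (\<lambda>x. F x + G x) (\<lambda>x. K x + L x)"
  unfolding has_lap_def
proof
  fix x assume x: "x \<in> U"
  obtain M where 1: "has_grad f (F x) x UNIV" "\<And>i. has_grad (\<lambda>x. F x $ i) (M i) x UNIV"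
    "(\<Sum>i\<in>UNIV. M i $ i) = K x" using assms(1) x unfolding has_lap_def by blast
  obtain N where 2: "has_grad g (G x) x UNIV" "\<And>i. has_grad (\<lambda>x. G x $ i) (N i) x UNIV"
    "(\<Sum>i\<in>UNIV. N i $ i) = L x" using assms(2) x unfolding has_lap_def by blast
  show "has_grad (\<lambda>x. f x + g x) (F x + G x) x UNIV \<and>
     (\<exists>M. (\<forall>i. has_grad (\<lambda>x. (F x + G x) $ i) (M i) x UNIV) \<and> (\<Sum>i\<in>UNIV. M i $ i) = K x + L x)"
    using 1 2 by (auto intro!: has_grad_add exI[of _ "\<lambda>i. M i + N i"] simp: sum.distrib)
qed

lemma has_lap_mult:
  assumes "has_lap U f F K" "has_lap U g G L"
  shows "has_lap U (\<lambda>x. f x * g x) (\<lambda>x. f x *\<^sub>R G x + g x *\<^sub>R F x)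
    (\<lambda>x. f x * L x + 2 * inner (F x) (G x) + g x * K x)"
  unfolding has_lap_def
proof
  fix x assume x: "x \<in> U"
  obtain M where 1: "has_grad f (F x) x UNIV" "\<And>i. has_grad (\<lambda>x. F x $ i) (M i) x UNIV"
    "(\<Sum>i\<in>UNIV. M i $ i) = K x" using assms(1) x unfolding has_lap_def by blast
  obtain N where 2: "has_grad g (G x) x UNIV" "\<And>i. has_grad (\<lambda>x. G x $ i) (N i) x UNIV"
    "(\<Sum>i\<in>UNIV. N i $ i) = L x" using assms(2) x unfolding has_lap_def by blast
  have h: "has_grad (\<lambda>x. f x * G x $ i + g x * F x $ i)
     (f x *\<^sub>R N i + G x $ i *\<^sub>R F x + (g x *\<^sub>R M i + F x $ i *\<^sub>R G x)) x UNIV" for i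
    by (intro has_grad_add has_grad_mult 1 2)
  have "(\<Sum>i\<in>UNIV. (f x *\<^sub>R N i + G x $ i *\<^sub>R F x + (g x *\<^sub>R M i + F x $ i *\<^sub>R G x)) $ i)
     = f x * L x + 2 * inner (F x) (G x) + g x * K x"
    by (simp add: sum.distrib inner_vec_def 1(3)[symmetric] 2(3)[symmetric] sum_distrib_left mult.commute)
  with h show "has_grad (\<lambda>x. f x * g x) (f x *\<^sub>R G x + g x *\<^sub>R F x) x UNIV \<and>
     (\<exists>M. (\<forall>i. has_grad (\<lambda>x. (f x *\<^sub>R G x + g x *\<^sub>R F x) $ i) (M i) x UNIV) \<and>
        (\<Sum>i\<in>UNIV. M i $ i) = f x * L x + 2 * inner (F x) (G x) + g x * K x)"
    using has_grad_mult[OF 1(1) 2(1)] by (auto intro!: exI[of _ "\<lambda>i. f x *\<^sub>R N i + G x $ i *\<^sub>R F x + (g x *\<^sub>R M i + F x $ i *\<^sub>R G x)"])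
qed

lemma has_grad_compose_open:
  assumes "has_grad f v x UNIV" "(R has_real_derivative r) (at (f x))"
  shows "has_grad (\<lambda>x. R (f x)) (r *\<^sub>R v) x UNIV"
  using has_grad_compose[OF assms(1), of R r UNIV] assms(2) by simp

lemma has_lap_compose:
  assumes f: "has_lap U f F K" and T: "\<And>x. x \<in> U \<Longrightarrow> f x \<in> T"
    and R: "\<And>z. z \<in> T \<Longrightarrow> (R has_real_derivative R1 z) (at z)" "\<And>z. z \<in> T \<Longrightarrow> (R1 has_real_derivative R2 z) (at z)"
  shows "has_lap U (\<lambda>x. R (f x)) (\<lambda>x. R1 (f x) *\<^sub>R F x) (\<lambda>x. R2 (f x) * inner (F x) (F x) + R1 (f x) * K x)"
  unfolding has_lap_def
proof
  fix x assume x: "x \<in> U"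
  obtain M where 1: "has_grad f (F x) x UNIV" "\<And>i. has_grad (\<lambda>x. F x $ i) (M i) x UNIV"
    "(\<Sum>i\<in>UNIV. M i $ i) = K x" using f x unfolding has_lap_def by blast
  have h: "has_grad (\<lambda>x. R1 (f x) * F x $ i) (R1 (f x) *\<^sub>R M i + F x $ i *\<^sub>R (R2 (f x) *\<^sub>R F x)) x UNIV" for i
    by (intro has_grad_mult has_grad_compose_open 1 R T x)
  have "(\<Sum>i\<in>UNIV. (R1 (f x) *\<^sub>R M i + F x $ i *\<^sub>R (R2 (f x) *\<^sub>R F x)) $ i) = R2 (f x) * inner (F x) (F x) + R1 (f x) * K x"
    by (simp add: sum.distrib inner_vec_def 1(3)[symmetric] sum_distrib_left mult_ac)
  with h show "has_grad (\<lambda>x. R (f x)) (R1 (f x) *\<^sub>R F x) x UNIV \<and>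
     (\<exists>M. (\<forall>i. has_grad (\<lambda>x. (R1 (f x) *\<^sub>R F x) $ i) (M i) x UNIV) \<and>
        (\<Sum>i\<in>UNIV. M i $ i) = R2 (f x) * inner (F x) (F x) + R1 (f x) * K x)"
    using has_grad_compose_open[OF 1(1) R(1)[OF T[OF x]]]
    by (auto intro!: exI[of _ "\<lambda>i. R1 (f x) *\<^sub>R M i + F x $ i *\<^sub>R (R2 (f x) *\<^sub>R F x)"])
qed

abbreviation inorm :: "real^3 \<Rightarrow> real" where "inorm x \<equiv> inverse (norm x)"

definition nvec :: "real^3 \<Rightarrow> real^3" where "nvec x = inorm x *\<^sub>R x"

lemma nvec_facts:
  assumes "x \<noteq> 0"
  shows "inner (nvec x) (nvec x) = 1" "inner (nvec x) (axis i 1) = nvec x $ i" "inner (axis i 1) (nvec x) = nvec x $ i"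
    "nvec x $ 3 = zc x"
proof -
  have "norm (nvec x) = 1" using assms by (simp add: nvec_def)
  then show "inner (nvec x) (nvec x) = 1" by (simp only: dot_square_norm) simp
qed (auto simp: inner_axis inner_axis' zc_def nvec_def)

lemma inner_axis_axis: "inner (axis i (1::real)) (axis j 1) = (if i = j then 1 else 0 :: real)"
  by (simp add: inner_axis_axis)

lemma zgrad_nvec: "zgrad x = inorm x *\<^sub>R (axis 3 1 - zc x *\<^sub>R nvec x)"
  by (simp add: zgrad_def nvec_def)

context
  fixes U :: "(real^3) set"
  assumes U: "open U" and U0: "0 \<notin> U"
begin

lemma U_nz: "x \<in> U \<Longrightarrow> x \<noteq> 0" using U0 by auto

text \<open>1/|x| is harmonic in dimension three: in the trace of -|x|^(-3) I + 3 |x|^(-5) x x^T the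
  first part gives -3 |x|^(-3) and the second 3 |x|^(-3).\<close>

lemma has_lap_inorm: "has_lap U inorm (\<lambda>x. - ((inorm x)\<^sup>2) *\<^sub>R nvec x) (\<lambda>_. 0)"
  unfolding has_lap_def
proof
  fix x assume "x \<in> U"
  then have x0: "x \<noteq> 0" by (rule U_nz)
  have g: "has_grad inorm (- (inorm x ^ 3) *\<^sub>R x) x UNIV" by (rule has_grad_inverse_norm[OF x0])
  note g2 = has_grad_mult[OF g g] and g3 = has_grad_mult[OF g has_grad_mult[OF g g]]
  note g4 = has_grad_mult[OF has_grad_mult[OF has_grad_const[of "-1"] g3] has_grad_nth]
  have feq: "(\<lambda>x. - 1 * (inorm x * (inorm x * inorm x)) * x $ i) = (\<lambda>x. (- ((inorm x)\<^sup>2) *\<^sub>R nvec x) $ i)" for i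
    by (simp add: nvec_def fun_eq_iff power2_eq_square mult_ac)
  have h: "has_grad (\<lambda>x. (- ((inorm x)\<^sup>2) *\<^sub>R nvec x) $ i)
     (- (inorm x ^ 3) *\<^sub>R axis i 1 + (3 * inorm x ^ 5 * x $ i) *\<^sub>R x) x UNIV" for i
    by (rule has_grad_eq[OF g4[of i, unfolded feq]]) (simp add: vec_eq_iff algebra_simps power_numeral_reduce)
  have s: "(\<Sum>i\<in>UNIV. x $ i * x $ i) = (norm x)\<^sup>2" by (simp add: power2_norm_eq_inner inner_vec_def)
  have "(\<Sum>i\<in>UNIV. (- (inorm x ^ 3) *\<^sub>R axis i 1 + (3 * inorm x ^ 5 * x $ i) *\<^sub>R x) $ i)
     = - 3 * inorm x ^ 3 + 3 * inorm x ^ 5 * (\<Sum>i\<in>UNIV. x $ i * x $ i)"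
    by (simp add: sum.distrib sum_subtractf sum_distrib_left mult.assoc)
  also have "\<dots> = 0" unfolding s using x0 by (simp add: field_simps power_numeral_reduce)
  finally show "has_grad inorm (- ((inorm x)\<^sup>2) *\<^sub>R nvec x) x UNIV \<and>
    (\<exists>M. (\<forall>i. has_grad (\<lambda>x. (- ((inorm x)\<^sup>2) *\<^sub>R nvec x) $ i) (M i) x UNIV) \<and> (\<Sum>i\<in>UNIV. M i $ i) = 0)"
    using h has_grad_eq[OF g, of "- ((inorm x)\<^sup>2) *\<^sub>R nvec x"]
    by (auto simp: nvec_def power_numeral_reduce mult.assoc intro!: exI)
qed

text \<open>The components of x/|x| are spherical harmonics of degree one, with eigenvalue -2 on the
  unit sphere.\<close>

lemma has_lap_nvec:
  "has_lap U (\<lambda>x. nvec x $ j) (\<lambda>x. inorm x *\<^sub>R (axis j 1 - (nvec x $ j) *\<^sub>R nvec x)) (\<lambda>x. - 2 * (inorm x)\<^sup>2 * nvec x $ j)"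
  apply (rule has_lap_cong[OF has_lap_mult[OF has_lap_inorm has_lap_nth[of _ j]] U])
  by (simp_all add: nvec_def inner_axis algebra_simps power2_eq_square)

lemma has_lap_zc: "has_lap U zc zgrad (\<lambda>x. - 2 * (inorm x)\<^sup>2 * zc x)"
  by (rule has_lap_cong[OF has_lap_nvec[of 3] U]) (auto simp: zc_def zgrad_nvec nvec_def mult.commute)

lemma has_lap_nvec_inorm:
  "has_lap U (\<lambda>x. nvec x $ j * inorm x) (\<lambda>x. (inorm x)\<^sup>2 *\<^sub>R (axis j 1 - (2 * nvec x $ j) *\<^sub>R nvec x))
     (\<lambda>x. - 2 * (inorm x) ^ 3 * nvec x $ j)"
proof (rule has_lap_cong[OF has_lap_mult[OF has_lap_nvec has_lap_inorm] U])
  fix x assume "x \<in> U"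
  then have x0: "x \<noteq> 0" by (rule U_nz)
  note n = nvec_facts[OF x0]
  show "(nvec x $ j) *\<^sub>R (- ((inorm x)\<^sup>2) *\<^sub>R nvec x) + inorm x *\<^sub>R inorm x *\<^sub>R (axis j 1 - (nvec x $ j) *\<^sub>R nvec x)
     = (inorm x)\<^sup>2 *\<^sub>R (axis j 1 - (2 * nvec x $ j) *\<^sub>R nvec x)"
    by (simp add: vec_eq_iff algebra_simps power2_eq_square)
  have i: "inner (inorm x *\<^sub>R (axis j 1 - (nvec x $ j) *\<^sub>R nvec x)) (- ((inorm x)\<^sup>2) *\<^sub>R nvec x) = 0"
    unfolding inner_scaleR_left inner_scaleR_right inner_diff_left n by simp
  show "nvec x $ j * 0 + 2 * inner (inorm x *\<^sub>R (axis j 1 - (nvec x $ j) *\<^sub>R nvec x)) (- ((inorm x)\<^sup>2) *\<^sub>R nvec x)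
     + inorm x * (- 2 * (inorm x)\<^sup>2 * nvec x $ j) = - 2 * (inorm x) ^ 3 * nvec x $ j"
    unfolding i by (simp add: power_numeral_reduce)
qed simp

section \<open>Profile functions of z times the basic homogeneous fields\<close>

context
  fixes T :: "real set" and R R1 R2 :: "real \<Rightarrow> real"
  assumes T: "\<And>x. x \<in> U \<Longrightarrow> zc x \<in> T"
    and R: "\<And>z. z \<in> T \<Longrightarrow> (R has_real_derivative R1 z) (at z)" "\<And>z. z \<in> T \<Longrightarrow> (R1 has_real_derivative R2 z) (at z)"
begin

text \<open>Building block for A(z) n/\<rho> and for the swirl field, whose components are all a
  profile times n_j/\<rho> up to sign. The extra term for j = 3 comes from the e_3 part of grad
  z.\<close>

lemma has_lap_zc_nvec:
  "has_lap U (\<lambda>x. R (zc x) * (nvec x $ j * inorm x))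
    (\<lambda>x. (R1 (zc x) * nvec x $ j * inorm x) *\<^sub>R zgrad x + (R (zc x) * (inorm x)\<^sup>2) *\<^sub>R (axis j 1 - (2 * nvec x $ j) *\<^sub>R nvec x))
    (\<lambda>x. (inorm x) ^ 3 * (nvec x $ j * ((1 - (zc x)\<^sup>2) * R2 (zc x) - 4 * zc x * R1 (zc x) - 2 * R (zc x))
        + 2 * R1 (zc x) * (if j = 3 then 1 else 0)))"
proof (rule has_lap_cong[OF has_lap_mult[OF has_lap_compose[OF has_lap_zc T R] has_lap_nvec_inorm] U])
  fix x assume "x \<in> U"
  then have x0: "x \<noteq> 0" by (rule U_nz)
  note n = nvec_facts[OF x0]
  show "R (zc x) *\<^sub>R (inorm x)\<^sup>2 *\<^sub>R (axis j 1 - (2 * nvec x $ j) *\<^sub>R nvec x) + (nvec x $ j * inorm x) *\<^sub>R R1 (zc x) *\<^sub>R zgrad x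
     = (R1 (zc x) * nvec x $ j * inorm x) *\<^sub>R zgrad x + (R (zc x) * (inorm x)\<^sup>2) *\<^sub>R (axis j 1 - (2 * nvec x $ j) *\<^sub>R nvec x)"
    by (simp add: mult_ac)
  have i: "inner (R1 (zc x) *\<^sub>R zgrad x) ((inorm x)\<^sup>2 *\<^sub>R (axis j 1 - (2 * nvec x $ j) *\<^sub>R nvec x))
     = R1 (zc x) * (inorm x) ^ 3 * ((if j = 3 then 1 else 0) - zc x * nvec x $ j)"
    unfolding zgrad_nvec inner_scaleR_left inner_scaleR_right inner_diff_left inner_diff_right n inner_axis_axis
    by (simp add: algebra_simps power_numeral_reduce)
  show "R (zc x) * (- 2 * (inorm x) ^ 3 * nvec x $ j) + 2 * inner (R1 (zc x) *\<^sub>R zgrad x) ((inorm x)\<^sup>2 *\<^sub>R (axis j 1 - (2 * nvec x $ j) *\<^sub>R nvec x))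
      + nvec x $ j * inorm x * (R2 (zc x) * inner (zgrad x) (zgrad x) + R1 (zc x) * (- 2 * (inorm x)\<^sup>2 * zc x))
     = (inorm x) ^ 3 * (nvec x $ j * ((1 - (zc x)\<^sup>2) * R2 (zc x) - 4 * zc x * R1 (zc x) - 2 * R (zc x))
        + 2 * R1 (zc x) * (if j = 3 then 1 else 0))"
    unfolding i inner_zgrad[OF x0] by (simp add: algebra_simps power_numeral_reduce)
qed auto

lemma has_lap_zc_inorm:
  "has_lap U (\<lambda>x. R (zc x) * inorm x)
    (\<lambda>x. (R1 (zc x) * inorm x) *\<^sub>R zgrad x - (R (zc x) * (inorm x)\<^sup>2) *\<^sub>R nvec x)
    (\<lambda>x. (inorm x) ^ 3 * ((1 - (zc x)\<^sup>2) * R2 (zc x) - 2 * zc x * R1 (zc x)))"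
proof (rule has_lap_cong[OF has_lap_mult[OF has_lap_compose[OF has_lap_zc T R] has_lap_inorm] U])
  fix x assume "x \<in> U"
  then have x0: "x \<noteq> 0" by (rule U_nz)
  note n = nvec_facts[OF x0]
  show "R (zc x) *\<^sub>R - ((inorm x)\<^sup>2) *\<^sub>R nvec x + inorm x *\<^sub>R R1 (zc x) *\<^sub>R zgrad x =
     (R1 (zc x) * inorm x) *\<^sub>R zgrad x - (R (zc x) * (inorm x)\<^sup>2) *\<^sub>R nvec x"
    by (simp add: mult_ac)
  have i: "inner (R1 (zc x) *\<^sub>R zgrad x) (- ((inorm x)\<^sup>2) *\<^sub>R nvec x) = 0"
    unfolding zgrad_nvec inner_scaleR_left inner_scaleR_right inner_diff_left n by simp
  show "R (zc x) * 0 + 2 * inner (R1 (zc x) *\<^sub>R zgrad x) (- ((inorm x)\<^sup>2) *\<^sub>R nvec x)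
    + inorm x * (R2 (zc x) * inner (zgrad x) (zgrad x) + R1 (zc x) * (- 2 * (inorm x)\<^sup>2 * zc x))
    = (inorm x) ^ 3 * ((1 - (zc x)\<^sup>2) * R2 (zc x) - 2 * zc x * R1 (zc x))"
    unfolding i inner_zgrad[OF x0] by (simp add: algebra_simps power_numeral_reduce)
qed auto

end

lemma vector_operators:
  fixes u :: "real^3 \<Rightarrow> real^3"
  assumes u: "\<And>j. has_lap U (\<lambda>x. u x $ j) (G j) (L j)" and x: "x \<in> U"
  shows "laplacian u x $ j = L j x" "divergence u x = (\<Sum>i\<in>UNIV. G i x $ i)"
    "advection u u x $ j = inner (u x) (G j x)"
proof -
  have p: "partial i u y = (\<chi> j. G j y $ i)" if "y \<in> U" for y i
  proof -
    have "(u has_derivative (\<lambda>h. \<chi> j. inner (G j y) h)) (at y)"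
      using u that unfolding has_lap_def has_grad_def by (intro has_derivative_vecI) auto
    from partial_eq[OF this] show ?thesis by (simp add: inner_axis)
  qed
  show "divergence u x = (\<Sum>i\<in>UNIV. G i x $ i)" using p[OF x] by (simp add: divergence_def)
  show "advection u u x $ j = inner (u x) (G j x)" using p[OF x]
    by (simp add: advection_def inner_vec_def)
  have "\<forall>j. \<exists>M. (\<forall>i. has_grad (\<lambda>x. G j x $ i) (M i) x UNIV) \<and> (\<Sum>i\<in>UNIV. M i $ i) = L j x"
    using u x unfolding has_lap_def by blast
  then obtain M where M: "\<And>j i. has_grad (\<lambda>x. G j x $ i) (M j i) x UNIV" "\<And>j. (\<Sum>i\<in>UNIV. M j i $ i) = L j x"
    by metis
  have "partial i (partial i u) x = (\<chi> j. M j i $ i)" for i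
  proof -
    have "((\<lambda>y. \<chi> j. G j y $ i) has_derivative (\<lambda>h. \<chi> j. inner (M j i) h)) (at x)"
      using M unfolding has_grad_def by (intro has_derivative_vecI) auto
    from partial_partial_eq[OF U x p this] show ?thesis by (simp add: inner_axis)
  qed
  then show "laplacian u x $ j = L j x" by (simp add: laplacian_def M(2))
qed

text \<open>With \<open>n = x / \<rho>\<close> and \<open>z = cos \<phi>\<close>, every axisymmetric field homogeneous of degree \<open>-1\<close> is off the axis
  of the form \<open>\<rho>\<^sup>-\<^sup>1 (A(z) n + B(z) e\<^sub>3 + H(z) e\<^sub>3 \<times> n)\<close>; in these variables no square root appears.\<close>

lemma NS_operators:
  fixes A B H P :: "real \<Rightarrow> real" and u :: "real^3 \<Rightarrow> real^3" and p :: "real^3 \<Rightarrow> real"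
  assumes T: "\<And>x. x \<in> U \<Longrightarrow> zc x \<in> T"
    and A: "\<And>z. z \<in> T \<Longrightarrow> (A has_real_derivative A1 z) (at z)" "\<And>z. z \<in> T \<Longrightarrow> (A1 has_real_derivative A2 z) (at z)"
    and B: "\<And>z. z \<in> T \<Longrightarrow> (B has_real_derivative B1 z) (at z)" "\<And>z. z \<in> T \<Longrightarrow> (B1 has_real_derivative B2 z) (at z)"
    and H: "\<And>z. z \<in> T \<Longrightarrow> (H has_real_derivative H1 z) (at z)" "\<And>z. z \<in> T \<Longrightarrow> (H1 has_real_derivative H2 z) (at z)"
    and P: "\<And>z. z \<in> T \<Longrightarrow> (P has_real_derivative P1 z) (at z)"
    and u: "\<And>x. x \<in> U \<Longrightarrow> u x = inorm x *\<^sub>R (A (zc x) *\<^sub>R nvec x + B (zc x) *\<^sub>R axis 3 1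
              + H (zc x) *\<^sub>R vector [- nvec x $ 2, nvec x $ 1, 0])"
    and p: "\<And>x. x \<in> U \<Longrightarrow> p x = (inorm x)\<^sup>2 * P (zc x)"
    and x: "x \<in> U" and z: "z = zc x"
  shows "divergence u x = (inorm x)\<^sup>2 * (A z + (1 - z\<^sup>2) * B1 z - z * B z)"
    "- laplacian u x + advection u u x + grad p x = (inorm x) ^ 3 *\<^sub>R
       ((- ((1 - z\<^sup>2) * A2 z - 4 * z * A1 z - 2 * A z) - (A z)\<^sup>2 + B z * ((1 - z\<^sup>2) * A1 z - 2 * z * A z)
          - (H z)\<^sup>2 - z * P1 z - 2 * P z) *\<^sub>R nvec x
      + (- 2 * A1 z - ((1 - z\<^sup>2) * B2 z - 2 * z * B1 z) + B z * ((1 - z\<^sup>2) * B1 z - z * B z)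
          + z * (H z)\<^sup>2 + P1 z) *\<^sub>R axis 3 1
      + (- ((1 - z\<^sup>2) * H2 z - 4 * z * H1 z - 2 * H z) + B z * ((1 - z\<^sup>2) * H1 z - 2 * z * H z))
          *\<^sub>R vector [- nvec x $ 2, nvec x $ 1, 0])"
proof -
  define GW where "GW R R1 j x = (R1 (zc x) * nvec x $ j * inorm x) *\<^sub>R zgrad x + (R (zc x) * (inorm x)\<^sup>2) *\<^sub>R (axis j 1 - (2 * nvec x $ j) *\<^sub>R nvec x)"
    for R R1 :: "real \<Rightarrow> real" and j :: 3 and x :: "real^3"
  define LW where "LW R R1 R2 j x = (inorm x) ^ 3 * (nvec x $ j * ((1 - (zc x)\<^sup>2) * R2 (zc x) - 4 * zc x * R1 (zc x) - 2 * R (zc x))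
        + 2 * R1 (zc x) * (if j = 3 then 1 else 0))"
    for R R1 R2 :: "real \<Rightarrow> real" and j :: 3 and x :: "real^3"
  define GE where "GE x = (B1 (zc x) * inorm x) *\<^sub>R zgrad x - (B (zc x) * (inorm x)\<^sup>2) *\<^sub>R nvec x" for x
  define LE where "LE x = (inorm x) ^ 3 * ((1 - (zc x)\<^sup>2) * B2 (zc x) - 2 * zc x * B1 (zc x))" for x
  \<comment> \<open>Components of A n + B e_3 + H (-n_2, n_1, 0): the swirl enters the first
    component through n_2 with a minus sign and the second through n_1, while B enters only the
    third.\<close>
  define G where "G j = (if j = 1 then (\<lambda>x. GW A A1 1 x + (-1) *\<^sub>R GW H H1 2 x)
     else if j = 2 then (\<lambda>x. GW A A1 2 x + GW H H1 1 x) else (\<lambda>x. GW A A1 3 x + GE x))" for j :: 3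
  define L where "L j = (if j = 1 then (\<lambda>x. LW A A1 A2 1 x + (-1) * LW H H1 H2 2 x)
     else if j = 2 then (\<lambda>x. LW A A1 A2 2 x + LW H H1 H2 1 x) else (\<lambda>x. LW A A1 A2 3 x + LE x))" for j :: 3
  have x0: "x \<noteq> 0" by (rule U_nz[OF x])
  note n = nvec_facts[OF x0]
  have WA: "has_lap U (\<lambda>x. A (zc x) * (nvec x $ j * inorm x)) (GW A A1 j) (LW A A1 A2 j)" for j
    unfolding GW_def[abs_def] LW_def[abs_def] by (rule has_lap_zc_nvec[OF T A])
  have WH: "has_lap U (\<lambda>x. H (zc x) * (nvec x $ j * inorm x)) (GW H H1 j) (LW H H1 H2 j)" for j
    unfolding GW_def[abs_def] LW_def[abs_def] by (rule has_lap_zc_nvec[OF T H])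
  have EB: "has_lap U (\<lambda>x. B (zc x) * inorm x) GE LE"
    unfolding GE_def[abs_def] LE_def[abs_def] by (rule has_lap_zc_inorm[OF T B])
  have WH': "has_lap U (\<lambda>x. (-1) * (H (zc x) * (nvec x $ j * inorm x))) (\<lambda>x. (-1) *\<^sub>R GW H H1 j x) (\<lambda>x. (-1) * LW H H1 H2 j x)" for j
    by (rule has_lap_cong[OF has_lap_mult[OF has_lap_const[of _ "-1"] WH] U]) auto
  have uj: "has_lap U (\<lambda>x. u x $ j) (G j) (L j)" for j
  proof -
    consider "j = 1" | "j = 2" | "j = 3" using exhaust_3[of j] by auto
    then show ?thesis
    proof cases
      case 1
      show ?thesis by (rule has_lap_cong[OF has_lap_add[OF WA[of 1] WH'[of 2]] U])
        (auto simp: 1 G_def L_def u axis_def algebra_simps)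
    next
      case 2
      show ?thesis by (rule has_lap_cong[OF has_lap_add[OF WA[of 2] WH[of 1]] U])
        (auto simp: 2 G_def L_def u axis_def algebra_simps)
    next
      case 3
      show ?thesis by (rule has_lap_cong[OF has_lap_add[OF WA[of 3] EB] U])
        (auto simp: 3 G_def L_def u axis_def algebra_simps)
    qed
  qed
  note op = vector_operators[OF uj x]
  define i n1 n2 where "i = inorm x" and "n1 = nvec x $ 1" and "n2 = nvec x $ 2"
  have nn: "nvec x $ 1 = n1" "nvec x $ 2 = n2" "nvec x $ 3 = z" "inorm x = i" "zc x = z"
    using n(4) z by (auto simp: n1_def n2_def i_def)
  \<comment> \<open>|n|^2 = 1 is the only relation among the components of n. The identities below
    are arranged so that this sum occurs literally and can be replaced by 1.\<close>
  have sum1: "n1 * n1 + n2 * n2 + z * z = 1" using n(1) unfolding inner_vec_def sum_3 nn by simp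
  have zg: "zgrad x $ 1 = i * (- z * n1)" "zgrad x $ 2 = i * (- z * n2)" "zgrad x $ 3 = i * (1 - z * z)"
    unfolding zgrad_nvec nn vector_scaleR_component vector_minus_component by (simp_all add: axis_def)
  have ax: "axis j (1::real) $ k = (if j = k then 1 else 0 :: real)" for j k :: 3 by (simp add: axis_def)
  have "divergence u x = GW A A1 1 x $ 1 - GW H H1 2 x $ 1 + (GW A A1 2 x $ 2 + GW H H1 1 x $ 2) + (GW A A1 3 x $ 3 + GE x $ 3)"
    using op(2) by (simp add: sum_3 G_def)
  also have "\<dots> = i\<^sup>2 * (A1 z * (z - z * (n1 * n1 + n2 * n2 + z * z)) + A z * (3 - 2 * (n1 * n1 + n2 * n2 + z * z)) + (1 - z * z) * B1 z - z * B z)"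
    unfolding GW_def GE_def vector_add_component vector_scaleR_component vector_minus_component
    unfolding nn zg ax
    by (simp add: algebra_simps power2_eq_square)
  finally show "divergence u x = (inorm x)\<^sup>2 * (A z + (1 - z\<^sup>2) * B1 z - z * B z)"
    unfolding sum1 nn by (simp add: power2_eq_square algebra_simps)
  have uv: "u x $ 1 = i * (A z * n1 - H z * n2)" "u x $ 2 = i * (A z * n2 + H z * n1)" "u x $ 3 = i * (A z * z + B z)"
    unfolding u[OF x] vector_scaleR_component vector_add_component
    unfolding nn ax by (simp_all add: algebra_simps)
  \<comment> \<open>Advection needs two scalar products: u . grad z multiplies derivatives of
    profiles, and A and H drop out of it; u . n accounts for the homogeneity.\<close>
  have uz: "inner (u x) (zgrad x) = i * i * (B z * (1 - z * z))"
  proof -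
    have "inner (u x) (zgrad x) = i * i * (A z * z * (1 - (n1 * n1 + n2 * n2 + z * z)) + B z * (1 - z * z))"
      unfolding inner_vec_def sum_3 uv zg by (simp add: algebra_simps)
    then show ?thesis unfolding sum1 by simp
  qed
  have un: "inner (u x) (nvec x) = i * (A z + B z * z)"
  proof -
    have "inner (u x) (nvec x) = i * (A z * (n1 * n1 + n2 * n2 + z * z) + B z * z)"
      unfolding inner_vec_def sum_3 uv nn by (simp add: algebra_simps)
    then show ?thesis unfolding sum1 by simp
  qed
  have uGW: "inner (u x) (GW R R1 j x) = R1 z * nvec x $ j * i * (i * i * (B z * (1 - z * z)))
      + R z * i\<^sup>2 * (u x $ j - 2 * nvec x $ j * (i * (A z + B z * z)))" for R R1 j
    unfolding GW_def inner_add_right inner_scaleR_right inner_diff_right uz un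
    unfolding nn by (simp add: inner_axis)
  have uGE: "inner (u x) (GE x) = B1 z * i * (i * i * (B z * (1 - z * z))) - B z * i\<^sup>2 * (i * (A z + B z * z))"
    unfolding GE_def inner_diff_right inner_scaleR_right uz un unfolding nn by simp
  have gp: "grad p x = (P1 z * i\<^sup>2) *\<^sub>R zgrad x - (2 * P z * i ^ 3) *\<^sub>R nvec x"
  proof -
    have li: "has_grad inorm (- (i\<^sup>2) *\<^sub>R nvec x) x UNIV"
      using has_lap_inorm x unfolding has_lap_def nn(4)[symmetric] by auto
    have "has_grad (\<lambda>x. inorm x * inorm x * P (zc x))
       ((inorm x * inorm x) *\<^sub>R (P1 z *\<^sub>R zgrad x) + P (zc x) *\<^sub>R (inorm x *\<^sub>R (- (i\<^sup>2) *\<^sub>R nvec x) + inorm x *\<^sub>R (- (i\<^sup>2) *\<^sub>R nvec x))) x UNIV"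
      using P[OF T[OF x]] unfolding z
      by (intro has_grad_mult has_grad_compose_open has_grad_zc x0 li)
    then have "has_grad p ((inorm x * inorm x) *\<^sub>R (P1 z *\<^sub>R zgrad x) + P (zc x) *\<^sub>R (inorm x *\<^sub>R (- (i\<^sup>2) *\<^sub>R nvec x) + inorm x *\<^sub>R (- (i\<^sup>2) *\<^sub>R nvec x))) x UNIV"
      by (rule has_grad_transform[OF U x, rotated]) (simp add: p power2_eq_square)
    from has_grad_partial[OF this] show ?thesis
      unfolding grad_def vec_eq_iff nn(4,5) by (simp add: algebra_simps power_numeral_reduce)
  qed
  have comp: "(- laplacian u x + advection u u x + grad p x) $ j = - L j x + inner (u x) (G j x)
     + (P1 z * i\<^sup>2 * zgrad x $ j - 2 * P z * i ^ 3 * nvec x $ j)" for j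
    unfolding gp by (simp only: vector_add_component vector_uminus_component op(1,3) vector_minus_component vector_scaleR_component real_scaleR_def)
  show "- laplacian u x + advection u u x + grad p x = (inorm x) ^ 3 *\<^sub>R
       ((- ((1 - z\<^sup>2) * A2 z - 4 * z * A1 z - 2 * A z) - (A z)\<^sup>2 + B z * ((1 - z\<^sup>2) * A1 z - 2 * z * A z)
          - (H z)\<^sup>2 - z * P1 z - 2 * P z) *\<^sub>R nvec x
      + (- 2 * A1 z - ((1 - z\<^sup>2) * B2 z - 2 * z * B1 z) + B z * ((1 - z\<^sup>2) * B1 z - z * B z)
          + z * (H z)\<^sup>2 + P1 z) *\<^sub>R axis 3 1
      + (- ((1 - z\<^sup>2) * H2 z - 4 * z * H1 z - 2 * H z) + B z * ((1 - z\<^sup>2) * H1 z - 2 * z * H z))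
          *\<^sub>R vector [- nvec x $ 2, nvec x $ 1, 0])"
    unfolding vec_eq_iff forall_3
  proof (intro conjI)
    have G1: "G 1 x = GW A A1 1 x + (-1) *\<^sub>R GW H H1 2 x" and L1: "L 1 x = LW A A1 A2 1 x - LW H H1 H2 2 x"
      and G2: "G 2 x = GW A A1 2 x + GW H H1 1 x" and L2: "L 2 x = LW A A1 A2 2 x + LW H H1 H2 1 x"
      and G3: "G 3 x = GW A A1 3 x + GE x" and L3: "L 3 x = LW A A1 A2 3 x + LE x" by (simp_all add: G_def L_def)
    let ?R = "\<lambda>j. ((inorm x) ^ 3 *\<^sub>R
       ((- ((1 - z\<^sup>2) * A2 z - 4 * z * A1 z - 2 * A z) - (A z)\<^sup>2 + B z * ((1 - z\<^sup>2) * A1 z - 2 * z * A z)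
          - (H z)\<^sup>2 - z * P1 z - 2 * P z) *\<^sub>R nvec x
      + (- 2 * A1 z - ((1 - z\<^sup>2) * B2 z - 2 * z * B1 z) + B z * ((1 - z\<^sup>2) * B1 z - z * B z)
          + z * (H z)\<^sup>2 + P1 z) *\<^sub>R axis 3 1
      + (- ((1 - z\<^sup>2) * H2 z - 4 * z * H1 z - 2 * H z) + B z * ((1 - z\<^sup>2) * H1 z - 2 * z * H z))
          *\<^sub>R vector [- nvec x $ 2, nvec x $ 1, 0])) $ j"
    have RHS: "?R j = i ^ 3 * ((- ((1 - z\<^sup>2) * A2 z - 4 * z * A1 z - 2 * A z) - (A z)\<^sup>2 + B z * ((1 - z\<^sup>2) * A1 z - 2 * z * A z)
          - (H z)\<^sup>2 - z * P1 z - 2 * P z) * nvec x $ j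
      + (- 2 * A1 z - ((1 - z\<^sup>2) * B2 z - 2 * z * B1 z) + B z * ((1 - z\<^sup>2) * B1 z - z * B z)
          + z * (H z)\<^sup>2 + P1 z) * axis 3 1 $ j
      + (- ((1 - z\<^sup>2) * H2 z - 4 * z * H1 z - 2 * H z) + B z * ((1 - z\<^sup>2) * H1 z - 2 * z * H z))
          * vector [- n2, n1, 0] $ j)" for j
      by (simp only: vector_scaleR_component vector_add_component real_scaleR_def nn)
    show "(- laplacian u x + advection u u x + grad p x) $ 1 = ?R 1"
      unfolding comp RHS G1 L1 inner_add_right inner_scaleR_right
      unfolding uGW LW_def vector_3 ax uv zg nn
      by (simp add: algebra_simps power_numeral_reduce)
    show "(- laplacian u x + advection u u x + grad p x) $ 2 = ?R 2"
      unfolding comp RHS G2 L2 inner_add_right inner_scaleR_right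
      unfolding uGW LW_def vector_3 ax uv zg nn
      by (simp add: algebra_simps power_numeral_reduce)
    show "(- laplacian u x + advection u u x + grad p x) $ 3 = ?R 3"
      unfolding comp RHS G3 L3 inner_add_right inner_scaleR_right
      unfolding uGW LW_def uGE LE_def vector_3 ax uv zg nn
      by (simp add: algebra_simps power_numeral_reduce)
  qed
qed

end

section \<open>The angular quantities\<close>

lemma x_cos_le_sin: assumes "0 \<le> x" "x \<le> pi" shows "x * cos x \<le> sin x"
proof -
  have "sin 0 - 0 * cos 0 \<le> sin x - x * cos x"
  proof (rule DERIV_nonneg_imp_nondecreasing[OF assms(1)])
    fix w assume w: "0 \<le> w" "w \<le> x"
    have "((\<lambda>x. sin x - x * cos x) has_real_derivative w * sin w) (at w)"
      by (auto intro!: derivative_eq_intros)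
    moreover have "w * sin w \<ge> 0" using w assms sin_ge_zero[of w] by simp
    ultimately show "\<exists>y. ((\<lambda>x. sin x - x * cos x) has_real_derivative y) (at w) \<and> 0 \<le> y" by blast
  qed
  then show ?thesis by simp
qed

text \<open>The inequality t cos t \<le> sin t at t = x/2, multiplied by cos (x/2), becomes x (1 +
  cos x) \<le> 2 sin x by the double angle formulas. It makes \<phi> comparable to sin \<phi> = sqrt
  (1 - z^2).\<close>

lemma le_2_sin: assumes "0 \<le> x" "x \<le> pi / 2" shows "x \<le> 2 * sin (x::real)"
proof -
  have c: "cos x \<ge> 0" using assms by (intro cos_ge_zero) auto
  have c2: "cos (x / 2) \<ge> 0" using assms by (intro cos_ge_zero) auto
  have "(x / 2 * cos (x / 2)) * cos (x / 2) \<le> sin (x / 2) * cos (x / 2)"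
    using assms c2 by (intro mult_right_mono x_cos_le_sin) auto
  moreover have "sin x = 2 * sin (x / 2) * cos (x / 2)" using sin_double[of "x / 2"] by simp
  moreover have "cos (x / 2) * cos (x / 2) = (1 + cos x) / 2"
    using cos_double_cos[of "x / 2"] by (simp add: power2_eq_square)
  moreover have "x * 1 \<le> x * (1 + cos x)" using c assms by (intro mult_left_mono) auto
  ultimately show ?thesis by (simp add: mult.assoc)
qed

text \<open>Mean value inequality on [0, x]. Keeping k instead of k/(n+1) is harmless, because only
  orders of vanishing matter below.\<close>

lemma derivative_power_bound:
  fixes f f' :: "real \<Rightarrow> real"
  assumes f: "\<And>x. x \<in> {0..b} \<Longrightarrow> (f has_real_derivative f' x) (at x within {0..b})"
    and bd: "\<And>x. x \<in> {0..b} \<Longrightarrow> \<bar>f' x\<bar> \<le> k * x ^ n" and k: "k \<ge> 0" and f0: "f 0 = 0" and x: "x \<in> {0..b}"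
  shows "\<bar>f x\<bar> \<le> k * x ^ Suc n"
proof -
  have "norm (f x - f 0) \<le> k * x ^ n * norm (x - 0)"
  proof (rule field_differentiable_bound[of "{0..x}" f f'])
    fix w assume w: "w \<in> {0..x}"
    show "(f has_real_derivative f' w) (at w within {0..x})" using w x by (intro DERIV_subset[OF f]) auto
    have "\<bar>f' w\<bar> \<le> k * w ^ n" using w x by (intro bd) auto
    also have "\<dots> \<le> k * x ^ n" using w k by (intro mult_left_mono power_mono) auto
    finally show "norm (f' w) \<le> k * x ^ n" by simp
  qed (use x in auto)
  then show ?thesis using x by (simp add: f0 mult_ac)
qed

lemma arccos_facts:
  assumes "0 \<le> z" "z < 1"
  shows "arccos z \<in> {0<..pi/2}" "sin (arccos z) = sqrt (1 - z\<^sup>2)" "cos (arccos z) = z" "sqrt (1 - z\<^sup>2) > 0"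
    "arccos z \<le> 2 * sqrt (1 - z\<^sup>2)" "sqrt (1 - z\<^sup>2) \<le> 1" "(sqrt (1 - z\<^sup>2))\<^sup>2 = 1 - z\<^sup>2"
    "sqrt (1 - z) \<le> sqrt (1 - z\<^sup>2)"
proof -
  have z2: "z\<^sup>2 < 1" using assms by (simp add: power2_eq_square mult_strict_mono[of z 1 z 1, simplified])
  have "0 < arccos z" using assms arccos_less_arccos[of z 1] by simp
  moreover have le: "arccos z \<le> pi / 2" using assms by (intro arccos_le_pi2) auto
  ultimately show 1: "arccos z \<in> {0<..pi/2}" by simp
  show s: "sin (arccos z) = sqrt (1 - z\<^sup>2)" using assms by (intro sin_arccos) auto
  show "cos (arccos z) = z" using assms by simp
  show "sqrt (1 - z\<^sup>2) > 0" "(sqrt (1 - z\<^sup>2))\<^sup>2 = 1 - z\<^sup>2" "sqrt (1 - z\<^sup>2) \<le> 1" using z2 by auto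
  show "arccos z \<le> 2 * sqrt (1 - z\<^sup>2)" using le_2_sin[of "arccos z"] 1 s by simp
  have "z\<^sup>2 \<le> z" using assms by (simp add: power2_eq_square mult_left_le)
  then show "sqrt (1 - z) \<le> sqrt (1 - z\<^sup>2)" by simp
qed

lemma arccos_mem: "z \<in> {0..1} \<Longrightarrow> arccos z \<in> {0..pi/2}"
  using arccos_lbound[of z] arccos_le_pi2[of z] by auto

lemma compose_arccos_deriv:
  assumes f: "\<And>\<phi>. \<phi> \<in> {0..pi/2} \<Longrightarrow> (f has_real_derivative f' \<phi>) (at \<phi> within {0..pi/2})"
    and z: "0 \<le> z" "z < 1"
  shows "((\<lambda>z. f (arccos z)) has_real_derivative - f' (arccos z) / sqrt (1 - z\<^sup>2)) (at z within {0..1})"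
proof -
  have 1: "(arccos has_real_derivative inverse (- sqrt (1 - z\<^sup>2))) (at z within {0..1})"
    using z by (intro DERIV_subset[OF DERIV_arccos]) auto
  have 2: "(f has_real_derivative f' (arccos z)) (at (arccos z) within arccos ` {0..1})"
  proof (rule DERIV_subset[OF f])
    show "arccos z \<in> {0..pi/2}" using z by (intro arccos_mem) auto
    show "arccos ` {0..1} \<subseteq> {0..pi/2}" using arccos_mem by blast
  qed
  from DERIV_image_chain[OF 2 1] show ?thesis by (simp add: o_def divide_inverse)
qed

text \<open>What a C^1 axisymmetric force imposes on its profiles: continuous derivatives up to both
  ends, and a tangential component that vanishes on the axis, where e_phi would depend on
  \<theta>.\<close>

locale angular_force =
  fixes X Y X1 Y1 :: "real \<Rightarrow> real"
  assumes X: "\<And>\<phi>. \<phi> \<in> {0..pi/2} \<Longrightarrow> (X has_real_derivative X1 \<phi>) (at \<phi> within {0..pi/2})"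
    and Y: "\<And>\<phi>. \<phi> \<in> {0..pi/2} \<Longrightarrow> (Y has_real_derivative Y1 \<phi>) (at \<phi> within {0..pi/2})"
    and X1c: "continuous_on {0..pi/2} X1" and Y1c: "continuous_on {0..pi/2} Y1"
    and Y0: "Y 0 = 0"
begin

abbreviation "C \<equiv> force_C X Y"
definition "Q \<phi> = integral {0..\<phi>} Y"
definition "K \<phi> = force_G X Y \<phi> + 2 * C"
definition "J \<phi> = integral {0..\<phi>} (\<lambda>\<tau>. K \<tau> * sin \<tau>)"

lemma Xc: "continuous_on {0..pi/2} X" by (rule DERIV_continuous_on, erule X)
lemma Yc: "continuous_on {0..pi/2} Y" by (rule DERIV_continuous_on, erule Y)

lemma Q_deriv: "\<phi> \<in> {0..pi/2} \<Longrightarrow> (Q has_real_derivative Y \<phi>) (at \<phi> within {0..pi/2})"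
  unfolding Q_def[abs_def] by (rule integral_has_real_derivative[OF Yc])

lemma K_eq: "K \<phi> = X \<phi> + 2 * Q \<phi> + 2 * C" by (simp add: K_def force_G_def Q_def)

lemma K_deriv: "\<phi> \<in> {0..pi/2} \<Longrightarrow> (K has_real_derivative X1 \<phi> + 2 * Y \<phi>) (at \<phi> within {0..pi/2})"
  unfolding K_eq[abs_def] by (auto intro!: derivative_eq_intros X Q_deriv)

lemma Kc: "continuous_on {0..pi/2} K" by (rule DERIV_continuous_on, erule K_deriv)

lemma J_deriv: "\<phi> \<in> {0..pi/2} \<Longrightarrow> (J has_real_derivative K \<phi> * sin \<phi>) (at \<phi> within {0..pi/2})"
  unfolding J_def[abs_def] by (rule integral_has_real_derivative) (auto intro!: continuous_intros Kc)

lemma force_N_eq: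
  assumes "\<phi> \<in> {0..pi/2}"
  shows "force_N X Y \<phi> = cos \<phi> * J \<phi> - integral {0..\<phi>} (\<lambda>\<tau>. K \<tau> * sin \<tau> * cos \<tau>)"
proof -
  have c: "continuous_on {0..\<phi>} K" using assms by (intro continuous_on_subset[OF Kc]) auto
  have "force_N X Y \<phi> = integral {0..\<phi>} (\<lambda>\<tau>. cos \<phi> * (K \<tau> * sin \<tau>) - K \<tau> * sin \<tau> * cos \<tau>)"
    unfolding force_N_def K_def by (simp add: algebra_simps)
  also have "\<dots> = integral {0..\<phi>} (\<lambda>\<tau>. cos \<phi> * (K \<tau> * sin \<tau>)) - integral {0..\<phi>} (\<lambda>\<tau>. K \<tau> * sin \<tau> * cos \<tau>)"
    by (intro integral_diff integrable_continuous_real continuous_intros c)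
  finally show ?thesis by (simp add: J_def)
qed

text \<open>In the split form the two terms K sin cos arising from the integrals cancel, and only
  the derivative of the factor cos \<phi> survives.\<close>

lemma force_N_deriv:
  assumes p: "\<phi> \<in> {0..pi/2}"
  shows "(force_N X Y has_real_derivative - sin \<phi> * J \<phi>) (at \<phi> within {0..pi/2})"
proof (rule has_field_derivative_transform_within[OF _ zero_less_one p])
  have "((\<lambda>\<phi>. integral {0..\<phi>} (\<lambda>\<tau>. K \<tau> * sin \<tau> * cos \<tau>)) has_real_derivative K \<phi> * sin \<phi> * cos \<phi>) (at \<phi> within {0..pi/2})"
    by (rule integral_has_real_derivative[OF _ p]) (auto intro!: continuous_intros Kc)
  then show "((\<lambda>\<phi>. cos \<phi> * J \<phi> - integral {0..\<phi>} (\<lambda>\<tau>. K \<tau> * sin \<tau> * cos \<tau>)) has_real_derivative - sin \<phi> * J \<phi>) (at \<phi> within {0..pi/2})"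
    by (auto intro!: derivative_eq_intros J_deriv[OF p])
qed (simp add: force_N_eq)

lemma force_N_0: "force_N X Y 0 = 0" by (simp add: force_N_def)

text \<open>This is the property that singles out \<open>C\<close>: cos vanishes at \<pi>/2, and the
  remaining integral of K sin cos is that of G sin cos plus 2 C times 1/2.\<close>

lemma force_N_pi2: "force_N X Y (pi/2) = 0"
proof -
  have G: "continuous_on {0..pi/2} (force_G X Y)"
    unfolding force_G_def[abs_def] Q_def[symmetric]
    by (intro continuous_intros Xc DERIV_continuous_on[OF Q_deriv])
  have "((\<lambda>\<tau>. sin \<tau> * cos \<tau>) has_integral ((sin (pi/2))\<^sup>2 / 2 - (sin 0)\<^sup>2 / 2)) {0..pi/2}"
    by (intro fundamental_theorem_of_calculus)
      (auto simp: has_real_derivative_iff_has_vector_derivative[symmetric] intro!: derivative_eq_intros)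
  then have i: "integral {0..pi/2} (\<lambda>\<tau>. sin \<tau> * cos \<tau>) = 1 / 2" by (simp add: integral_unique)
  have "integral {0..pi/2} (\<lambda>\<tau>. K \<tau> * sin \<tau> * cos \<tau>)
      = integral {0..pi/2} (\<lambda>\<tau>. force_G X Y \<tau> * sin \<tau> * cos \<tau> + 2 * C * (sin \<tau> * cos \<tau>))"
    unfolding K_def by (simp add: algebra_simps)
  also have "\<dots> = integral {0..pi/2} (\<lambda>\<tau>. force_G X Y \<tau> * sin \<tau> * cos \<tau>) + integral {0..pi/2} (\<lambda>\<tau>. 2 * C * (sin \<tau> * cos \<tau>))"
    by (intro integral_add integrable_continuous_real continuous_intros G)
  also have "\<dots> = 0" using i by (simp add: force_C_def)
  finally show ?thesis by (simp add: force_N_eq)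
qed

section \<open>The angular quantities as functions of z = cos \<phi>\<close>

definition "Qz z = Q (arccos z)"
definition "Kz z = K (arccos z)"
definition "Ez z = J (arccos z)"
definition "Nz z = force_N X Y (arccos z)"

text \<open>As dz = - sin \<phi> d\<phi>, the factors sin \<phi> cancel and N'' = -K in the variable
  z. The singular factor 1/sqrt (1 - z^2) appears only when K and Q are differentiated.\<close>

lemma z_derivs:
  assumes z: "0 \<le> z" "z < 1"
  shows "(Nz has_real_derivative Ez z) (at z within {0..1})" "(Ez has_real_derivative - Kz z) (at z within {0..1})"
    "(Kz has_real_derivative - (X1 (arccos z) + 2 * Y (arccos z)) / sqrt (1 - z\<^sup>2)) (at z within {0..1})"
    "(Qz has_real_derivative - Y (arccos z) / sqrt (1 - z\<^sup>2)) (at z within {0..1})"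
  using compose_arccos_deriv[OF force_N_deriv z] compose_arccos_deriv[OF J_deriv z]
    compose_arccos_deriv[OF K_deriv z] compose_arccos_deriv[OF Q_deriv z] arccos_facts[OF z]
  unfolding Nz_def[abs_def] Ez_def[abs_def] Kz_def[abs_def] Qz_def[abs_def] by simp_all

lemma bounded_on_interval:
  assumes "continuous_on {0..pi/2} f"
  obtains c where "c \<ge> 0" "\<forall>\<phi>\<in>{0..pi/2}. \<bar>f \<phi>\<bar> \<le> (c::real)"
proof -
  have "bounded (f ` {0..pi/2})" using assms by (intro compact_imp_bounded compact_continuous_image) auto
  then obtain M where "\<And>x. x \<in> f ` {0..pi/2} \<Longrightarrow> norm x \<le> M" by (meson bounded_iff)
  then show ?thesis by (intro that[of "\<bar>M\<bar>"]) force+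
qed

text \<open>The leading term -K(0) (1 - z)^2 / 2 of N at the axis is split off, since its quotient
  by (1 - z^2)^2 is explicit and smooth. \<open>M1\<close>, \<open>M2\<close> and \<open>M3\<close>
  are the successive derivatives of the remainder.\<close>

definition "M0 z = Nz z + K 0 * (1 - z)\<^sup>2 / 2"
definition "M1 z = Ez z - K 0 * (1 - z)"
definition "M2 z = K 0 - Kz z"
definition "M3 z = (X1 (arccos z) + 2 * Y (arccos z)) / sqrt (1 - z\<^sup>2)"

lemma M_derivs:
  assumes z: "0 \<le> z" "z < 1"
  shows "(M0 has_real_derivative M1 z) (at z within {0..1})" "(M1 has_real_derivative M2 z) (at z within {0..1})"
    "(M2 has_real_derivative M3 z) (at z within {0..1})"
proof -
  show "(M0 has_real_derivative M1 z) (at z within {0..1})"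
    unfolding M0_def[abs_def] by (auto intro!: derivative_eq_intros z_derivs[OF z] simp: M1_def field_simps)
  show "(M1 has_real_derivative M2 z) (at z within {0..1})"
    unfolding M1_def[abs_def] by (auto intro!: derivative_eq_intros z_derivs[OF z] simp: M2_def)
  show "(M2 has_real_derivative M3 z) (at z within {0..1})"
    unfolding M2_def[abs_def] M3_def
    by (rule DERIV_cong[OF DERIV_diff[OF DERIV_const z_derivs(3)[OF z]]]) (simp add: minus_divide_left)
qed

text \<open>From K - K(0) = O(\<phi>), each multiplication by sin \<phi> followed by integration
  from the axis gains two powers of \<phi>: order 3 for J and order 5 for N, after subtraction of
  the leading terms.\<close>

lemma M_bounds:
  obtains k where "k \<ge> 0"
    "\<And>z. 0 \<le> z \<Longrightarrow> z < 1 \<Longrightarrow> \<bar>M0 z\<bar> \<le> k * sqrt (1 - z\<^sup>2) ^ 5 \<and> \<bar>M1 z\<bar> \<le> k * sqrt (1 - z\<^sup>2) ^ 3 \<and>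
       \<bar>M2 z\<bar> \<le> k * sqrt (1 - z\<^sup>2) \<and> \<bar>M3 z\<bar> * sqrt (1 - z\<^sup>2) \<le> k"
proof -
  obtain k where k: "k \<ge> 0" "\<forall>\<phi>\<in>{0..pi/2}. \<bar>X1 \<phi> + 2 * Y \<phi>\<bar> \<le> k"
    by (rule bounded_on_interval[of "\<lambda>\<phi>. X1 \<phi> + 2 * Y \<phi>"]) (auto intro!: continuous_intros X1c Yc)
  have m2: "\<bar>K \<phi> - K 0\<bar> \<le> k * \<phi> ^ Suc 0" if "\<phi> \<in> {0..pi/2}" for \<phi>
    by (rule derivative_power_bound[where b = "pi/2" and f' = "\<lambda>\<phi>. X1 \<phi> + 2 * Y \<phi>"])
      (use that k K_deriv in \<open>auto intro!: derivative_eq_intros\<close>)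
  have sin_le: "\<bar>sin \<phi>\<bar> \<le> \<phi>" if "\<phi> \<in> {0..pi/2}" for \<phi>
    using that abs_sin_x_le_abs_x[of \<phi>] by auto
  have m1: "\<bar>J \<phi> - K 0 * (1 - cos \<phi>)\<bar> \<le> k * \<phi> ^ Suc 2" if "\<phi> \<in> {0..pi/2}" for \<phi>
  proof (rule derivative_power_bound[where b = "pi/2" and f' = "\<lambda>\<phi>. (K \<phi> - K 0) * sin \<phi>"])
    fix x assume x: "x \<in> {0..pi/2}"
    show "((\<lambda>\<phi>. J \<phi> - K 0 * (1 - cos \<phi>)) has_real_derivative (K x - K 0) * sin x) (at x within {0..pi/2})"
      by (auto intro!: derivative_eq_intros J_deriv[OF x] simp: algebra_simps)
    show "\<bar>(K x - K 0) * sin x\<bar> \<le> k * x\<^sup>2"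
      using mult_mono[OF m2[OF x] sin_le[OF x]] k x by (simp add: abs_mult power2_eq_square mult_ac)
  qed (use that k in \<open>auto simp: J_def\<close>)
  have m0: "\<bar>force_N X Y \<phi> + K 0 * (1 - cos \<phi>)\<^sup>2 / 2\<bar> \<le> k * \<phi> ^ Suc 4" if "\<phi> \<in> {0..pi/2}" for \<phi>
  proof (rule derivative_power_bound[where b = "pi/2" and f' = "\<lambda>\<phi>. - ((J \<phi> - K 0 * (1 - cos \<phi>)) * sin \<phi>)"])
    fix x assume x: "x \<in> {0..pi/2}"
    show "((\<lambda>\<phi>. force_N X Y \<phi> + K 0 * (1 - cos \<phi>)\<^sup>2 / 2) has_real_derivative - ((J x - K 0 * (1 - cos x)) * sin x)) (at x within {0..pi/2})"
      by (auto intro!: derivative_eq_intros force_N_deriv[OF x] simp: field_simps)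
    show "\<bar>- ((J x - K 0 * (1 - cos x)) * sin x)\<bar> \<le> k * x ^ 4"
      using mult_mono[OF m1[OF x] sin_le[OF x]] k x unfolding abs_minus_cancel abs_mult by (simp add: power_numeral_reduce mult_ac)
  qed (use that k in \<open>auto simp: force_N_0\<close>)
  show ?thesis
  proof (rule that[of "32 * k"])
    show "32 * k \<ge> 0" using k by simp
    fix z :: real assume z: "0 \<le> z" "z < 1"
    note a = arccos_facts[OF z]
    have ac: "arccos z \<in> {0..pi/2}" using a(1) by auto
    \<comment> \<open>From \<phi> \<le> 2 sin \<phi>; the factor 2^n is at most 32 because no power
      above 5 occurs.\<close>
    have pw: "k * arccos z ^ n \<le> 32 * k * sqrt (1 - z\<^sup>2) ^ n" if "n \<le> 5" for n
    proof -
      have "arccos z ^ n \<le> (2 * sqrt (1 - z\<^sup>2)) ^ n" using a by (intro power_mono) auto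
      also have "\<dots> \<le> 32 * sqrt (1 - z\<^sup>2) ^ n"
        using power_increasing[OF that, of "2::real"] a(4) unfolding power_mult_distrib by (intro mult_right_mono) auto
      finally show ?thesis using k(1) by (metis mult.assoc mult.left_commute mult_left_mono)
    qed
    have "\<bar>M3 z\<bar> * sqrt (1 - z\<^sup>2) \<le> 32 * k"
    proof -
      have "\<bar>M3 z\<bar> * sqrt (1 - z\<^sup>2) = \<bar>X1 (arccos z) + 2 * Y (arccos z)\<bar>"
        using a(4) by (simp add: M3_def abs_mult)
      then show ?thesis using k ac by force
    qed
    then show "\<bar>M0 z\<bar> \<le> 32 * k * sqrt (1 - z\<^sup>2) ^ 5 \<and> \<bar>M1 z\<bar> \<le> 32 * k * sqrt (1 - z\<^sup>2) ^ 3 \<and>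
       \<bar>M2 z\<bar> \<le> 32 * k * sqrt (1 - z\<^sup>2) \<and> \<bar>M3 z\<bar> * sqrt (1 - z\<^sup>2) \<le> 32 * k"
      using order_trans[OF m0[OF ac] pw[of "Suc 4"]] order_trans[OF m1[OF ac] pw[of "Suc 2"]]
        order_trans[OF m2[OF ac] pw[of "Suc 0"]] a(3)
      by (simp add: M0_def M1_def M2_def Nz_def Ez_def Kz_def abs_minus_commute eval_nat_numeral)
  qed
qed

text \<open>At \<open>z = 1\<close> the quotient \<open>M0 z / (1 - z\<^sup>2)\<^sup>2\<close> is \<open>0 / 0 = 0\<close>, which is also its limit.\<close>
definition "q z = - K 0 / (2 * (1 + z)\<^sup>2) + M0 z / (1 - z\<^sup>2)\<^sup>2"
text \<open>The derivatives of \<open>q\<close> on [0,1), kept expanded in the remainders over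
  powers of 1 - z^2 so that every summand can be bounded by itself.\<close>

definition "q1 z = K 0 / (1 + z) ^ 3 + M1 z / (1 - z\<^sup>2)\<^sup>2 + 4 * z * M0 z / (1 - z\<^sup>2) ^ 3"
definition "q2 z = - 3 * K 0 / (1 + z) ^ 4 + M2 z / (1 - z\<^sup>2)\<^sup>2 + 8 * z * M1 z / (1 - z\<^sup>2) ^ 3
   + 4 * M0 z / (1 - z\<^sup>2) ^ 3 + 24 * z\<^sup>2 * M0 z / (1 - z\<^sup>2) ^ 4"
definition "q3 z = 12 * K 0 / (1 + z) ^ 5 + M3 z / (1 - z\<^sup>2)\<^sup>2 + 12 * z * M2 z / (1 - z\<^sup>2) ^ 3
   + 12 * M1 z / (1 - z\<^sup>2) ^ 3 + 72 * z\<^sup>2 * M1 z / (1 - z\<^sup>2) ^ 4 + 72 * z * M0 z / (1 - z\<^sup>2) ^ 4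
   + 192 * z ^ 3 * M0 z / (1 - z\<^sup>2) ^ 5"

text \<open>Since (1 - z^2)^2 = (1 - z)^2 (1 + z)^2, the first summand of \<open>q\<close> is the
  split-off part of N divided by (1 - z^2)^2. At z = 1 both sides are 0.\<close>

lemma q_N: assumes "z \<in> {0..1}" shows "(1 - z\<^sup>2)\<^sup>2 * q z = Nz z"
proof (cases "z = 1")
  case True then show ?thesis by (simp add: Nz_def force_N_0)
next
  case False
  then have nz: "(1 - z)\<^sup>2 \<noteq> 0" "(1 + z)\<^sup>2 \<noteq> 0" using assms by auto
  have fac: "(1 - z\<^sup>2)\<^sup>2 = (1 - z)\<^sup>2 * (1 + z)\<^sup>2" by (simp add: power2_eq_square algebra_simps)
  have expand: "a * b * (- k / (2 * b) + m / (a * b)) = - k * a / 2 + m" if "a \<noteq> 0" "b \<noteq> 0" for a b k m :: real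
    using that by (simp add: field_simps)
  have "(1 - z\<^sup>2)\<^sup>2 * q z = - K 0 * (1 - z)\<^sup>2 / 2 + M0 z"
    unfolding q_def fac by (rule expand[OF nz])
  then show ?thesis by (simp add: M0_def)
qed

lemma quotient_deriv:
  assumes f: "(f has_real_derivative f') (at z within S)" and z: "0 \<le> z" "z < 1"
  shows "((\<lambda>z. f z / (1 - z\<^sup>2) ^ n) has_real_derivative f' / (1 - z\<^sup>2) ^ n + 2 * real n * z * f z / (1 - z\<^sup>2) ^ Suc n) (at z within S)"
proof -
  have nz: "1 - z\<^sup>2 \<noteq> 0" using z by (auto simp: power2_eq_1_iff)
  have main: "((\<lambda>z. f z * inverse (1 - z\<^sup>2) ^ n) has_real_derivative
     f' * inverse (1 - z\<^sup>2) ^ n + f z * (real n * (inverse (1 - z\<^sup>2) ^ (n - 1) * (2 * z * inverse (1 - z\<^sup>2) ^ 2)))) (at z within S)"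
    using nz by (auto intro!: derivative_eq_intros f simp: power2_eq_square)
  have eq: "f' * inverse w ^ n + f z * (real n * (inverse w ^ (n - 1) * (2 * z * inverse w ^ 2)))
     = f' / w ^ n + 2 * real n * z * f z / w ^ Suc n" for w :: real
    unfolding power_inverse by (cases n) (simp_all add: divide_inverse power2_eq_square algebra_simps)
  have "(\<lambda>z. f z * inverse (1 - z\<^sup>2) ^ n) = (\<lambda>z. f z / (1 - z\<^sup>2) ^ n)" by (simp add: fun_eq_iff divide_inverse power_inverse)
  then show ?thesis using DERIV_cong[OF main eq] by metis
qed

lemma rational_deriv:
  fixes z :: real assumes "0 \<le> z"
  shows "((\<lambda>z. c / (1 + z) ^ n) has_real_derivative - real n * c / (1 + z) ^ Suc n) (at z within S)"
proof -
  have nz: "1 + z \<noteq> 0" using assms by simp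
  have main: "((\<lambda>z. c * inverse (1 + z) ^ n) has_real_derivative
     c * (real n * (inverse (1 + z) ^ (n - 1) * (- (inverse (1 + z) ^ 2))))) (at z within S)"
    using nz by (auto intro!: derivative_eq_intros simp: power2_eq_square)
  have eq: "c * (real n * (inverse w ^ (n - 1) * (- (inverse w ^ 2)))) = - real n * c / w ^ Suc n" for w :: real
    unfolding power_inverse by (cases n) (simp_all add: divide_inverse power2_eq_square algebra_simps)
  have "(\<lambda>z. c * inverse (1 + z) ^ n) = (\<lambda>z. c / (1 + z) ^ n)" by (simp add: fun_eq_iff divide_inverse power_inverse)
  then show ?thesis using DERIV_cong[OF main eq] by metis
qed

lemma q_derivs:
  assumes z: "0 \<le> z" "z < 1"
  shows "(q has_real_derivative q1 z) (at z within {0..1})" "(q1 has_real_derivative q2 z) (at z within {0..1})"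
    "(q2 has_real_derivative q3 z) (at z within {0..1})"
proof -
  note M = M_derivs[OF z] and Q = quotient_deriv[OF _ z, of _ _ "{0..1}"] and rd = rational_deriv[OF z(1), where S = "{0..1}"]
  have zM0: "((\<lambda>z. z * M0 z) has_real_derivative M0 z + z * M1 z) (at z within {0..1})"
    "((\<lambda>z. z * M1 z) has_real_derivative M1 z + z * M2 z) (at z within {0..1})"
    "((\<lambda>z. z\<^sup>2 * M0 z) has_real_derivative 2 * z * M0 z + z\<^sup>2 * M1 z) (at z within {0..1})"
    by (auto intro!: derivative_eq_intros M)
  have q_alt: "q = (\<lambda>z. (- K 0 / 2) / (1 + z) ^ 2 + M0 z / (1 - z\<^sup>2) ^ 2)"
    "q1 = (\<lambda>z. K 0 / (1 + z) ^ 3 + M1 z / (1 - z\<^sup>2) ^ 2 + 4 * (z * M0 z / (1 - z\<^sup>2) ^ 3))"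
    "q2 = (\<lambda>z. (- 3 * K 0) / (1 + z) ^ 4 + M2 z / (1 - z\<^sup>2) ^ 2 + 8 * (z * M1 z / (1 - z\<^sup>2) ^ 3)
       + 4 * (M0 z / (1 - z\<^sup>2) ^ 3) + 24 * (z\<^sup>2 * M0 z / (1 - z\<^sup>2) ^ 4))"
    by (simp_all add: fun_eq_iff q_def q1_def q2_def mult.assoc)
  show "(q has_real_derivative q1 z) (at z within {0..1})"
    unfolding q_alt(1) by (rule DERIV_cong[OF DERIV_add[OF rd Q[OF M(1)]]]) (simp add: q1_def mult_ac)
  show "(q1 has_real_derivative q2 z) (at z within {0..1})"
    unfolding q_alt(2)
    by (rule DERIV_cong[OF DERIV_add[OF DERIV_add[OF rd Q[OF M(2)]] DERIV_cmult[OF Q[OF zM0(1)]]]])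
      (simp add: q2_def add_divide_distrib distrib_left mult_ac power2_eq_square)
  show "(q2 has_real_derivative q3 z) (at z within {0..1})"
    unfolding q_alt(3)
    by (rule DERIV_cong[OF DERIV_add[OF DERIV_add[OF DERIV_add[OF DERIV_add[OF rd Q[OF M(3)]] DERIV_cmult[OF Q[OF zM0(2)]]]
         DERIV_cmult[OF Q[OF M(1)]]] DERIV_cmult[OF Q[OF zM0(3)]]]])
      (simp add: q3_def add_divide_distrib distrib_left mult_ac power2_eq_square power3_eq_cube)
qed

text \<open>With s = sqrt (1 - z^2), the remainders are s^5, s^3, s and 1/s times bounded factors.
  In the quotient by s^4 each differentiation costs s^2, so the orders are s, 1/s, 1/s^3 and
  1/s^5.\<close>

lemma q_bounds:
  obtains c where "c \<ge> 0"
    "\<And>z. 0 \<le> z \<Longrightarrow> z < 1 \<Longrightarrow> \<bar>q z - (- K 0 / (2 * (1 + z)\<^sup>2))\<bar> \<le> c * sqrt (1 - z\<^sup>2)"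
    "\<And>z. 0 \<le> z \<Longrightarrow> z < 1 \<Longrightarrow> \<bar>q1 z\<bar> * sqrt (1 - z\<^sup>2) \<le> c"
    "\<And>z. 0 \<le> z \<Longrightarrow> z < 1 \<Longrightarrow> \<bar>q2 z\<bar> * sqrt (1 - z\<^sup>2) ^ 3 \<le> c"
    "\<And>z. 0 \<le> z \<Longrightarrow> z < 1 \<Longrightarrow> \<bar>q3 z\<bar> * sqrt (1 - z\<^sup>2) ^ 5 \<le> c"
proof -
  obtain k where k: "k \<ge> 0"
    "\<And>z. 0 \<le> z \<Longrightarrow> z < 1 \<Longrightarrow> \<bar>M0 z\<bar> \<le> k * sqrt (1 - z\<^sup>2) ^ 5 \<and> \<bar>M1 z\<bar> \<le> k * sqrt (1 - z\<^sup>2) ^ 3 \<and>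
       \<bar>M2 z\<bar> \<le> k * sqrt (1 - z\<^sup>2) \<and> \<bar>M3 z\<bar> * sqrt (1 - z\<^sup>2) \<le> k" using M_bounds by metis
  \<comment> \<open>Taken from \<open>q3\<close>, which has the largest coefficients: 12 for K(0),
    and 1 + 12 + 12 + 72 + 72 + 192 = 361 for the remainders, rounded up.\<close>
  define c where "c = 12 * \<bar>K 0\<bar> + 400 * k"
  have *: "\<bar>q z - (- K 0 / (2 * (1 + z)\<^sup>2))\<bar> \<le> c * sqrt (1 - z\<^sup>2) \<and> \<bar>q1 z\<bar> * sqrt (1 - z\<^sup>2) \<le> c \<and>
     \<bar>q2 z\<bar> * sqrt (1 - z\<^sup>2) ^ 3 \<le> c \<and> \<bar>q3 z\<bar> * sqrt (1 - z\<^sup>2) ^ 5 \<le> c" if z: "0 \<le> z" "z < 1" for z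
  proof -
    define s where "s = sqrt (1 - z\<^sup>2)"
    note a = arccos_facts[OF z, folded s_def]
    have s: "0 < s" "s \<le> 1" and t: "1 - z\<^sup>2 = s\<^sup>2" using a by auto
    note kz = k(2)[OF z, folded s_def]
    define m0 m1 m2 m3 where "m0 = M0 z / s ^ 5" and "m1 = M1 z / s ^ 3" and "m2 = M2 z / s" and "m3 = M3 z * s"
    have mb: "\<bar>m0\<bar> \<le> k" "\<bar>m1\<bar> \<le> k" "\<bar>m2\<bar> \<le> k" "\<bar>m3\<bar> \<le> k"
      using kz s by (auto simp: m0_def m1_def m2_def m3_def abs_mult pos_divide_le_eq)
    have M: "M0 z = m0 * s ^ 5" "M1 z = m1 * s ^ 3" "M2 z = m2 * s" "M3 z = m3 / s"
      using s by (auto simp: m0_def m1_def m2_def m3_def)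
    have zs: "\<bar>z ^ i * s ^ j * m\<bar> \<le> k" if "\<bar>m\<bar> \<le> k" for i j m
    proof -
      have "z ^ i \<le> 1" "s ^ j \<le> 1" using z s by (auto intro!: power_le_one)
      then have "z ^ i * s ^ j \<le> 1" "0 \<le> z ^ i * s ^ j" using z s by (auto intro!: mult_le_one)
      then have "(z ^ i * s ^ j) * \<bar>m\<bar> \<le> 1 * k" using that by (intro mult_mono) auto
      then show ?thesis using z s by (simp add: abs_mult)
    qed
    have kb: "\<bar>K 0 / (1 + z) ^ i * s ^ j\<bar> \<le> \<bar>K 0\<bar>" for i j
    proof -
      have "(1 + z) ^ i \<ge> 1" "s ^ j \<le> 1" using z s by (auto intro!: one_le_power power_le_one)
      then have "\<bar>K 0\<bar> / (1 + z) ^ i \<le> \<bar>K 0\<bar> / 1" by (intro divide_left_mono) auto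
      then have "\<bar>K 0\<bar> / (1 + z) ^ i * s ^ j \<le> \<bar>K 0\<bar> / 1 * 1" using \<open>s ^ j \<le> 1\<close> s by (intro mult_mono) auto
      then show ?thesis using z s by (simp add: abs_mult power_abs)
    qed
    have "q z - (- K 0 / (2 * (1 + z)\<^sup>2)) = s * m0"
      unfolding q_def t M using s by (simp add: field_simps power_numeral_reduce)
    then have 0: "\<bar>q z - (- K 0 / (2 * (1 + z)\<^sup>2))\<bar> \<le> c * s"
      using mb(1) s k(1) by (simp add: abs_mult c_def mult.commute mult_left_mono)
    have e1: "q1 z * s = K 0 / (1 + z) ^ 3 * s ^ 1 + z ^ 0 * s ^ 0 * m1 + 4 * (z ^ 1 * s ^ 0 * m0)"
      unfolding q1_def t M distrib_right using s by (simp add: power_numeral_reduce)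
    have 1: "\<bar>q1 z * s\<bar> \<le> c"
      using kb[of 3 1] zs[OF mb(2), of 0 0] zs[OF mb(1), of 1 0] k(1)
      unfolding c_def e1 by linarith
    have e2: "q2 z * s ^ 3 = - 3 * (K 0 / (1 + z) ^ 4 * s ^ 3) + z ^ 0 * s ^ 0 * m2 + 8 * (z ^ 1 * s ^ 0 * m1) + 4 * (z ^ 0 * s ^ 2 * m0)
        + 24 * (z ^ 2 * s ^ 0 * m0)"
      unfolding q2_def t M distrib_right using s by (simp add: power_numeral_reduce)
    have 2: "\<bar>q2 z * s ^ 3\<bar> \<le> c"
      using kb[of 4 3] zs[OF mb(3), of 0 0] zs[OF mb(2), of 1 0] zs[OF mb(1), of 0 2] zs[OF mb(1), of 2 0] k(1)
      unfolding c_def e2 by linarith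
    have e3: "q3 z * s ^ 5 = 12 * (K 0 / (1 + z) ^ 5 * s ^ 5) + z ^ 0 * s ^ 0 * m3 + 12 * (z ^ 1 * s ^ 0 * m2) + 12 * (z ^ 0 * s ^ 2 * m1)
        + 72 * (z ^ 2 * s ^ 0 * m1) + 72 * (z ^ 1 * s ^ 2 * m0) + 192 * (z ^ 3 * s ^ 0 * m0)"
      unfolding q3_def t M distrib_right using s by (simp add: power_numeral_reduce)
    have 3: "\<bar>q3 z * s ^ 5\<bar> \<le> c"
      using kb[of 5 5] zs[OF mb(4), of 0 0] zs[OF mb(3), of 1 0] zs[OF mb(2), of 0 2] zs[OF mb(2), of 2 0]
        zs[OF mb(1), of 1 2] zs[OF mb(1), of 3 0] k(1)
      unfolding c_def e3 by linarith
    show ?thesis using 0 1 2 3 s unfolding s_def[symmetric] by (simp add: abs_mult power_abs)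
  qed
  show ?thesis by (rule that[of c]) (use * k(1) in \<open>auto simp: c_def\<close>)
qed

lemma q_continuous: "continuous_on {0..1} q"
  unfolding continuous_on_eq_continuous_within
proof
  fix z :: real assume z: "z \<in> {0..1}"
  show "continuous (at z within {0..1}) q"
  proof (cases "z < 1")
    case True
    then show ?thesis using z q_derivs(1)[of z] by (auto intro: DERIV_continuous)
  next
    case False
    then have z1: "z = 1" using z by simp
    obtain c where c: "c \<ge> 0" "\<And>z. 0 \<le> z \<Longrightarrow> z < 1 \<Longrightarrow> \<bar>q z - (- K 0 / (2 * (1 + z)\<^sup>2))\<bar> \<le> c * sqrt (1 - z\<^sup>2)"
      using q_bounds by metis
    define h where "h z = q z - (- K 0 / (2 * (1 + z)\<^sup>2))" for z
    have "(h \<longlongrightarrow> 0) (at 1 within {0..1})"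
    proof (rule Lim_null_comparison)
      show "\<forall>\<^sub>F z in at 1 within {0..1}. norm (h z) \<le> c * sqrt (1 - z\<^sup>2)"
        unfolding eventually_at_filter using c by (intro always_eventually) (auto simp: h_def)
      have "((\<lambda>z. c * sqrt (1 - z\<^sup>2)) \<longlongrightarrow> c * sqrt (1 - 1\<^sup>2)) (at 1 within {0..1})" by (intro tendsto_intros)
      then show "((\<lambda>z. c * sqrt (1 - z\<^sup>2)) \<longlongrightarrow> 0) (at 1 within {0..1})" by simp
    qed
    then have "((\<lambda>z. h z + (- K 0 / (2 * (1 + z)\<^sup>2))) \<longlongrightarrow> 0 + (- K 0 / (2 * (1 + 1)\<^sup>2))) (at 1 within {0..1})"
      by (intro tendsto_intros) auto
    moreover have "q 1 = 0 + (- K 0 / (2 * (1 + 1)\<^sup>2))" by (simp add: q_def)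
    ultimately show ?thesis unfolding z1 continuous_within h_def by simp
  qed
qed

text \<open>Differentiating N = (1 - z^2)^2 q twice expresses K, and through it X, by q and its
  derivatives. In this form the force enters the verification of the momentum equation.\<close>

lemma E_q: assumes z: "0 < z" "z < 1"
  shows "Ez z = (1 - z\<^sup>2)\<^sup>2 * q1 z - 4 * z * (1 - z\<^sup>2) * q z"
    "- Kz z = (1 - z\<^sup>2)\<^sup>2 * q2 z - 8 * z * (1 - z\<^sup>2) * q1 z + (8 * z\<^sup>2 - 4 * (1 - z\<^sup>2)) * q z"
proof -
  have at: "at w within {0..1} = at w" if "0 < w" "w < 1" for w :: real using that by (intro at_within_interior) auto
  have ev: "\<forall>\<^sub>F w in nhds z. w \<in> {0<..<1}" using z by (intro eventually_nhds_in_open) auto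
  have E: "Ez w = (1 - w\<^sup>2)\<^sup>2 * q1 w - 4 * w * (1 - w\<^sup>2) * q w" if w: "0 < w" "w < 1" for w
  proof (rule DERIV_unique)
    show "(Nz has_real_derivative Ez w) (at w)" using z_derivs(1)[of w] w at by simp
    have "((\<lambda>w. (1 - w\<^sup>2)\<^sup>2 * q w) has_real_derivative (1 - w\<^sup>2)\<^sup>2 * q1 w - 4 * w * (1 - w\<^sup>2) * q w) (at w)"
      using q_derivs(1)[of w] w at[OF w] by (auto intro!: derivative_eq_intros simp: algebra_simps)
    then show "(Nz has_real_derivative (1 - w\<^sup>2)\<^sup>2 * q1 w - 4 * w * (1 - w\<^sup>2) * q w) (at w)"
      by (rule has_field_derivative_transform_within_open[of _ _ _ "{0<..<1}"]) (use w q_N in auto)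
  qed
  then show "Ez z = (1 - z\<^sup>2)\<^sup>2 * q1 z - 4 * z * (1 - z\<^sup>2) * q z" using z by blast
  show "- Kz z = (1 - z\<^sup>2)\<^sup>2 * q2 z - 8 * z * (1 - z\<^sup>2) * q1 z + (8 * z\<^sup>2 - 4 * (1 - z\<^sup>2)) * q z"
  proof (rule DERIV_unique)
    show "(Ez has_real_derivative - Kz z) (at z)" using z_derivs(2)[of z] z at by simp
    have "((\<lambda>w. (1 - w\<^sup>2)\<^sup>2 * q1 w - 4 * w * (1 - w\<^sup>2) * q w) has_real_derivative
       (1 - z\<^sup>2)\<^sup>2 * q2 z - 8 * z * (1 - z\<^sup>2) * q1 z + (8 * z\<^sup>2 - 4 * (1 - z\<^sup>2)) * q z) (at z)"
      using q_derivs(1,2)[of z] z at[OF z]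
      by (auto intro!: derivative_eq_intros simp: algebra_simps power2_eq_square)
    then show "(Ez has_real_derivative (1 - z\<^sup>2)\<^sup>2 * q2 z - 8 * z * (1 - z\<^sup>2) * q1 z + (8 * z\<^sup>2 - 4 * (1 - z\<^sup>2)) * q z) (at z)"
      by (rule has_field_derivative_transform_within_open[of _ _ _ "{0<..<1}"]) (use z E in auto)
  qed
qed

end

section \<open>Spherical geometry\<close>

lemma sin_mult_sin: "sin x * sin x = 1 - cos x * cos (x::real)"
  using sin_cos_squared_add[of x] by (simp add: power2_eq_square)

lemma e_phi_vec: "e_phi \<phi> \<theta> = vector [cos \<phi> * cos \<theta>, cos \<phi> * sin \<theta>, - sin \<phi>]"
proof -
  have "sin \<theta> * (sin \<phi> * sin \<theta>) + cos \<theta> * (sin \<phi> * cos \<theta>) = sin \<phi> * (sin \<theta> * sin \<theta> + cos \<theta> * cos \<theta>)"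
    by (simp only: algebra_simps)
  also have "\<dots> = sin \<phi>" unfolding sin_mult_sin by simp
  finally show ?thesis
    unfolding e_phi_def cross3_def e_theta_def e_rho_def by (simp add: vec_eq_iff forall_3)
qed

lemma norm_e_rho: "norm (e_rho \<phi> \<theta>) = 1"
proof -
  have "inner (e_rho \<phi> \<theta>) (e_rho \<phi> \<theta>)
      = (sin \<phi> * sin \<phi>) * (cos \<theta> * cos \<theta> + sin \<theta> * sin \<theta>) + cos \<phi> * cos \<phi>"
    unfolding e_rho_def inner_vec_def sum_3 by (simp add: algebra_simps del: sin_cos_squared_add sin_cos_squared_add2 sin_cos_squared_add3)
  also have "\<dots> = 1" unfolding sin_mult_sin by (simp add: algebra_simps)
  finally show ?thesis by (simp add: norm_eq_sqrt_inner)
qed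

text \<open>Multiplied by sin \<phi>, the tangential frame is expressed by n, e_3 and cos \<phi>;
  the angle \<theta> then survives only inside n.\<close>

lemma sin_e_phi: "sin \<phi> *\<^sub>R e_phi \<phi> \<theta> = cos \<phi> *\<^sub>R e_rho \<phi> \<theta> - axis 3 1"
proof -
  have "cos \<phi> * cos \<phi> - 1 = - (sin \<phi> * sin \<phi>)"
    using sin_cos_squared_add[of \<phi>] by (simp add: power2_eq_square)
  then show ?thesis unfolding e_phi_vec e_rho_def by (simp add: vec_eq_iff forall_3 axis_def mult_ac)
qed

lemma sin_e_theta: "sin \<phi> *\<^sub>R e_theta \<theta> = vector [- e_rho \<phi> \<theta> $ 2, e_rho \<phi> \<theta> $ 1, 0]"
  unfolding e_theta_def e_rho_def by (simp add: vec_eq_iff forall_3)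

lemma e3_eq: "axis 3 1 = cos \<phi> *\<^sub>R e_rho \<phi> \<theta> - sin \<phi> *\<^sub>R e_phi \<phi> \<theta>"
  unfolding sin_e_phi by simp

lemma spherical_facts:
  assumes "\<rho> > 0"
  shows "norm (spherical \<rho> \<phi> \<theta>) = \<rho>" "nvec (spherical \<rho> \<phi> \<theta>) = e_rho \<phi> \<theta>" "zc (spherical \<rho> \<phi> \<theta>) = cos \<phi>"
proof -
  show 1: "norm (spherical \<rho> \<phi> \<theta>) = \<rho>" using assms by (simp add: spherical_def norm_e_rho)
  show "nvec (spherical \<rho> \<phi> \<theta>) = e_rho \<phi> \<theta>" unfolding nvec_def 1 using assms by (simp add: spherical_def)
  show "zc (spherical \<rho> \<phi> \<theta>) = cos \<phi>" unfolding zc_def 1 using assms by (simp add: spherical_def e_rho_def)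
qed

lemma spherical_in_S3: "\<rho> > 0 \<Longrightarrow> \<phi> \<in> {0..pi/2} \<Longrightarrow> spherical \<rho> \<phi> \<theta> \<in> S3"
  using spherical_facts(1)[of \<rho> \<phi> \<theta>] cos_ge_zero[of \<phi>]
  by (auto simp: mem_S3 spherical_def e_rho_def)

lemma spherical_coordinates:
  assumes x: "x \<in> S3"
  obtains \<theta> where "x = spherical (norm x) (arccos (zc x)) \<theta>"
proof -
  have x0: "x \<noteq> 0" using x by (simp add: mem_S3)
  have z: "0 \<le> zc x" "zc x \<le> 1" using zc_bounds[OF x] by auto
  define s where "s = sqrt (1 - (zc x)\<^sup>2)"
  have z2: "(zc x)\<^sup>2 \<le> 1" using z by (simp add: power_le_one)
  have sn: "sin (arccos (zc x)) = s" "cos (arccos (zc x)) = zc x"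
    using z by (auto simp: s_def sin_arccos)
  have "inner (nvec x) (nvec x) = 1" by (rule nvec_facts[OF x0])
  then have sum: "(nvec x $ 1)\<^sup>2 + (nvec x $ 2)\<^sup>2 = s\<^sup>2"
    using nvec_facts(4)[OF x0] z2 by (simp add: inner_vec_def sum_3 power2_eq_square s_def)
  obtain \<theta> where t: "nvec x $ 1 = s * cos \<theta>" "nvec x $ 2 = s * sin \<theta>"
  proof (cases "s = 0")
    case True
    then show ?thesis using that[of 0] sum by (simp add: sum_power2_eq_zero_iff)
  next
    case False
    then have "(nvec x $ 1 / s)\<^sup>2 + (nvec x $ 2 / s)\<^sup>2 = 1"
      using sum by (simp add: power_divide add_divide_distrib[symmetric])
    then obtain t where "nvec x $ 1 / s = cos t" "nvec x $ 2 / s = sin t" using sincos_total_2pi by metis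
    then show ?thesis using that[of t] False by (simp add: field_simps)
  qed
  have "nvec x = e_rho (arccos (zc x)) \<theta>"
    unfolding e_rho_def sn using t nvec_facts(4)[OF x0] by (simp add: vec_eq_iff forall_3)
  moreover have "norm x *\<^sub>R nvec x = x" using x0 by (simp add: nvec_def)
  ultimately have "x = spherical (norm x) (arccos (zc x)) \<theta>" by (simp add: spherical_def)
  then show ?thesis by (rule that)
qed

lemma off_axis_frame:
  assumes x: "x \<in> S3" "zc x < 1" and t: "x = spherical (norm x) (arccos (zc x)) \<theta>"
  shows "e_rho (arccos (zc x)) \<theta> = nvec x"
    "e_phi (arccos (zc x)) \<theta> = (1 / sqrt (1 - (zc x)\<^sup>2)) *\<^sub>R (zc x *\<^sub>R nvec x - axis 3 1)"
    "e_theta \<theta> = (1 / sqrt (1 - (zc x)\<^sup>2)) *\<^sub>R vector [- nvec x $ 2, nvec x $ 1, 0]"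
proof -
  have n: "norm x > 0" using x by (simp add: mem_S3)
  have z: "0 \<le> zc x" using zc_bounds[OF x(1)] by auto
  note a = arccos_facts[OF z x(2)]
  show 1: "e_rho (arccos (zc x)) \<theta> = nvec x" using spherical_facts(2)[OF n] t by metis
  let ?s = "sqrt (1 - (zc x)\<^sup>2)"
  have "?s *\<^sub>R e_phi (arccos (zc x)) \<theta> = zc x *\<^sub>R nvec x - axis 3 1"
    using sin_e_phi[of "arccos (zc x)" \<theta>] unfolding a(2,3) 1 .
  then have "(1 / ?s) *\<^sub>R (?s *\<^sub>R e_phi (arccos (zc x)) \<theta>) = (1 / ?s) *\<^sub>R (zc x *\<^sub>R nvec x - axis 3 1)" by simp
  then show "e_phi (arccos (zc x)) \<theta> = (1 / ?s) *\<^sub>R (zc x *\<^sub>R nvec x - axis 3 1)" using a(4) by simp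
  show "e_theta \<theta> = (1 / sqrt (1 - (zc x)\<^sup>2)) *\<^sub>R vector [- nvec x $ 2, nvec x $ 1, 0]"
    using a(4) unfolding sin_e_theta[of "arccos (zc x)" \<theta>, unfolded a(2) 1, symmetric] by simp
qed

lemma force_cartesian:
  assumes F: "\<And>\<rho> \<phi> \<theta>. \<rho> > 0 \<Longrightarrow> \<phi> \<in> {0..pi/2} \<Longrightarrow>
      F (spherical \<rho> \<phi> \<theta>) = (1 / \<rho>^3) *\<^sub>R (X \<phi> *\<^sub>R e_rho \<phi> \<theta> + Y \<phi> *\<^sub>R e_phi \<phi> \<theta>)"
    and x: "x \<in> S3" "zc x < 1" and z: "z = zc x" and s: "s = sqrt (1 - z\<^sup>2)"
  shows "F x = (inorm x) ^ 3 *\<^sub>R ((X (arccos z) + z * (Y (arccos z) / s)) *\<^sub>R nvec x - (Y (arccos z) / s) *\<^sub>R axis 3 1)"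
proof -
  obtain \<theta> where t: "x = spherical (norm x) (arccos (zc x)) \<theta>" by (rule spherical_coordinates[OF x(1)])
  have n: "norm x > 0" using x by (simp add: mem_S3)
  have "F x = (1 / norm x ^ 3) *\<^sub>R (X (arccos z) *\<^sub>R e_rho (arccos z) \<theta> + Y (arccos z) *\<^sub>R e_phi (arccos z) \<theta>)"
    using F[OF n arccos_mem[OF zc_bounds[OF x(1)]], of \<theta>] t z by simp
  then show ?thesis unfolding off_axis_frame[OF x t, folded z, folded s]
    by (simp add: algebra_simps power_inverse divide_inverse)
qed

section \<open>Regular fields on the open half space\<close>

lemma half_space_S3: "x \<in> half_space \<Longrightarrow> x \<in> S3" by (auto simp: half_space_def mem_S3)

lemma open_half_space: "open half_space"
  unfolding half_space_def by (intro open_Collect_less continuous_intros)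

lemma at_half_space: "x \<in> half_space \<Longrightarrow> at x within S3 = at x"
proof (rule at_within_interior)
  assume "x \<in> half_space"
  then show "x \<in> interior S3" using open_half_space half_space_S3 by (intro interiorI[of half_space]) auto
qed

lemma C1_partial:
  assumes "has_continuous_derivative_on f f' S3" "x \<in> half_space"
  shows "(f has_derivative blinfun_apply (f' x)) (at x)" "partial i f x = f' x (axis i 1)"
proof -
  show 1: "(f has_derivative blinfun_apply (f' x)) (at x)"
    using assms at_half_space half_space_S3 unfolding has_continuous_derivative_on_def by metis
  show "partial i f x = f' x (axis i 1)" using partial_eq[OF 1] .
qed

lemma C2_partial:
  fixes u :: "real^3 \<Rightarrow> 'b::real_normed_vector"
  assumes u: "has_continuous_derivative_on u u' S3" "has_continuous_derivative_on u' u'' S3" and x: "x \<in> half_space"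
  shows "partial i (partial i u) x = u'' x (axis i 1) (axis i 1)"
proof -
  have "((\<lambda>y. u' y (axis i 1)) has_derivative (\<lambda>h. u'' x h (axis i 1))) (at x)"
    by (rule bounded_linear.has_derivative[OF blinfun.bounded_linear_left C1_partial(1)[OF u(2) x]])
  from partial_partial_eq[OF open_half_space x C1_partial(2)[OF u(1)] this] show ?thesis by simp
qed

text \<open>Continuity of the operators allows equations that are verified off the axis, where the
  profile form is available, to be extended to it.\<close>

lemma NS_continuous:
  fixes u :: "real^3 \<Rightarrow> real^3" and p :: "real^3 \<Rightarrow> real"
  assumes u: "C2_on S3 u" and p: "C1_on S3 p"
  shows "continuous_on half_space (\<lambda>x. - laplacian u x + advection u u x + grad p x)"
    "continuous_on half_space (divergence u)"
proof -
  obtain u' u'' where u': "has_continuous_derivative_on u u' S3" "has_continuous_derivative_on u' u'' S3"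
    using u unfolding C2_on_def by blast
  obtain p' where p': "has_continuous_derivative_on p p' S3" using p unfolding C1_on_def by blast
  have sub: "half_space \<subseteq> S3" using half_space_S3 by blast
  have c: "continuous_on half_space u'" "continuous_on half_space u''" "continuous_on half_space p'"
    using u' p' continuous_on_subset[OF _ sub] unfolding has_continuous_derivative_on_def by auto
  have cu: "continuous_on half_space u"
    using C1_partial(1)[OF u'(1)] by (auto intro!: continuous_at_imp_continuous_on has_derivative_continuous)
  have "continuous_on half_space (\<lambda>x. - (\<Sum>i\<in>UNIV. u'' x (axis i 1) (axis i 1)) + (\<Sum>i\<in>UNIV. u x $ i *\<^sub>R u' x (axis i 1))
      + (\<chi> i. p' x (axis i 1)))"
    by (intro continuous_intros c cu)
  then show "continuous_on half_space (\<lambda>x. - laplacian u x + advection u u x + grad p x)"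
    by (rule continuous_on_eq)
      (simp add: laplacian_def advection_def grad_def C2_partial[OF u'] C1_partial(2)[OF u'(1)] C1_partial(2)[OF p'])
  have "continuous_on half_space (\<lambda>x. \<Sum>i\<in>UNIV. u' x (axis i 1) $ i)" by (intro continuous_intros c)
  then show "continuous_on half_space (divergence u)"
    by (rule continuous_on_eq) (simp add: divergence_def C1_partial(2)[OF u'(1)])
qed

section \<open>Points off the axis and extension by continuity\<close>

definition off_axis :: "(real^3) set" where
  "off_axis = {x. 0 < x $ 3 \<and> (x $ 1)\<^sup>2 + (x $ 2)\<^sup>2 > 0}"

lemma open_off_axis: "open off_axis"
  unfolding off_axis_def by (intro open_Collect_conj open_Collect_less continuous_intros)

lemma off_axis_facts:
  assumes "x \<in> off_axis" shows "x \<in> half_space" "x \<in> S3" "x \<noteq> 0" "zc x \<in> {0<..<1}"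
proof -
  show 1: "x \<in> half_space" using assms by (auto simp: off_axis_def half_space_def)
  show 2: "x \<in> S3" by (rule half_space_S3[OF 1])
  show x0: "x \<noteq> 0" using 2 by (simp add: mem_S3)
  have "(norm x)\<^sup>2 = (x $ 1)\<^sup>2 + (x $ 2)\<^sup>2 + (x $ 3)\<^sup>2"
    by (simp add: power2_norm_eq_inner inner_vec_def sum_3) (simp add: power2_eq_square)
  then have "(x $ 3)\<^sup>2 < (norm x)\<^sup>2" using assms by (auto simp: off_axis_def)
  then have "x $ 3 < norm x" by (rule power2_less_imp_less) simp
  then show "zc x \<in> {0<..<1}" using assms x0 by (auto simp: zc_def off_axis_def field_simps)
qed

lemma zero_0_off_axis: "0 \<notin> off_axis" using off_axis_facts(3) by blast

text \<open>The point x is the limit of x + t d as t decreases to 0, with d leading into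
  \<open>off_axis\<close>. The direction e_3 does this, also from the boundary plane, unless x lies
  on the axis; there e_1 is added to leave it.\<close>

lemma continuous_zero_off_axis:
  fixes f :: "real^3 \<Rightarrow> 'b::real_normed_vector"
  assumes f: "continuous_on S f" and S: "off_axis \<subseteq> S" "x \<in> S"
    and z: "\<And>y. y \<in> off_axis \<Longrightarrow> f y = 0" and x3: "x $ 3 \<ge> 0" "x \<noteq> 0"
  shows "f x = 0"
proof -
  define d :: "real^3" where "d = (if (x $ 1)\<^sup>2 + (x $ 2)\<^sup>2 > 0 then axis 3 1 else axis 1 1 + axis 3 1)"
  have mem: "x + t *\<^sub>R d \<in> off_axis" if "t > 0" for t
    using that x3 by (auto simp: d_def off_axis_def axis_def add_nonneg_pos sum_power2_gt_zero_iff)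
  have lim: "((\<lambda>n. x + inverse (real (Suc n)) *\<^sub>R d) \<longlongrightarrow> x + 0 *\<^sub>R d) sequentially"
    by (intro tendsto_intros LIMSEQ_inverse_real_of_nat)
  have "((\<lambda>n. f (x + inverse (real (Suc n)) *\<^sub>R d)) \<longlongrightarrow> f x) sequentially"
    by (rule continuous_on_tendsto_compose[OF f]) (use lim S mem in \<open>auto intro!: always_eventually\<close>)
  moreover have "(\<lambda>n. f (x + inverse (real (Suc n)) *\<^sub>R d)) = (\<lambda>_. 0)" using mem z by auto
  ultimately show ?thesis by (metis LIMSEQ_unique tendsto_const)
qed

lemma NS_from_off_axis:
  fixes u :: "real^3 \<Rightarrow> real^3" and p :: "real^3 \<Rightarrow> real"
  assumes u: "C2_on S3 u" and p: "C1_on S3 p" and F: "C1_on S3 F"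
    and NS: "\<And>x. x \<in> off_axis \<Longrightarrow> - laplacian u x + advection u u x + grad p x = lam *\<^sub>R F x"
    and div: "\<And>x. x \<in> off_axis \<Longrightarrow> divergence u x = 0" and x: "x \<in> half_space"
  shows "- laplacian u x + advection u u x + grad p x = lam *\<^sub>R F x" "divergence u x = 0"
proof -
  have sub: "off_axis \<subseteq> half_space" using off_axis_facts(1) by blast
  have x3: "x $ 3 \<ge> 0" "x \<noteq> 0" using x half_space_S3[OF x] by (auto simp: half_space_def mem_S3)
  obtain F' where F': "has_continuous_derivative_on F F' S3" using F unfolding C1_on_def by blast
  have cF: "continuous_on half_space F"
    using C1_partial(1)[OF F'] by (auto intro!: continuous_at_imp_continuous_on has_derivative_continuous)
  have "(- laplacian u x + advection u u x + grad p x) - lam *\<^sub>R F x = 0"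
    by (rule continuous_zero_off_axis[OF continuous_on_diff[OF NS_continuous(1)[OF u p]
        continuous_on_scaleR[OF continuous_on_const cF]] sub x _ x3]) (simp only: NS diff_self)
  then show "- laplacian u x + advection u u x + grad p x = lam *\<^sub>R F x" by simp
  show "divergence u x = 0"
    by (rule continuous_zero_off_axis[OF NS_continuous(2)[OF u p] sub x div x3])
qed

section \<open>Existence and regularity\<close>

lemma has_grad_real: "has_grad f v x S \<longleftrightarrow> (f has_real_derivative v) (at (x::real) within S)"
  unfolding has_grad_def has_field_derivative_def by (simp add: inner_real_def[abs_def])

lemma endpoint_limit_continuous:
  fixes f f' :: "real \<Rightarrow> real"
  assumes d: "\<And>z. 0 \<le> z \<Longrightarrow> z < 1 \<Longrightarrow> (f has_real_derivative f' z) (at z within {0..1})"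
    and b: "\<And>z. 0 \<le> z \<Longrightarrow> z < 1 \<Longrightarrow> \<bar>f z - g z\<bar> \<le> c * sqrt (1 - z\<^sup>2)" and g: "(g \<longlongrightarrow> f 1) (at 1 within {0..1})"
  shows "continuous_on {0..1} f"
  unfolding continuous_on_eq_continuous_within
proof
  fix z :: real assume z: "z \<in> {0..1}"
  show "continuous (at z within {0..1}) f"
  proof (cases "z < 1")
    case True
    then show ?thesis using z d[of z] by (auto intro: DERIV_continuous)
  next
    case False
    then have z1: "z = 1" using z by simp
    have "((\<lambda>z. f z - g z) \<longlongrightarrow> 0) (at 1 within {0..1})"
    proof (rule Lim_null_comparison)
      show "\<forall>\<^sub>F z in at 1 within {0..1}. norm (f z - g z) \<le> c * sqrt (1 - z\<^sup>2)"
        unfolding eventually_at_filter using b by (intro always_eventually) auto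
      have "((\<lambda>z. c * sqrt (1 - z\<^sup>2)) \<longlongrightarrow> c * sqrt (1 - 1\<^sup>2)) (at 1 within {0..1})" by (intro tendsto_intros)
      then show "((\<lambda>z. c * sqrt (1 - z\<^sup>2)) \<longlongrightarrow> 0) (at 1 within {0..1})" by simp
    qed
    from tendsto_add[OF this g] show ?thesis unfolding z1 continuous_within by simp
  qed
qed

context angular_force
begin

text \<open>The velocity contains \<open>q\<close> itself only in this product. The factor s^2 = 1 -
  z^2 compensates two orders of the leading singularities, so the second and third derivatives are
  O(1/s) and O(1/s^3), as the composition criterion demands.\<close>

lemma r_C2L: "C2L (\<lambda>x. (1 - (zc x)\<^sup>2) * q (zc x))"
proof -
  obtain c where c: "c \<ge> 0"
    "\<And>z. 0 \<le> z \<Longrightarrow> z < 1 \<Longrightarrow> \<bar>q1 z\<bar> * sqrt (1 - z\<^sup>2) \<le> c"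
    "\<And>z. 0 \<le> z \<Longrightarrow> z < 1 \<Longrightarrow> \<bar>q2 z\<bar> * sqrt (1 - z\<^sup>2) ^ 3 \<le> c"
    "\<And>z. 0 \<le> z \<Longrightarrow> z < 1 \<Longrightarrow> \<bar>q3 z\<bar> * sqrt (1 - z\<^sup>2) ^ 5 \<le> c" using q_bounds by metis
  obtain d where d: "d \<ge> 0" "\<forall>z\<in>{0..1}. \<bar>q z\<bar> \<le> d" by (rule continuous_on_unit_bounded[OF q_continuous])
  define R1 where "R1 z = - 2 * z * q z + (1 - z\<^sup>2) * q1 z" for z
  define R2 where "R2 z = - 2 * q z - 4 * z * q1 z + (1 - z\<^sup>2) * q2 z" for z
  define R3 where "R3 z = - 6 * q1 z - 6 * z * q2 z + (1 - z\<^sup>2) * q3 z" for z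
  have R2: "(R1 has_real_derivative R2 z) (at z within {0..1})" if "0 \<le> z" "z < 1" for z
    unfolding R1_def[abs_def] R2_def using q_derivs[OF that] by (auto intro!: derivative_eq_intros simp: algebra_simps)
  have R3: "(R2 has_real_derivative R3 z) (at z within {0..1})" if "0 \<le> z" "z < 1" for z
    unfolding R2_def[abs_def] R3_def using q_derivs[OF that] by (auto intro!: derivative_eq_intros simp: algebra_simps)
  have R1: "((\<lambda>z. (1 - z\<^sup>2) * q z) has_real_derivative R1 z) (at z within {0..1})" if z: "z \<in> {0..1}" for z
  proof (cases "z < 1")
    case True
    then show ?thesis unfolding R1_def using q_derivs[of z] z by (auto intro!: derivative_eq_intros simp: algebra_simps)
  next
    case False
    then have z1: "z = 1" using z by simp
    \<comment> \<open>At z = 1 only continuity of \<open>q\<close> is available; since 1 - z^2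
      vanishes there, the product still has a one-sided derivative.\<close>
    have "has_grad (\<lambda>z. 1 - z\<^sup>2) (- 2) (1::real) {0..1}"
      unfolding has_grad_real by (auto intro!: derivative_eq_intros)
    from has_grad_mult_vanishing[OF this q_continuous] show ?thesis
      unfolding z1 has_grad_real R1_def by (simp add: mult.commute)
  qed
  have est: "\<bar>R1 z - (- 2 * z * q z)\<bar> \<le> c * sqrt (1 - z\<^sup>2) \<and> \<bar>R2 z\<bar> * sqrt (1 - z\<^sup>2) \<le> 2 * d + 5 * c \<and>
      \<bar>R3 z\<bar> * sqrt (1 - z\<^sup>2) ^ 3 \<le> 13 * c" if z: "0 \<le> z" "z < 1" for z
  proof -
    define s where "s = sqrt (1 - z\<^sup>2)"
    note a = arccos_facts[OF z, folded s_def]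
    have s: "0 < s" "s \<le> 1" and t: "1 - z\<^sup>2 = s\<^sup>2" using a by auto
    have b: "\<bar>q1 z * s\<bar> \<le> c" "\<bar>q2 z * s ^ 3\<bar> \<le> c" "\<bar>q3 z * s ^ 5\<bar> \<le> c" "\<bar>q z\<bar> \<le> d"
      using c(2-4)[OF z, folded s_def] s d z by (auto simp: abs_mult power_abs)
    have le: "\<bar>f * m\<bar> \<le> k" if "\<bar>m\<bar> \<le> k" "0 \<le> f" "f \<le> 1" for f m k :: real
    proof -
      have "f * \<bar>m\<bar> \<le> 1 * k" using that by (intro mult_mono) auto
      then show ?thesis using that by (simp add: abs_mult)
    qed
    have s2: "s\<^sup>2 \<le> 1" "0 \<le> s\<^sup>2" using s by (auto intro: power_le_one)
    have "R1 z - (- 2 * z * q z) = s * (q1 z * s)" unfolding R1_def t by (simp add: power2_eq_square)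
    then have 1: "\<bar>R1 z - (- 2 * z * q z)\<bar> \<le> c * s" using b(1) s by (simp add: abs_mult mult.commute mult_left_mono)
    have "R2 z * s = - 2 * (s * q z) - 4 * (z * (q1 z * s)) + q2 z * s ^ 3"
      unfolding R2_def t by (simp add: algebra_simps power_numeral_reduce)
    moreover have "\<bar>s * q z\<bar> \<le> d" "\<bar>z * (q1 z * s)\<bar> \<le> c" using le b s z by auto
    ultimately have 2: "\<bar>R2 z * s\<bar> \<le> 2 * d + 5 * c" using b(2) by linarith
    have "R3 z * s ^ 3 = - 6 * (s\<^sup>2 * (q1 z * s)) - 6 * (z * (q2 z * s ^ 3)) + q3 z * s ^ 5"
      unfolding R3_def t by (simp add: algebra_simps power_numeral_reduce)
    moreover have "\<bar>s\<^sup>2 * (q1 z * s)\<bar> \<le> c" "\<bar>z * (q2 z * s ^ 3)\<bar> \<le> c" using le b s2 z by auto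
    ultimately have 3: "\<bar>R3 z * s ^ 3\<bar> \<le> 13 * c" using b(3) by linarith
    show ?thesis using 1 2 3 s unfolding s_def[symmetric] by (simp add: abs_mult power_abs)
  qed
  show ?thesis
  proof (rule C2L_compose_zc[where R = "\<lambda>z. (1 - z\<^sup>2) * q z" and c = "2 * d + 13 * c", OF R1 _ R2 R3])
    have "(q \<longlongrightarrow> q 1) (at 1 within {0..1})" using q_continuous by (simp add: continuous_on_def)
    then have "((\<lambda>z. - 2 * z * q z) \<longlongrightarrow> - 2 * 1 * q 1) (at 1 within {0..1})" by (intro tendsto_intros)
    then show "continuous_on {0..1} R1"
      using est by (intro endpoint_limit_continuous[where g = "\<lambda>z. - 2 * z * q z", OF R2]) (auto simp: R1_def)
    fix z :: real assume z: "0 \<le> z" "z < 1"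
    note a = arccos_facts[OF z]
    have "\<bar>R2 z\<bar> * sqrt (1 - z) \<le> \<bar>R2 z\<bar> * sqrt (1 - z\<^sup>2)" using a by (intro mult_left_mono) auto
    then show "\<bar>R2 z\<bar> * sqrt (1 - z) \<le> 2 * d + 13 * c" using est[OF z] c(1) d(1) by linarith
    have "\<bar>R3 z\<bar> * sqrt (1 - z) ^ 3 \<le> \<bar>R3 z\<bar> * sqrt (1 - z\<^sup>2) ^ 3" using a z by (intro mult_left_mono power_mono) auto
    then show "\<bar>R3 z\<bar> * sqrt (1 - z) ^ 3 \<le> 2 * d + 13 * c" using est[OF z] c(1) d(1) by linarith
  qed auto
qed

text \<open>Differentiating the Riccati equation shows that y is one derivative smoother than q: its
  second derivative is of the order 1/s of q', its third of the order 1/s^3 of q''.\<close>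

lemma riccati_C2L:
  assumes y: "riccati_solution q l y"
  shows "C2L (\<lambda>x. y (zc x))"
proof -
  obtain c where c: "c \<ge> 0"
    "\<And>z. 0 \<le> z \<Longrightarrow> z < 1 \<Longrightarrow> \<bar>q1 z\<bar> * sqrt (1 - z\<^sup>2) \<le> c"
    "\<And>z. 0 \<le> z \<Longrightarrow> z < 1 \<Longrightarrow> \<bar>q2 z\<bar> * sqrt (1 - z\<^sup>2) ^ 3 \<le> c" using q_bounds by metis
  have yd: "(y has_real_derivative l * q z - (y z)\<^sup>2 / 2) (at z within {0..1})" if "z \<in> {0..1}" for z
    using y that by (auto simp: riccati_solution_def)
  have yc: "continuous_on {0..1} y" by (rule DERIV_continuous_on, erule yd)
  define y1 where "y1 z = l * q z - (y z)\<^sup>2 / 2" for z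
  define y2 where "y2 z = l * q1 z - y z * y1 z" for z
  define y3 where "y3 z = l * q2 z - (y1 z)\<^sup>2 - y z * y2 z" for z
  have y1c: "continuous_on {0..1} y1" unfolding y1_def[abs_def] by (intro continuous_intros yc q_continuous) auto
  have d1: "(y has_real_derivative y1 z) (at z within {0..1})" if "z \<in> {0..1}" for z
    using yd[OF that] by (simp add: y1_def)
  have d2: "(y1 has_real_derivative y2 z) (at z within {0..1})" if "0 \<le> z" "z < 1" for z
    unfolding y1_def[abs_def] y2_def using q_derivs[OF that] d1[of z] that
    by (auto intro!: derivative_eq_intros simp: y1_def)
  have d3: "(y2 has_real_derivative y3 z) (at z within {0..1})" if "0 \<le> z" "z < 1" for z
    unfolding y2_def[abs_def] y3_def using q_derivs[OF that] d1[of z] d2[OF that] that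
    by (auto intro!: derivative_eq_intros simp: y2_def power2_eq_square)
  obtain k0 where k0: "k0 \<ge> 0" "\<forall>z\<in>{0..1}. \<bar>y z\<bar> \<le> k0" by (rule continuous_on_unit_bounded[OF yc])
  obtain k1 where k1: "k1 \<ge> 0" "\<forall>z\<in>{0..1}. \<bar>y1 z\<bar> \<le> k1" by (rule continuous_on_unit_bounded[OF y1c])
  define b where "b = \<bar>l\<bar> * c + k0 * k1"
  define b3 where "b3 = \<bar>l\<bar> * c + k1 * k1 + k0 * b"
  have b0: "b \<ge> 0" "b3 \<ge> 0" using c k0 k1 by (auto simp: b_def b3_def)
  have est: "\<bar>y2 z\<bar> * sqrt (1 - z\<^sup>2) \<le> b \<and> \<bar>y3 z\<bar> * sqrt (1 - z\<^sup>2) ^ 3 \<le> b3" if z: "0 \<le> z" "z < 1" for z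
  proof -
    define s where "s = sqrt (1 - z\<^sup>2)"
    note a = arccos_facts[OF z, folded s_def]
    have s: "0 < s" "s \<le> 1" using a by auto
    have s3: "s ^ 3 \<le> 1" "s ^ 3 \<ge> 0" "s ^ 3 \<le> s" using s by (auto intro: power_le_one simp: power3_eq_cube mult_le_one mult_left_le)
    have yb: "\<bar>y z\<bar> \<le> k0" "\<bar>y1 z\<bar> \<le> k1" using k0 k1 z by auto
    have "\<bar>y2 z\<bar> \<le> \<bar>l\<bar> * \<bar>q1 z\<bar> + \<bar>y z\<bar> * \<bar>y1 z\<bar>"
      unfolding y2_def by (rule order_trans[OF abs_triangle_ineq4]) (simp add: abs_mult)
    then have "\<bar>y2 z\<bar> * s \<le> (\<bar>l\<bar> * \<bar>q1 z\<bar> + \<bar>y z\<bar> * \<bar>y1 z\<bar>) * s" using s by (intro mult_right_mono) auto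
    also have "\<dots> = \<bar>l\<bar> * (\<bar>q1 z\<bar> * s) + \<bar>y z\<bar> * \<bar>y1 z\<bar> * s" by (simp add: algebra_simps)
    also have "\<dots> \<le> \<bar>l\<bar> * c + k0 * k1 * 1"
      using c(2)[OF z, folded s_def] yb s k0 k1 by (intro add_mono mult_left_mono mult_mono) auto
    finally have 2: "\<bar>y2 z\<bar> * s \<le> b" by (simp add: b_def)
    have "\<bar>y3 z\<bar> \<le> \<bar>l\<bar> * \<bar>q2 z\<bar> + \<bar>y1 z\<bar> * \<bar>y1 z\<bar> + \<bar>y z\<bar> * \<bar>y2 z\<bar>"
      unfolding y3_def by (rule order_trans[OF abs_triangle_ineq4], intro add_mono order_trans[OF abs_triangle_ineq4])
        (simp_all add: abs_mult power2_eq_square)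
    then have "\<bar>y3 z\<bar> * s ^ 3 \<le> (\<bar>l\<bar> * \<bar>q2 z\<bar> + \<bar>y1 z\<bar> * \<bar>y1 z\<bar> + \<bar>y z\<bar> * \<bar>y2 z\<bar>) * s ^ 3" using s3 by (intro mult_right_mono) auto
    also have "\<dots> = \<bar>l\<bar> * (\<bar>q2 z\<bar> * s ^ 3) + \<bar>y1 z\<bar> * \<bar>y1 z\<bar> * s ^ 3 + \<bar>y z\<bar> * (\<bar>y2 z\<bar> * s ^ 3)" by (simp add: algebra_simps)
    also have "\<dots> \<le> \<bar>l\<bar> * c + k1 * k1 * 1 + k0 * (\<bar>y2 z\<bar> * s)"
      using c(3)[OF z, folded s_def] yb s s3 k0 k1 by (intro add_mono mult_left_mono mult_mono) auto
    also have "\<dots> \<le> \<bar>l\<bar> * c + k1 * k1 * 1 + k0 * b" using 2 k0 by (intro add_left_mono mult_left_mono) auto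
    finally have 3: "\<bar>y3 z\<bar> * s ^ 3 \<le> b3" by (simp add: b3_def)
    show ?thesis using 2 3 unfolding s_def by simp
  qed
  show ?thesis
  proof (rule C2L_compose_zc[where R = y and c = "b + b3", OF d1 y1c d2 d3])
    fix z :: real assume z: "0 \<le> z" "z < 1"
    note a = arccos_facts[OF z]
    have "\<bar>y2 z\<bar> * sqrt (1 - z) \<le> \<bar>y2 z\<bar> * sqrt (1 - z\<^sup>2)" using a by (intro mult_left_mono) auto
    then show "\<bar>y2 z\<bar> * sqrt (1 - z) \<le> b + b3" using est[OF z] b0 by linarith
    have "\<bar>y3 z\<bar> * sqrt (1 - z) ^ 3 \<le> \<bar>y3 z\<bar> * sqrt (1 - z\<^sup>2) ^ 3" using a z by (intro mult_left_mono power_mono) auto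
    then show "\<bar>y3 z\<bar> * sqrt (1 - z) ^ 3 \<le> b + b3" using est[OF z] b0 by linarith
  qed auto
qed

text \<open>The pressure contains the primitive of Y. Its z-derivative -Y / sin \<phi> is bounded
  since Y vanishes on the axis, and the second derivative is O(1/(1 - z)). The value -Y'(0) at z = 1
  has to be established from the definition of the derivative.\<close>

lemma Qz_C1L: "C1L (\<lambda>x. Qz (zc x))"
proof -
  obtain k where k: "k \<ge> 0" "\<forall>\<phi>\<in>{0..pi/2}. \<bar>Y1 \<phi>\<bar> \<le> k" by (rule bounded_on_interval[OF Y1c])
  have Yb: "\<bar>Y \<phi>\<bar> \<le> k * \<phi>" if "\<phi> \<in> {0..pi/2}" for \<phi>
    using derivative_power_bound[OF Y, of k 0] k Y0 that by simp
  define Q1 where "Q1 z = (if z = 1 then - Y1 0 else - Y (arccos z) / sqrt (1 - z\<^sup>2))" for z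
  define Q2 where "Q2 z = (Y1 (arccos z) - Y (arccos z) * z / sqrt (1 - z\<^sup>2)) / (1 - z\<^sup>2)" for z
  have Q2: "(Q1 has_real_derivative Q2 z) (at z within {0..1})" if z: "0 \<le> z" "z < 1" for z
  proof (rule has_field_derivative_transform_within)
    note a = arccos_facts[OF z]
    have s: "sqrt (1 - z\<^sup>2) * sqrt (1 - z\<^sup>2) = 1 - z\<^sup>2" using a(7) by (simp add: power2_eq_square)
    have t: "1 - z\<^sup>2 > 0" using a(4) by simp
    have ds: "((\<lambda>z. sqrt (1 - z\<^sup>2)) has_real_derivative - z / sqrt (1 - z\<^sup>2)) (at z within {0..1})"
      using t by (auto intro!: derivative_eq_intros simp: field_simps)
    have "((\<lambda>z. - Y (arccos z) / sqrt (1 - z\<^sup>2)) has_real_derivative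
        ((Y1 (arccos z) / sqrt (1 - z\<^sup>2)) * sqrt (1 - z\<^sup>2) - (- Y (arccos z)) * (- z / sqrt (1 - z\<^sup>2))) / (sqrt (1 - z\<^sup>2) * sqrt (1 - z\<^sup>2)))
        (at z within {0..1})"
      using DERIV_minus[OF compose_arccos_deriv[OF Y z]] a(4) by (intro DERIV_divide ds) auto
    then show "((\<lambda>z. - Y (arccos z) / sqrt (1 - z\<^sup>2)) has_real_derivative Q2 z) (at z within {0..1})"
      using a(4) unfolding Q2_def s by simp
    show "0 < 1 - z" using z by simp
    show "z \<in> {0..1}" using z by simp
  qed (use z in \<open>auto simp: Q1_def dist_real_def\<close>)
  have end1: "(Qz has_real_derivative - Y1 0) (at 1 within {0..1})"
    unfolding has_field_derivative_def has_derivative_within_alt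
  proof (intro conjI allI impI)
    show "bounded_linear ((*) (- Y1 0))" by (rule bounded_linear_mult_right)
    fix e :: real assume e: "e > 0"
    have "((\<lambda>\<phi>. Y \<phi> - Y1 0 * sin \<phi>) has_real_derivative 0) (at 0 within {0..pi/2})"
      using Y[of 0] by (auto intro!: derivative_eq_intros)
    \<comment> \<open>The fraction 1/8 is matched to \<phi>^2 / 8 \<le> 1 - cos \<phi>: an error of
      at most e \<phi> / 8 in the integrand contributes at most e (1 - cos \<phi>) to the
      primitive.\<close>
    then obtain \<delta> where \<delta>: "\<delta> > 0" "\<And>\<phi>. \<phi> \<in> {0..pi/2} \<Longrightarrow> \<bar>\<phi>\<bar> < \<delta> \<Longrightarrow> \<bar>Y \<phi> - Y1 0 * sin \<phi>\<bar> \<le> e / 8 * \<bar>\<phi>\<bar>"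
      using e unfolding has_field_derivative_def has_derivative_within_alt by (force simp: Y0 dest: spec[of _ "e / 8"])
    define \<eta> where "\<eta> = min (\<delta> / 2) (pi / 2)"
    have \<eta>: "0 < \<eta>" "\<eta> < \<delta>" "\<eta> \<le> pi / 2" using \<delta> by (auto simp: \<eta>_def)
    have D: "\<bar>Q \<phi> - Y1 0 * (1 - cos \<phi>)\<bar> \<le> e * (1 - cos \<phi>)" if p: "\<phi> \<in> {0..\<eta>}" for \<phi>
    proof -
      have "\<bar>Q \<phi> - Y1 0 * (1 - cos \<phi>)\<bar> \<le> e / 8 * \<phi> ^ Suc 1"
      proof (rule derivative_power_bound[where b = \<eta> and f' = "\<lambda>\<phi>. Y \<phi> - Y1 0 * sin \<phi>"])
        fix x assume x: "x \<in> {0..\<eta>}"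
        have "(Q has_real_derivative Y x) (at x within {0..\<eta>})" using x \<eta> by (intro DERIV_subset[OF Q_deriv]) auto
        then show "((\<lambda>\<phi>. Q \<phi> - Y1 0 * (1 - cos \<phi>)) has_real_derivative Y x - Y1 0 * sin x) (at x within {0..\<eta>})"
          by (auto intro!: derivative_eq_intros)
        show "\<bar>Y x - Y1 0 * sin x\<bar> \<le> e / 8 * x ^ 1" using \<delta>(2)[of x] x \<eta> by auto
      qed (use p e in \<open>auto simp: Q_def\<close>)
      also have "\<dots> \<le> e * (1 - cos \<phi>)"
      proof -
        have "\<phi> / 2 \<le> 2 * sin (\<phi> / 2)" using p \<eta> by (intro le_2_sin) auto
        then have "(\<phi> / 4) * (\<phi> / 4) \<le> sin (\<phi> / 2) * sin (\<phi> / 2)" using p by (intro mult_mono) auto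
        moreover have "cos \<phi> = 1 - 2 * (sin (\<phi> / 2) * sin (\<phi> / 2))"
          using cos_double_sin[of "\<phi> / 2"] by (simp add: power2_eq_square)
        ultimately have "\<phi> * \<phi> / 8 \<le> 1 - cos \<phi>" by simp
        then have "e * (\<phi> * \<phi> / 8) \<le> e * (1 - cos \<phi>)" using e by (intro mult_left_mono) auto
        then show ?thesis by simp
      qed
      finally show ?thesis .
    qed
    show "\<exists>d>0. \<forall>z\<in>{0..1}. norm (z - 1) < d \<longrightarrow> norm (Qz z - Qz 1 - - Y1 0 * (z - 1)) \<le> e * norm (z - 1)"
    proof (intro exI[of _ "1 - cos \<eta>"] conjI ballI impI)
      have "cos \<eta> < cos 0" using \<eta> pi_gt_zero by (intro cos_monotone_0_pi) auto
      then show "0 < 1 - cos \<eta>" by simp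
      fix z :: real assume z: "z \<in> {0..1}" "norm (z - 1) < 1 - cos \<eta>"
      have "cos \<eta> < z" using z by auto
      then have "arccos z < arccos (cos \<eta>)" using z by (intro arccos_less_arccos) auto
      then have "arccos z \<in> {0..\<eta>}" using \<eta> arccos_lbound[of z] z by (auto simp: arccos_cos)
      from D[OF this] show "norm (Qz z - Qz 1 - - Y1 0 * (z - 1)) \<le> e * norm (z - 1)"
        using z by (simp add: Qz_def Q_def algebra_simps)
    qed
  qed
  show ?thesis
  proof (rule C1L_compose_zc[where Q = Qz and ?Q1.0 = Q1 and ?Q2.0 = Q2 and c = "3 * k"])
    fix z :: real assume z: "z \<in> {0..1}"
    show "(Qz has_real_derivative Q1 z) (at z within {0..1})"
      using z_derivs(4)[of z] end1 z by (cases "z = 1") (auto simp: Q1_def)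
  next
    fix z :: real assume z: "0 \<le> z" "z < 1"
    note a = arccos_facts[OF z]
    have ac: "arccos z \<in> {0..pi/2}" using a(1) by auto
    have "\<bar>Y (arccos z)\<bar> \<le> k * arccos z" by (rule Yb[OF ac])
    also have "\<dots> \<le> k * (2 * sqrt (1 - z\<^sup>2))" using a(5) k by (intro mult_left_mono) auto
    finally have b: "\<bar>Y (arccos z)\<bar> / sqrt (1 - z\<^sup>2) \<le> 2 * k" using a(4) by (simp add: pos_divide_le_eq mult_ac)
    then show "\<bar>Q1 z\<bar> \<le> 3 * k" using z k a(4) by (simp add: Q1_def)
    have t: "0 < 1 - z\<^sup>2" "1 - z \<le> 1 - z\<^sup>2" using a(4) z by (auto simp: power2_eq_square mult_left_le)
    have n: "\<bar>Y1 (arccos z) - Y (arccos z) * z / sqrt (1 - z\<^sup>2)\<bar> \<le> 3 * k"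
    proof -
      have "\<bar>Y (arccos z) * z / sqrt (1 - z\<^sup>2)\<bar> = z * (\<bar>Y (arccos z)\<bar> / sqrt (1 - z\<^sup>2))"
        using z a(4) by (simp add: abs_mult)
      also have "\<dots> \<le> 1 * (2 * k)" using b z k a(4) by (intro mult_mono) auto
      finally show ?thesis using k ac by (force intro: order_trans[OF abs_triangle_ineq4])
    qed
    have "\<bar>Q2 z\<bar> * (1 - z) \<le> \<bar>Q2 z\<bar> * (1 - z\<^sup>2)" using t by (intro mult_left_mono) auto
    also have "\<dots> = \<bar>Y1 (arccos z) - Y (arccos z) * z / sqrt (1 - z\<^sup>2)\<bar>" using t by (simp add: Q2_def)
    also note n
    finally show "\<bar>Q2 z\<bar> * (1 - z) \<le> 3 * k" .
  qed (rule Q2)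
qed

text \<open>Incompressibility reads A = z B - (1 - z^2) B'; with B = -y and y' replaced from the
  Riccati equation this is \<open>profA\<close>. Likewise \<open>profP\<close> is what integrating
  the e_3 component of the momentum equation leaves for the pressure, with additive constant l
  C.\<close>

definition "profA l y z = l * ((1 - z\<^sup>2) * q z) - (1 - z\<^sup>2) * (y z)\<^sup>2 / 2 - z * y z"
definition "profP l y z = profA l y z - z * y z - (1 - z\<^sup>2) * (y z)\<^sup>2 / 2 + l * Qz z + l * C"
definition "vel l y x = inorm x *\<^sub>R (profA l y (zc x) *\<^sub>R nvec x - y (zc x) *\<^sub>R axis 3 1)"
definition "pres l y x = (inorm x)\<^sup>2 * profP l y (zc x)"

section \<open>Regularity, symmetry and equations of the constructed field\<close>

context
  fixes l :: real and y :: "real \<Rightarrow> real"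
  assumes y: "riccati_solution q l y"
begin

lemma profA_C2L: "C2L (\<lambda>x. profA l y (zc x))"
proof -
  have "C2L (\<lambda>x. l * ((1 - (zc x)\<^sup>2) * q (zc x)) + ((-1/2) * ((1 + (-1) * (zc x * zc x)) * (y (zc x) * y (zc x))) + (-1) * (zc x * y (zc x))))"
    by (intro C2L_add C2L_mult C2L_const r_C2L riccati_C2L[OF y] C2L_zc)
  then show ?thesis by (rule C2L_cong) (simp add: profA_def power2_eq_square field_simps)
qed

lemma vel_C2L: "C2L (\<lambda>x. vel l y x $ i)"
proof -
  have "C2L (\<lambda>x. inorm x * (profA l y (zc x) * (inorm x * x $ i) + (-1) * y (zc x) * (axis 3 1 $ i)))"
    by (intro C2L_add C2L_mult C2L_const profA_C2L riccati_C2L[OF y] C2L_inverse_norm C2L_nth)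
  then show ?thesis by (rule C2L_cong) (simp add: vel_def nvec_def)
qed

lemma pres_C1L: "C1L (\<lambda>x. pres l y x)"
proof -
  have "C1L (\<lambda>x. inorm x * inorm x * (profA l y (zc x) + ((-1) * (zc x * y (zc x))
     + ((-1/2) * ((1 + (-1) * (zc x * zc x)) * (y (zc x) * y (zc x))) + (l * Qz (zc x) + l * C)))))"
    by (intro C1L_add C1L_mult C1L_const C2L_imp_C1L[OF profA_C2L] C2L_imp_C1L[OF riccati_C2L[OF y]]
      C2L_imp_C1L[OF C2L_inverse_norm] C2L_imp_C1L[OF C2L_zc] Qz_C1L)
  then show ?thesis by (rule C1L_cong) (simp add: pres_def profP_def power2_eq_square field_simps)
qed

lemma vel_Holder:
  assumes "\<alpha> \<in> {0<..<1}"
  shows "C2_Holder_loc_on \<alpha> S3 (vel l y)" "C1_Holder_loc_on \<alpha> S3 (pres l y)" "C2_on S3 (vel l y)" "C1_on S3 (pres l y)"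
proof -
  obtain f' f'' where f: "has_continuous_derivative_on (vel l y) f' S3" "has_continuous_derivative_on f' f'' S3"
    "loc_lipschitz S3 f''" using C2L_imp_C2_Holder[of "vel l y"] vel_C2L by metis
  show "C2_Holder_loc_on \<alpha> S3 (vel l y)"
    unfolding C2_Holder_loc_on_def using f loc_lipschitz_imp_Holder[OF f(3) assms] by blast
  show "C2_on S3 (vel l y)" unfolding C2_on_def using f by blast
  show "C1_Holder_loc_on \<alpha> S3 (pres l y)" by (rule C1L_imp_C1_Holder[OF pres_C1L assms])
  then show "C1_on S3 (pres l y)" unfolding C1_Holder_loc_on_def C1_on_def by blast
qed

lemma vel_spherical:
  assumes "\<rho> > 0"
  shows "vel l y (spherical \<rho> \<phi> \<theta>) = ((profA l y (cos \<phi>) - y (cos \<phi>) * cos \<phi>) / \<rho>) *\<^sub>R e_rho \<phi> \<theta>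
     + (y (cos \<phi>) * sin \<phi> / \<rho>) *\<^sub>R e_phi \<phi> \<theta> + 0 *\<^sub>R e_theta \<theta>"
  unfolding vel_def spherical_facts[OF assms] e3_eq[of \<phi> \<theta>]
  by (simp add: algebra_simps divide_inverse)

lemma pres_spherical: "\<rho> > 0 \<Longrightarrow> pres l y (spherical \<rho> \<phi> \<theta>) = profP l y (cos \<phi>) / \<rho>\<^sup>2"
  unfolding pres_def by (simp add: spherical_facts power_inverse divide_inverse)

lemma zc_scale: "\<mu> > 0 \<Longrightarrow> zc (\<mu> *\<^sub>R x) = zc x" "\<mu> > 0 \<Longrightarrow> nvec (\<mu> *\<^sub>R x) = nvec x"
  by (auto simp: zc_def nvec_def)

text \<open>Derivatives of y are eliminated by the Riccati equation and X by \<open>E_q\<close>.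
  What remains are polynomial identities in z, y, q, q', q'', the primitive of Y and the quotient Y
  / sin \<phi>, which is treated as one symbol.\<close>

lemma profile_equations:
  assumes z: "0 < z" "z < 1"
  obtains A1 A2 P1 y1 y2 where
    "\<And>z. z \<in> {0<..<1} \<Longrightarrow> (profA l y has_real_derivative A1 z) (at z)"
    "\<And>z. z \<in> {0<..<1} \<Longrightarrow> (A1 has_real_derivative A2 z) (at z)"
    "\<And>z. z \<in> {0<..<1} \<Longrightarrow> (y has_real_derivative y1 z) (at z)"
    "\<And>z. z \<in> {0<..<1} \<Longrightarrow> (y1 has_real_derivative y2 z) (at z)"
    "\<And>z. z \<in> {0<..<1} \<Longrightarrow> (profP l y has_real_derivative P1 z) (at z)"
    "profA l y z + (1 - z\<^sup>2) * (- y1 z) - z * (- y z) = 0"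
    "- ((1 - z\<^sup>2) * A2 z - 4 * z * A1 z - 2 * profA l y z) - (profA l y z)\<^sup>2
        + (- y z) * ((1 - z\<^sup>2) * A1 z - 2 * z * profA l y z) - z * P1 z - 2 * profP l y z
       = l * (X (arccos z) + z * (Y (arccos z) / sqrt (1 - z\<^sup>2)))"
    "- 2 * A1 z - ((1 - z\<^sup>2) * (- y2 z) - 2 * z * (- y1 z)) + (- y z) * ((1 - z\<^sup>2) * (- y1 z) - z * (- y z)) + P1 z
       = - l * (Y (arccos z) / sqrt (1 - z\<^sup>2))"
proof -
  have at: "at w within {0..1} = at w" if "w \<in> {0<..<1}" for w :: real using that by (intro at_within_interior) auto
  define y1 where "y1 z = l * q z - (y z)\<^sup>2 / 2" for z
  define y2 where "y2 z = l * q1 z - y z * y1 z" for z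
  define A1 where "A1 z = l * (- 2 * z * q z + (1 - z\<^sup>2) * q1 z) + z * (y z)\<^sup>2 - (1 - z\<^sup>2) * y z * y1 z - y z - z * y1 z" for z
  define A2 where "A2 z = l * (- 2 * q z - 4 * z * q1 z + (1 - z\<^sup>2) * q2 z) + (y z)\<^sup>2 + 4 * z * y z * y1 z
     - (1 - z\<^sup>2) * ((y1 z)\<^sup>2 + y z * y2 z) - 2 * y1 z - z * y2 z" for z
  define P1 where "P1 z = A1 z - y z - z * y1 z + z * (y z)\<^sup>2 - (1 - z\<^sup>2) * y z * y1 z - l * (Y (arccos z) / sqrt (1 - z\<^sup>2))" for z
  have qd: "(q has_real_derivative q1 w) (at w)" "(q1 has_real_derivative q2 w) (at w)"
     "(Qz has_real_derivative - Y (arccos w) / sqrt (1 - w\<^sup>2)) (at w)" if "w \<in> {0<..<1}" for w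
    using q_derivs[of w] z_derivs(4)[of w] at[OF that] that by auto
  have d1: "(y has_real_derivative y1 w) (at w)" if "w \<in> {0<..<1}" for w
    using y that at[OF that] by (auto simp: riccati_solution_def y1_def) (metis atLeastAtMost_iff less_imp_le)
  have d2: "(y1 has_real_derivative y2 w) (at w)" if "w \<in> {0<..<1}" for w
    unfolding y1_def[abs_def] y2_def using qd[OF that] d1[OF that]
    by (auto intro!: derivative_eq_intros simp: y1_def)
  have dA: "(profA l y has_real_derivative A1 w) (at w)" if "w \<in> {0<..<1}" for w
    unfolding profA_def[abs_def] A1_def using qd[OF that] d1[OF that]
    by (auto intro!: derivative_eq_intros simp: field_simps power2_eq_square)
  have dA1: "(A1 has_real_derivative A2 w) (at w)" if "w \<in> {0<..<1}" for w
    unfolding A1_def[abs_def] A2_def using qd[OF that] d1[OF that] d2[OF that]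
    by (auto intro!: derivative_eq_intros simp: algebra_simps power2_eq_square)
  have dP: "(profP l y has_real_derivative P1 w) (at w)" if "w \<in> {0<..<1}" for w
    unfolding profP_def[abs_def] P1_def using qd[OF that] d1[OF that] dA[OF that]
    by (auto intro!: derivative_eq_intros simp: field_simps power2_eq_square)
  have K: "X (arccos z) = - ((1 - z\<^sup>2)\<^sup>2 * q2 z - 8 * z * (1 - z\<^sup>2) * q1 z + (8 * z\<^sup>2 - 4 * (1 - z\<^sup>2)) * q z) - 2 * Qz z - 2 * C"
    using E_q(2)[OF z] by (simp add: Kz_def K_eq Qz_def)
  define Ys where "Ys = Y (arccos z) / sqrt (1 - z\<^sup>2)"
  have 1: "profA l y z + (1 - z\<^sup>2) * (- y1 z) - z * (- y z) = 0"
    unfolding profA_def y1_def by (simp add: algebra_simps)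
  have 3: "- 2 * A1 z - ((1 - z\<^sup>2) * (- y2 z) - 2 * z * (- y1 z)) + (- y z) * ((1 - z\<^sup>2) * (- y1 z) - z * (- y z)) + P1 z
       = - l * Ys"
    unfolding P1_def A1_def y2_def y1_def Ys_def[symmetric] by (simp add: field_simps power2_eq_square)
  have 2: "- ((1 - z\<^sup>2) * A2 z - 4 * z * A1 z - 2 * profA l y z) - (profA l y z)\<^sup>2
        + (- y z) * ((1 - z\<^sup>2) * A1 z - 2 * z * profA l y z) - z * P1 z - 2 * profP l y z
       = l * (X (arccos z) + z * Ys)"
    unfolding K P1_def profP_def A2_def A1_def profA_def y2_def y1_def Ys_def[symmetric]
    by (simp add: field_simps power2_eq_square)
  show ?thesis by (rule that[OF dA dA1 d1 d2 dP 1 2[unfolded Ys_def] 3[unfolded Ys_def]])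
qed

lemma vel_solution:
  fixes F :: "real^3 \<Rightarrow> real^3"
  assumes F: "\<And>\<rho> \<phi> \<theta>. \<rho> > 0 \<Longrightarrow> \<phi> \<in> {0..pi/2} \<Longrightarrow>
      F (spherical \<rho> \<phi> \<theta>) = (1 / \<rho>^3) *\<^sub>R (X \<phi> *\<^sub>R e_rho \<phi> \<theta> + Y \<phi> *\<^sub>R e_phi \<phi> \<theta>)"
    and FC: "C1_on S3 F"
  shows "axisymmetric_self_similar_solution F l (vel l y) (pres l y)"
proof -
  have C: "C2_on S3 (vel l y)" "C1_on S3 (pres l y)" using vel_Holder[of "1/2"] by auto
  have off: "- laplacian (vel l y) x + advection (vel l y) (vel l y) x + grad (pres l y) x = l *\<^sub>R F x
      \<and> divergence (vel l y) x = 0" if x: "x \<in> off_axis" for x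
  proof -
    define z where "z = zc x"
    have z: "0 < z" "z < 1" using off_axis_facts(4)[OF x] by (auto simp: z_def)
    obtain A1 A2 P1 y1 y2 where D:
      "\<And>z. z \<in> {0<..<1} \<Longrightarrow> (profA l y has_real_derivative A1 z) (at z)"
      "\<And>z. z \<in> {0<..<1} \<Longrightarrow> (A1 has_real_derivative A2 z) (at z)"
      "\<And>z. z \<in> {0<..<1} \<Longrightarrow> (y has_real_derivative y1 z) (at z)"
      "\<And>z. z \<in> {0<..<1} \<Longrightarrow> (y1 has_real_derivative y2 z) (at z)"
      "\<And>z. z \<in> {0<..<1} \<Longrightarrow> (profP l y has_real_derivative P1 z) (at z)"
      and E: "profA l y z + (1 - z\<^sup>2) * (- y1 z) - z * (- y z) = 0"
      "- ((1 - z\<^sup>2) * A2 z - 4 * z * A1 z - 2 * profA l y z) - (profA l y z)\<^sup>2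
        + (- y z) * ((1 - z\<^sup>2) * A1 z - 2 * z * profA l y z) - z * P1 z - 2 * profP l y z
       = l * (X (arccos z) + z * (Y (arccos z) / sqrt (1 - z\<^sup>2)))"
      "- 2 * A1 z - ((1 - z\<^sup>2) * (- y2 z) - 2 * z * (- y1 z)) + (- y z) * ((1 - z\<^sup>2) * (- y1 z) - z * (- y z)) + P1 z
       = - l * (Y (arccos z) / sqrt (1 - z\<^sup>2))"
      using profile_equations[OF z] by metis
    note op = NS_operators[OF open_off_axis zero_0_off_axis, where A = "profA l y" and ?A1.0 = A1 and ?A2.0 = A2
      and B = "\<lambda>z. - y z" and ?B1.0 = "\<lambda>z. - y1 z" and ?B2.0 = "\<lambda>z. - y2 z" and H = "\<lambda>_. 0" and ?H1.0 = "\<lambda>_. 0" and ?H2.0 = "\<lambda>_. 0"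
      and P = "profP l y" and ?P1.0 = P1 and T = "{0<..<1}" and u = "vel l y" and p = "pres l y" and x = x and z = z]
    have "divergence (vel l y) x = (inorm x)\<^sup>2 * (profA l y z + (1 - z\<^sup>2) * (- y1 z) - z * (- y z))"
      by (rule op(1)) (use D x off_axis_facts(4) in \<open>auto intro: DERIV_minus simp: vel_def pres_def z_def\<close>)
    then have div: "divergence (vel l y) x = 0" unfolding E by simp
    have "- laplacian (vel l y) x + advection (vel l y) (vel l y) x + grad (pres l y) x = (inorm x) ^ 3 *\<^sub>R
       ((- ((1 - z\<^sup>2) * A2 z - 4 * z * A1 z - 2 * profA l y z) - (profA l y z)\<^sup>2 + (- y z) * ((1 - z\<^sup>2) * A1 z - 2 * z * profA l y z)
          - 0\<^sup>2 - z * P1 z - 2 * profP l y z) *\<^sub>R nvec x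
      + (- 2 * A1 z - ((1 - z\<^sup>2) * (- y2 z) - 2 * z * (- y1 z)) + (- y z) * ((1 - z\<^sup>2) * (- y1 z) - z * (- y z))
          + z * 0\<^sup>2 + P1 z) *\<^sub>R axis 3 1
      + (- ((1 - z\<^sup>2) * 0 - 4 * z * 0 - 2 * 0) + (- y z) * ((1 - z\<^sup>2) * 0 - 2 * z * 0))
          *\<^sub>R vector [- nvec x $ 2, nvec x $ 1, 0])"
      by (rule op(2)) (use D x off_axis_facts(4) in \<open>auto intro: DERIV_minus simp: vel_def pres_def z_def\<close>)
    also have "\<dots> = (inorm x) ^ 3 *\<^sub>R ((l * (X (arccos z) + z * (Y (arccos z) / sqrt (1 - z\<^sup>2)))) *\<^sub>R nvec x
       + (- l * (Y (arccos z) / sqrt (1 - z\<^sup>2))) *\<^sub>R axis 3 1)"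
      unfolding E(2,3)[symmetric] by simp
    finally have NS: "- laplacian (vel l y) x + advection (vel l y) (vel l y) x + grad (pres l y) x
       = (inorm x) ^ 3 *\<^sub>R ((l * (X (arccos z) + z * (Y (arccos z) / sqrt (1 - z\<^sup>2)))) *\<^sub>R nvec x
       + (- l * (Y (arccos z) / sqrt (1 - z\<^sup>2))) *\<^sub>R axis 3 1)" .
    have Fx: "F x = (inorm x) ^ 3 *\<^sub>R ((X (arccos z) + z * (Y (arccos z) / sqrt (1 - z\<^sup>2))) *\<^sub>R nvec x
        - (Y (arccos z) / sqrt (1 - z\<^sup>2)) *\<^sub>R axis 3 1)"
      using force_cartesian[OF F off_axis_facts(2)[OF x] z(2)[unfolded z_def] z_def refl] by blast
    note NS
    also have "(inorm x) ^ 3 *\<^sub>R ((l * (X (arccos z) + z * (Y (arccos z) / sqrt (1 - z\<^sup>2)))) *\<^sub>R nvec x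
       + (- l * (Y (arccos z) / sqrt (1 - z\<^sup>2))) *\<^sub>R axis 3 1) = l *\<^sub>R F x"
      unfolding Fx by (simp add: algebra_simps)
    finally show ?thesis using div by simp
  qed
  have bdry: "vel l y x = 0" if x: "x \<in> punctured_boundary" for x
  proof -
    have "frontier half_space = {x. x $ 3 = 0}"
      unfolding frontier_def closure_half_space interior_open[OF open_half_space] by (auto simp: half_space_def)
    then have "zc x = 0" using x by (auto simp: punctured_boundary_def zc_def)
    \<comment> \<open>No slip of the radial component rests on N(\<pi>/2) = 0, that is, on the
      choice of C.\<close>
    moreover have "q 0 = 0" using q_N[of 0] by (simp add: Nz_def force_N_pi2)
    moreover have "y 0 = 0" using y by (simp add: riccati_solution_def)
    ultimately show ?thesis by (simp add: vel_def profA_def)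
  qed
  show ?thesis
    unfolding axisymmetric_self_similar_solution_def solves_NS_def
  proof (intro conjI ballI allI impI)
    show "axisymmetric_vector (vel l y)" unfolding axisymmetric_vector_def
      by (rule exI[of _ "\<lambda>\<rho> \<phi>. (profA l y (cos \<phi>) - y (cos \<phi>) * cos \<phi>) / \<rho>"],
          rule exI[of _ "\<lambda>\<rho> \<phi>. y (cos \<phi>) * sin \<phi> / \<rho>"], rule exI[of _ "\<lambda>_ _. 0"]) (auto simp only: vel_spherical)
    show "axisymmetric_scalar (pres l y)" unfolding axisymmetric_scalar_def
      by (rule exI[of _ "\<lambda>\<rho> \<phi>. profP l y (cos \<phi>) / \<rho>\<^sup>2"]) (auto simp: pres_spherical)
    fix x assume "x \<in> half_space"
    from NS_from_off_axis[OF C FC _ _ this] off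
    show "- laplacian (vel l y) x + advection (vel l y) (vel l y) x + grad (pres l y) x = l *\<^sub>R F x"
      "divergence (vel l y) x = 0" by blast+
  next
    fix \<mu> :: real and x :: "real^3" assume "\<mu> > 0"
    then show "vel l y (\<mu> *\<^sub>R x) = (1 / \<mu>) *\<^sub>R vel l y x" "pres l y (\<mu> *\<^sub>R x) = 1 / \<mu>\<^sup>2 * pres l y x"
      by (simp_all add: vel_def pres_def zc_scale divide_inverse power_mult_distrib power_inverse)
  qed (use C bdry in auto)
qed

end

end

section \<open>Necessity\<close>

definition meridian :: "real \<Rightarrow> real^3" where "meridian \<phi> = e_rho \<phi> 0"

lemma meridian_spherical: "meridian \<phi> = spherical 1 \<phi> 0" by (simp add: meridian_def spherical_def)

lemma meridian_S3: "\<phi> \<in> {0..pi/2} \<Longrightarrow> meridian \<phi> \<in> S3"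
  unfolding meridian_spherical by (rule spherical_in_S3) auto

lemma has_vector_derivative_vecI:
  fixes f :: "real \<Rightarrow> real^'n"
  assumes "\<And>j. ((\<lambda>x. f x $ j) has_real_derivative f' $ j) (at x within S)"
  shows "(f has_vector_derivative f') (at x within S)"
  unfolding has_vector_derivative_def
  by (rule has_derivative_vecI) (use assms in \<open>simp add: has_field_derivative_def mult.commute[of _ "f' $ _"]\<close>)

lemma meridian_derivative:
  "(meridian has_vector_derivative e_phi \<phi> 0) (at \<phi> within S)"
  "((\<lambda>\<phi>. e_phi \<phi> 0) has_vector_derivative - meridian \<phi>) (at \<phi> within S)"
proof -
  have "((\<lambda>\<phi>. meridian \<phi> $ j) has_real_derivative e_phi \<phi> 0 $ j) (at \<phi> within S)" for j
    using exhaust_3[of j] unfolding meridian_def e_rho_def e_phi_vec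
    by (auto intro!: derivative_eq_intros)
  then show "(meridian has_vector_derivative e_phi \<phi> 0) (at \<phi> within S)"
    by (rule has_vector_derivative_vecI)
  have "((\<lambda>\<phi>. e_phi \<phi> 0 $ j) has_real_derivative (- meridian \<phi>) $ j) (at \<phi> within S)" for j
    using exhaust_3[of j] unfolding meridian_def e_rho_def e_phi_vec
    by (auto intro!: derivative_eq_intros)
  then show "((\<lambda>\<phi>. e_phi \<phi> 0) has_vector_derivative - meridian \<phi>) (at \<phi> within S)"
    by (rule has_vector_derivative_vecI)
qed

lemma along_meridian:
  assumes w: "has_continuous_derivative_on w w' S3" and p: "\<phi> \<in> {0..pi/2}"
  shows "((\<lambda>\<phi>. w (meridian \<phi>)) has_vector_derivative w' (meridian \<phi>) (e_phi \<phi> 0)) (at \<phi> within {0..pi/2})"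
proof -
  have 1: "(w has_derivative blinfun_apply (w' (meridian \<phi>))) (at (meridian \<phi>) within meridian ` {0..pi/2})"
  proof (rule has_derivative_subset)
    show "(w has_derivative blinfun_apply (w' (meridian \<phi>))) (at (meridian \<phi>) within S3)"
      using w meridian_S3[OF p] unfolding has_continuous_derivative_on_def by blast
    show "meridian ` {0..pi/2} \<subseteq> S3" using meridian_S3 by blast
  qed
  from has_derivative_in_compose[OF meridian_derivative(1)[unfolded has_vector_derivative_def] 1]
  show ?thesis unfolding has_vector_derivative_def by (simp add: blinfun.scaleR_right)
qed

lemma meridian_continuous: "continuous_on S meridian" "continuous_on S (\<lambda>\<phi>. e_phi \<phi> 0)"
  unfolding continuous_on_eq_continuous_within
  by (intro ballI has_vector_derivative_continuous[OF meridian_derivative(1)] has_vector_derivative_continuous[OF meridian_derivative(2)])+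

lemma along_meridian_continuous:
  assumes w: "has_continuous_derivative_on w w' S3"
  shows "continuous_on {0..pi/2} (\<lambda>\<phi>. w' (meridian \<phi>) (e_phi \<phi> 0))"
proof -
  have "continuous_on S3 w'" using w by (simp add: has_continuous_derivative_on_def)
  then have "continuous_on {0..pi/2} (\<lambda>\<phi>. w' (meridian \<phi>))"
    by (rule continuous_on_compose2[OF _ meridian_continuous(1)]) (use meridian_S3 in auto)
  then show ?thesis by (intro continuous_intros meridian_continuous)
qed

lemma has_vector_derivative_nth:
  "(f has_vector_derivative f') (at x within S) \<Longrightarrow> ((\<lambda>x. f x $ j) has_real_derivative f' $ j) (at x within S)"
  using bounded_linear.has_vector_derivative[OF bounded_linear_vec_nth]
  by (simp add: has_real_derivative_iff_has_vector_derivative)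

lemma C1_along_meridian:
  fixes w :: "real^3 \<Rightarrow> real^3"
  assumes "C1_on S3 w"
  obtains d where "\<And>\<phi> j. \<phi> \<in> {0..pi/2} \<Longrightarrow> ((\<lambda>\<phi>. w (meridian \<phi>) $ j) has_real_derivative d \<phi> $ j) (at \<phi> within {0..pi/2})"
    "continuous_on {0..pi/2} d"
proof -
  obtain w' where w: "has_continuous_derivative_on w w' S3" using assms unfolding C1_on_def by blast
  show ?thesis
    by (rule that[of "\<lambda>\<phi>. w' (meridian \<phi>) (e_phi \<phi> 0)"])
      (auto intro: has_vector_derivative_nth along_meridian[OF w] along_meridian_continuous[OF w] simp del: atLeastAtMost_iff)
qed

lemma C2_along_meridian:
  fixes w :: "real^3 \<Rightarrow> real^3"
  assumes "C2_on S3 w"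
  obtains d d2 where "\<And>\<phi> j. \<phi> \<in> {0..pi/2} \<Longrightarrow> ((\<lambda>\<phi>. w (meridian \<phi>) $ j) has_real_derivative d \<phi> $ j) (at \<phi> within {0..pi/2})"
    "\<And>\<phi> j. \<phi> \<in> {0..pi/2} \<Longrightarrow> ((\<lambda>\<phi>. d \<phi> $ j) has_real_derivative d2 \<phi> $ j) (at \<phi> within {0..pi/2})"
proof -
  obtain w' w'' where w: "has_continuous_derivative_on w w' S3" "has_continuous_derivative_on w' w'' S3"
    using assms unfolding C2_on_def by blast
  have 2: "((\<lambda>\<phi>. w' (meridian \<phi>) (e_phi \<phi> 0)) has_vector_derivative
      w' (meridian \<phi>) (- meridian \<phi>) + w'' (meridian \<phi>) (e_phi \<phi> 0) (e_phi \<phi> 0)) (at \<phi> within {0..pi/2})"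
    if "\<phi> \<in> {0..pi/2}" for \<phi>
    by (rule bounded_bilinear.has_vector_derivative[OF bounded_bilinear_blinfun_apply
        along_meridian[OF w(2) that] meridian_derivative(2)])
  show ?thesis
    by (rule that[OF has_vector_derivative_nth[OF along_meridian[OF w(1)]] has_vector_derivative_nth[OF 2]])
qed

text \<open>The derivatives are existential. Closure under sums and products then yields the
  Cartesian profiles of a C^2 field without computing their first and second derivatives.\<close>

definition twice_diff :: "(real \<Rightarrow> real) \<Rightarrow> bool" where
  "twice_diff R \<longleftrightarrow> (\<exists>R1 R2. \<forall>z\<in>{0<..<1}. (R has_real_derivative R1 z) (at z) \<and> (R1 has_real_derivative R2 z) (at z))"

lemma twice_diffI:
  assumes "\<And>z. z \<in> {0<..<1} \<Longrightarrow> (R has_real_derivative R1 z) (at z)"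
    "\<And>z. z \<in> {0<..<1} \<Longrightarrow> (R1 has_real_derivative R2 z) (at z)"
  shows "twice_diff R"
  using assms unfolding twice_diff_def by blast

lemma twice_diff_const: "twice_diff (\<lambda>_. c)" and twice_diff_id: "twice_diff (\<lambda>z. z)"
  by (rule twice_diffI[of _ "\<lambda>_. 0" "\<lambda>_. 0"], auto)
     (rule twice_diffI[of _ "\<lambda>_. 1" "\<lambda>_. 0"], auto)

lemma twice_diff_add: assumes "twice_diff f" "twice_diff g" shows "twice_diff (\<lambda>z. f z + g z)"
proof -
  obtain f1 f2 where f: "\<forall>z\<in>{0<..<1}. (f has_real_derivative f1 z) (at z) \<and> (f1 has_real_derivative f2 z) (at z)"
    using assms(1) unfolding twice_diff_def by blast
  obtain g1 g2 where g: "\<forall>z\<in>{0<..<1}. (g has_real_derivative g1 z) (at z) \<and> (g1 has_real_derivative g2 z) (at z)"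
    using assms(2) unfolding twice_diff_def by blast
  show ?thesis
    by (rule twice_diffI[of _ "\<lambda>z. f1 z + g1 z" "\<lambda>z. f2 z + g2 z"]) (use f g in \<open>auto intro!: DERIV_add\<close>)
qed

lemma twice_diff_mult: assumes "twice_diff f" "twice_diff g" shows "twice_diff (\<lambda>z. f z * g z)"
proof -
  obtain f1 f2 where f: "\<forall>z\<in>{0<..<1}. (f has_real_derivative f1 z) (at z) \<and> (f1 has_real_derivative f2 z) (at z)"
    using assms(1) unfolding twice_diff_def by blast
  obtain g1 g2 where g: "\<forall>z\<in>{0<..<1}. (g has_real_derivative g1 z) (at z) \<and> (g1 has_real_derivative g2 z) (at z)"
    using assms(2) unfolding twice_diff_def by blast
  show ?thesis
  proof (rule twice_diffI[of _ "\<lambda>z. f1 z * g z + f z * g1 z" "\<lambda>z. f2 z * g z + 2 * f1 z * g1 z + f z * g2 z"])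
    fix z :: real assume z: "z \<in> {0<..<1}"
    have d: "(f has_real_derivative f1 z) (at z)" "(f1 has_real_derivative f2 z) (at z)"
      "(g has_real_derivative g1 z) (at z)" "(g1 has_real_derivative g2 z) (at z)" using f g z by auto
    show "((\<lambda>z. f z * g z) has_real_derivative f1 z * g z + f z * g1 z) (at z)"
      using DERIV_mult[OF d(1,3)] by (simp add: algebra_simps)
    show "((\<lambda>z. f1 z * g z + f z * g1 z) has_real_derivative f2 z * g z + 2 * f1 z * g1 z + f z * g2 z) (at z)"
      using DERIV_add[OF DERIV_mult[OF d(2,3)] DERIV_mult[OF d(1,4)]]
      by (simp add: algebra_simps)
  qed
qed

lemma at_unit: "z \<in> {0<..<1} \<Longrightarrow> at (z::real) within {0..1} = at z"
  by (intro at_within_interior) auto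

lemma inverse_sin_deriv:
  fixes z :: real assumes "z \<in> {0<..<1}"
  shows "((\<lambda>z. inverse (sqrt (1 - z\<^sup>2))) has_real_derivative z * inverse (sqrt (1 - z\<^sup>2)) ^ 3) (at z)"
proof -
  have t: "1 - z\<^sup>2 > 0" using arccos_facts(4)[of z] assms by simp
  have "((\<lambda>z. sqrt (1 - z\<^sup>2)) has_real_derivative - z * inverse (sqrt (1 - z\<^sup>2))) (at z)"
    using t by (auto intro!: derivative_eq_intros simp: field_simps)
  from DERIV_inverse'[OF this] t show ?thesis
    by (simp add: power3_eq_cube mult_ac)
qed

lemma twice_diff_inverse_sin: "twice_diff (\<lambda>z. inverse (sqrt (1 - z\<^sup>2)))"
proof (rule twice_diffI[OF inverse_sin_deriv])
  fix z :: real assume z: "z \<in> {0<..<1}"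
  let ?i = "inverse (sqrt (1 - z\<^sup>2))"
  show "((\<lambda>z. z * inverse (sqrt (1 - z\<^sup>2)) ^ 3) has_real_derivative ?i ^ 3 + z * (3 * ?i ^ 2 * (z * ?i ^ 3))) (at z)"
    by (rule derivative_eq_intros inverse_sin_deriv[OF z] refl | simp)+
qed

lemma twice_diff_arccos:
  assumes f: "\<And>\<phi>. \<phi> \<in> {0..pi/2} \<Longrightarrow> (f has_real_derivative f' \<phi>) (at \<phi> within {0..pi/2})"
    "\<And>\<phi>. \<phi> \<in> {0..pi/2} \<Longrightarrow> (f' has_real_derivative f'' \<phi>) (at \<phi> within {0..pi/2})"
  shows "twice_diff (\<lambda>z. f (arccos z))"
proof (rule twice_diffI)
  fix z :: real assume z: "z \<in> {0<..<1}"
  then have z': "0 \<le> z" "z < 1" by auto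
  show "((\<lambda>z. f (arccos z)) has_real_derivative - f' (arccos z) * inverse (sqrt (1 - z\<^sup>2))) (at z)"
    using compose_arccos_deriv[OF f(1) z', unfolded at_unit[OF z] divide_inverse] .
  have "((\<lambda>z. f' (arccos z)) has_real_derivative - f'' (arccos z) * inverse (sqrt (1 - z\<^sup>2))) (at z)"
    using compose_arccos_deriv[OF f(2) z', unfolded at_unit[OF z] divide_inverse] .
  from DERIV_mult[OF DERIV_minus[OF this] inverse_sin_deriv[OF z]]
  show "((\<lambda>z. - f' (arccos z) * inverse (sqrt (1 - z\<^sup>2))) has_real_derivative
     - (- f'' (arccos z) * inverse (sqrt (1 - z\<^sup>2))) * inverse (sqrt (1 - z\<^sup>2)) + z * inverse (sqrt (1 - z\<^sup>2)) ^ 3 * - f' (arccos z)) (at z)" .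
qed

text \<open>L^2 e^(-2 M z) is nonincreasing and L^2 e^(2 M z) nondecreasing, so a zero of L
  propagates to the right and to the left. The bound on B takes the place of a primitive of
  B.\<close>

lemma bounded_linear_ode_zero:
  fixes L B :: "real \<Rightarrow> real"
  assumes L: "\<And>z. z \<in> {0<..<1} \<Longrightarrow> (L has_real_derivative B z * L z) (at z)"
    and M: "\<And>z. z \<in> {0<..<1} \<Longrightarrow> \<bar>B z\<bar> \<le> M" and z0: "z0 \<in> {0<..<1}" "L z0 = 0" and z: "z \<in> {0<..<1}"
  shows "L z = 0"
proof -
  have d: "((\<lambda>z. (L z)\<^sup>2 * exp (k * z)) has_real_derivative (2 * B w + k) * (L w)\<^sup>2 * exp (k * w)) (at w)"
    if "w \<in> {0<..<1}" for w k
    by (rule derivative_eq_intros L[OF that] refl | simp add: algebra_simps power2_eq_square)+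
  have "(L z)\<^sup>2 \<le> 0"
  proof (cases "z0 \<le> z")
    case True
    have "(L z)\<^sup>2 * exp (- 2 * M * z) \<le> (L z0)\<^sup>2 * exp (- 2 * M * z0)"
    proof (rule DERIV_nonpos_imp_nonincreasing[OF True])
      fix w assume "z0 \<le> w" "w \<le> z"
      then have w: "w \<in> {0<..<1}" using z z0 by auto
      have "2 * B w + - 2 * M \<le> 0" using M[OF w] by auto
      then have "(2 * B w + - 2 * M) * (L w)\<^sup>2 * exp (- 2 * M * w) \<le> 0"
        by (intro mult_nonpos_nonneg) auto
      then show "\<exists>y. ((\<lambda>z. (L z)\<^sup>2 * exp (- 2 * M * z)) has_real_derivative y) (at w) \<and> y \<le> 0"
        using d[OF w, of "- 2 * M"] by blast
    qed
    then show ?thesis using z0 by (simp add: mult_le_0_iff)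
  next
    case False
    then have le: "z \<le> z0" by simp
    have "(L z)\<^sup>2 * exp (2 * M * z) \<le> (L z0)\<^sup>2 * exp (2 * M * z0)"
    proof (rule DERIV_nonneg_imp_nondecreasing[OF le])
      fix w assume "z \<le> w" "w \<le> z0"
      then have w: "w \<in> {0<..<1}" using z z0 by auto
      have "2 * B w + 2 * M \<ge> 0" using M[OF w] by auto
      then have "(2 * B w + 2 * M) * (L w)\<^sup>2 * exp (2 * M * w) \<ge> 0"
        by (intro mult_nonneg_nonneg) auto
      then show "\<exists>y. ((\<lambda>z. (L z)\<^sup>2 * exp (2 * M * z)) has_real_derivative y) (at w) \<and> y \<ge> 0"
        using d[OF w, of "2 * M"] by blast
    qed
    then show ?thesis using z0 by (simp add: mult_le_0_iff)
  qed
  then show ?thesis by simp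
qed

lemma isconst_unit:
  fixes f :: "real \<Rightarrow> real"
  assumes "continuous_on {0..1} f" "\<And>z. z \<in> {0<..<1} \<Longrightarrow> (f has_real_derivative 0) (at z)" "z \<in> {0..1}"
  shows "f z = f 1"
proof -
  have c: "f x = f 0" if "x \<in> {0..1}" for x
    by (rule DERIV_isconst2[of 0 1 f x]) (use assms that in auto)
  have "f 1 = f 0" by (rule c) simp
  with c[OF assms(3)] show ?thesis by simp
qed

section \<open>Reduction of the profile equations to the Riccati equation\<close>

context angular_force
begin

text \<open>The Cartesian profiles are differentiable inside (0,1), while control at the ends comes
  from f, g, h and the angular derivatives. The second and third integrals are therefore rewritten
  in forms continuous on [0,1] and evaluated at z = 1. The pressure constant is left over from the
  first one and is determined at z = 0.\<close>

lemma profile_riccati: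
  fixes f g h f' g' h' P :: "real \<Rightarrow> real"
  assumes f: "\<And>\<phi>. \<phi> \<in> {0..pi/2} \<Longrightarrow> (f has_real_derivative f' \<phi>) (at \<phi> within {0..pi/2})"
    and g: "\<And>\<phi>. \<phi> \<in> {0..pi/2} \<Longrightarrow> (g has_real_derivative g' \<phi>) (at \<phi> within {0..pi/2})"
    and h: "\<And>\<phi>. \<phi> \<in> {0..pi/2} \<Longrightarrow> (h has_real_derivative h' \<phi>) (at \<phi> within {0..pi/2})"
    and cont: "continuous_on {0..pi/2} f'" "continuous_on {0..pi/2} g'"
    and g0: "g 0 = 0" and pi2: "f (pi/2) = 0" "g (pi/2) = 0" "h (pi/2) = 0"
    and A: "\<And>z. z \<in> {0<..<1} \<Longrightarrow> (A has_real_derivative A1 z) (at z)" "\<And>z. z \<in> {0<..<1} \<Longrightarrow> (A1 has_real_derivative A2 z) (at z)"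
    and B: "\<And>z. z \<in> {0<..<1} \<Longrightarrow> (B has_real_derivative B1 z) (at z)" "\<And>z. z \<in> {0<..<1} \<Longrightarrow> (B1 has_real_derivative B2 z) (at z)"
    and H: "\<And>z. z \<in> {0<..<1} \<Longrightarrow> (H has_real_derivative H1 z) (at z)" "\<And>z. z \<in> {0<..<1} \<Longrightarrow> (H1 has_real_derivative H2 z) (at z)"
    and Pd: "\<And>z. z \<in> {0<..<1} \<Longrightarrow> (P has_real_derivative P1 z) (at z)"
    and A_eq: "\<And>z. z \<in> {0<..<1} \<Longrightarrow> A z = f (arccos z) + z * (g (arccos z) * inverse (sqrt (1 - z\<^sup>2)))"
    and B_eq: "\<And>z. z \<in> {0<..<1} \<Longrightarrow> B z = - (g (arccos z) * inverse (sqrt (1 - z\<^sup>2)))"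
    and H_eq: "\<And>z. z \<in> {0<..<1} \<Longrightarrow> H z = h (arccos z) * inverse (sqrt (1 - z\<^sup>2))"
    and div: "\<And>z. z \<in> {0<..<1} \<Longrightarrow> A z + (1 - z\<^sup>2) * B1 z - z * B z = 0"
    and eR: "\<And>z. z \<in> {0<..<1} \<Longrightarrow> - ((1 - z\<^sup>2) * A2 z - 4 * z * A1 z - 2 * A z) - (A z)\<^sup>2 + B z * ((1 - z\<^sup>2) * A1 z - 2 * z * A z)
          - (H z)\<^sup>2 - z * P1 z - 2 * P z = l * (X (arccos z) + z * (Y (arccos z) / sqrt (1 - z\<^sup>2)))"
    and eE: "\<And>z. z \<in> {0<..<1} \<Longrightarrow> - 2 * A1 z - ((1 - z\<^sup>2) * B2 z - 2 * z * B1 z) + B z * ((1 - z\<^sup>2) * B1 z - z * B z)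
          + z * (H z)\<^sup>2 + P1 z = - l * (Y (arccos z) / sqrt (1 - z\<^sup>2))"
    and eK: "\<And>z. z \<in> {0<..<1} \<Longrightarrow> - ((1 - z\<^sup>2) * H2 z - 4 * z * H1 z - 2 * H z) + B z * ((1 - z\<^sup>2) * H1 z - 2 * z * H z) = 0"
  shows "riccati_solvable q l"
    "\<And>ys z. riccati_solution q l ys \<Longrightarrow> z \<in> {0<..<1} \<Longrightarrow>
      H z = 0 \<and> B z = - ys z \<and> A z = profA l ys z \<and> P z = profP l ys z"
proof -
  let ?t = "\<lambda>z::real. 1 - z\<^sup>2"
  let ?s = "\<lambda>z::real. sqrt (1 - z\<^sup>2)"
  have sp: "?s z > 0" "?s z * ?s z = ?t z" "?t z > 0" if "z \<in> {0<..<1}" for z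
    using arccos_facts(4,7)[of z] that by (auto simp: power2_eq_square)
  have aux: "s * h = t * (h * inverse s)" if "s > 0" "s * s = t" for s t h :: real
    using that by (auto simp: field_simps)
  have c_arccos: "continuous_on {0..1} (\<lambda>z. k (arccos z))" if "continuous_on {0..pi/2} k" for k :: "real \<Rightarrow> real"
  proof (rule continuous_on_compose2[OF that])
    show "continuous_on {0..1} arccos" by (rule continuous_on_subset[OF continuous_on_arccos']) auto
  qed (use arccos_mem in blast)
  have fc: "continuous_on {0..pi/2} f" and gc: "continuous_on {0..pi/2} g" and hc: "continuous_on {0..pi/2} h"
    by (rule DERIV_continuous_on, erule f g h)+
  note cc = c_arccos[OF fc] c_arccos[OF gc] c_arccos[OF hc] c_arccos[OF cont(1)]
  obtain k where k: "k \<ge> 0" "\<forall>\<phi>\<in>{0..pi/2}. \<bar>g' \<phi>\<bar> \<le> k" by (rule bounded_on_interval[OF cont(2)])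
  \<comment> \<open>The component g vanishes on the axis and has a bounded derivative, so |g| \<le>
    k \<phi> \<le> 2 k sin \<phi>.\<close>
  have gb: "\<bar>g (arccos z) * inverse (?s z)\<bar> \<le> 2 * k" if z: "0 \<le> z" "z < 1" for z
  proof -
    note a = arccos_facts[OF z]
    have "\<bar>g (arccos z)\<bar> \<le> k * arccos z ^ Suc 0"
      by (rule derivative_power_bound[OF g]) (use k g0 a(1) in auto)
    also have "\<dots> \<le> k * (2 * ?s z)" using a k by (simp add: mult_left_mono)
    finally have "\<bar>g (arccos z)\<bar> / ?s z \<le> 2 * k" using a(4) by (simp add: pos_divide_le_eq mult_ac)
    then show ?thesis using a(4) by (simp add: abs_mult field_simps)
  qed
  have Bb: "\<bar>B z\<bar> \<le> 2 * k" if "z \<in> {0<..<1}" for z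
    using gb[of z] that B_eq[OF that] by simp
  text \<open>No swirl: \<open>(1 - z\<^sup>2) H\<close> vanishes at both ends and its derivative solves a linear first-order equation.\<close>
  have H0: "H z = 0" if z: "z \<in> {0<..<1}" for z
  proof -
    define L where "L z = ?s z * h (arccos z)" for z
    define L1 where "L1 z = ?t z * H1 z - 2 * z * H z" for z
    have LH: "L w = ?t w * H w" if "w \<in> {0<..<1}" for w
      using aux[OF sp(1,2)[OF that], of "h (arccos w)"] H_eq[OF that] by (simp only: L_def)
    have dL: "(L has_real_derivative L1 w) (at w)" if w: "w \<in> {0<..<1}" for w
    proof -
      have "((\<lambda>w. ?t w * H w) has_real_derivative L1 w) (at w)"
        unfolding L1_def by (auto intro!: derivative_eq_intros H[OF w] simp: algebra_simps)
      then show ?thesis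
        by (rule has_field_derivative_transform_within_open[of _ _ _ "{0<..<1}"]) (use w LH in auto)
    qed
    have dL1: "(L1 has_real_derivative B w * L1 w) (at w)" if w: "w \<in> {0<..<1}" for w
    proof -
      have "(L1 has_real_derivative ?t w * H2 w - 4 * w * H1 w - 2 * H w) (at w)"
        unfolding L1_def[abs_def] by (auto intro!: derivative_eq_intros H[OF w] simp: algebra_simps)
      moreover have "?t w * H2 w - 4 * w * H1 w - 2 * H w = B w * L1 w" using eK[OF w] unfolding L1_def by linarith
      ultimately show ?thesis by simp
    qed
    have cL: "continuous_on {0..1} L" unfolding L_def[abs_def] by (intro continuous_intros cc)
    have L01: "L 0 = 0" "L 1 = 0" using pi2(3) by (auto simp: L_def)
    obtain w where w: "w \<in> {0<..<1}" "L1 w = 0"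
    proof -
      have "\<exists>w>0. w < 1 \<and> (\<lambda>h. L1 w * h) = (\<lambda>_. 0)"
        by (rule Rolle_deriv[of 0 1 L]) (use L01 cL dL in \<open>auto simp: has_field_derivative_def\<close>)
      then obtain w where w: "w > 0" "w < 1" "(\<lambda>h. L1 w * h) = (\<lambda>_. 0)" by blast
      have "L1 w * 1 = 0" using fun_cong[OF w(3), of 1] .
      then show ?thesis using that[of w] w(1,2) by simp
    qed
    have L10: "L1 x = 0" if "x \<in> {0<..<1}" for x
      using bounded_linear_ode_zero[of L1 B "2 * k" w x] dL1 Bb w that by blast
    have "L z = L 1"
      by (rule isconst_unit[OF cL]) (use dL L10 z in auto)
    then show ?thesis using LH[OF z] L01 sp(3)[OF z] by simp
  qed
  \<comment> \<open>\<open>F1\<close> is the z-derivative of the radial profile f. \<open>G\<close>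
    below is the stream profile g sin \<phi>; the divergence equation says that its z-derivative is
    f.\<close>
  define F1 where "F1 z = A1 z + B z + z * B1 z" for z
  define G where "G z = ?s z * g (arccos z)" for z
  have GB: "G z = - ?t z * B z" if "z \<in> {0<..<1}" for z
    using aux[OF sp(1,2)[OF that], of "g (arccos z)"] unfolding B_eq[OF that] G_def by linarith
  have fAB: "f (arccos z) = A z + z * B z" if "z \<in> {0<..<1}" for z
    using A_eq[OF that] B_eq[OF that] by simp
  have tr: "(u has_real_derivative d) (at z)" if "(v has_real_derivative d) (at z)" "z \<in> {0<..<1}" "\<And>w. w \<in> {0<..<1} \<Longrightarrow> v w = u w"
    for u v :: "real \<Rightarrow> real" and d z
    by (rule has_field_derivative_transform_within_open[OF that(1), of "{0<..<1}"]) (use that in auto)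
  have df: "((\<lambda>z. f (arccos z)) has_real_derivative F1 z) (at z)" if z: "z \<in> {0<..<1}" for z
  proof (rule tr[OF _ z])
    show "((\<lambda>z. A z + z * B z) has_real_derivative F1 z) (at z)"
      unfolding F1_def by (auto intro!: derivative_eq_intros A[OF z] B[OF z])
  qed (use fAB in simp)
  \<comment> \<open>The right-hand side makes sense and is continuous up to z = 1, which is not
    visible from \<open>F1\<close>.\<close>
  have F1_eq: "?t z * F1 z = - ?s z * f' (arccos z)" if z: "z \<in> {0<..<1}" for z
  proof -
    have "((\<lambda>z. f (arccos z)) has_real_derivative - f' (arccos z) / ?s z) (at z)"
      using compose_arccos_deriv[OF f, of z] z unfolding at_unit[OF z] by simp
    from DERIV_unique[OF df[OF z] this] have "F1 z = - f' (arccos z) * inverse (?s z)"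
      unfolding divide_inverse .
    then show ?thesis using aux[OF sp(1,2)[OF z], of "- f' (arccos z)"]
      by (simp only: mult_minus_right mult_minus_left)
  qed
  have dG: "(G has_real_derivative f (arccos z)) (at z)" if z: "z \<in> {0<..<1}" for z
  proof (rule tr[OF _ z])
    show "((\<lambda>z. - ?t z * B z) has_real_derivative f (arccos z)) (at z)"
      unfolding fAB[OF z] using div[OF z] by (auto intro!: derivative_eq_intros B[OF z] simp: algebra_simps)
  qed (use GB in simp)
  have A1_eq: "?t z * B2 z = B z + 3 * z * B1 z - A1 z" if z: "z \<in> {0<..<1}" for z
  proof (rule ccontr)
    have "((\<lambda>z. A z + ?t z * B1 z - z * B z) has_real_derivative A1 z + (?t z * B2 z - 2 * z * B1 z) - (B z + z * B1 z)) (at z)"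
      by (auto intro!: derivative_eq_intros A[OF z] B[OF z])
    moreover have "((\<lambda>z. A z + ?t z * B1 z - z * B z) has_real_derivative 0) (at z)"
      by (rule tr[OF DERIV_const z]) (use div in simp)
    ultimately have "A1 z + (?t z * B2 z - 2 * z * B1 z) - (B z + z * B1 z) = 0" by (rule DERIV_unique)
    moreover assume "?t z * B2 z \<noteq> B z + 3 * z * B1 z - A1 z"
    ultimately show False by linarith
  qed
  \<comment> \<open>The constant of the first integration, read off at an arbitrary interior
    point.\<close>
  define c0 where "c0 = P (1/2) - f (arccos (1/2)) + ?t (1/2) * (B (1/2))\<^sup>2 / 2 - l * Qz (1/2)"
  have Qd: "(Qz has_real_derivative - (Y (arccos z) / ?s z)) (at z)" if z: "z \<in> {0<..<1}" for z
    using z_derivs(4)[of z] z at_unit[OF z] by simp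
  have P_eq: "P z = f (arccos z) - ?t z * (B z)\<^sup>2 / 2 + l * Qz z + c0" if z: "z \<in> {0<..<1}" for z
  proof -
    define \<Phi> where "\<Phi> z = P z - f (arccos z) + ?t z * (B z)\<^sup>2 / 2 - l * Qz z" for z
    have "(\<Phi> has_real_derivative 0) (at w)" if w: "w \<in> {0<..<1}" for w
    proof -
      have "(\<Phi> has_real_derivative P1 w - F1 w + (- w * (B w)\<^sup>2 + ?t w * B w * B1 w) + l * (Y (arccos w) / ?s w)) (at w)"
        unfolding \<Phi>_def[abs_def]
        by (auto intro!: derivative_eq_intros Pd[OF w] df[OF w] B[OF w] Qd[OF w] simp: field_simps power2_eq_square)
      moreover have "P1 w - F1 w + (- w * (B w)\<^sup>2 + ?t w * B w * B1 w) + l * (Y (arccos w) / ?s w) = 0"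
        using eE[OF w] A1_eq[OF w] H0[OF w] unfolding F1_def by (simp add: algebra_simps power2_eq_square)
      ultimately show ?thesis by simp
    qed
    then have "\<Phi> z = \<Phi> (1/2)"
      using DERIV_isconst3[of 0 1 z "1/2" \<Phi>] z by auto
    then show ?thesis by (simp add: \<Phi>_def c0_def)
  qed
  \<comment> \<open>Twice the deviation of the pressure constant from l C; it turns out to be
    zero.\<close>
  define kk where "kk = 2 * c0 - 2 * l * C"
  \<comment> \<open>\<open>W\<close> is the expression (1 - z^2) G' + 2 z G + G^2/2 of the fully
    integrated system, and \<open>E\<close> is its derivative. Both vanish at z = 1, because
    \<open>G\<close> and sin \<phi> do.\<close>
  define E where "E z = - ?s z * f' (arccos z) + G z * f (arccos z) + 2 * G z" for z
  define W where "W z = ?t z * f (arccos z) + 2 * z * G z + (G z)\<^sup>2 / 2" for z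
  have cG: "continuous_on {0..1} G" unfolding G_def[abs_def] by (intro continuous_intros cc)
  have cE: "continuous_on {0..1} E" unfolding E_def[abs_def] by (intro continuous_intros cc cG)
  have cW: "continuous_on {0..1} W" unfolding W_def[abs_def] by (intro continuous_intros cc cG) auto
  have cJ: "continuous_on {0..pi/2} J" by (rule DERIV_continuous_on, erule J_deriv)
  have cN: "continuous_on {0..pi/2} (force_N X Y)" by (rule DERIV_continuous_on, erule force_N_deriv)
  have cEz: "continuous_on {0..1} Ez" and cNz: "continuous_on {0..1} Nz"
    unfolding Ez_def[abs_def] Nz_def[abs_def] by (rule c_arccos[OF cJ], rule c_arccos[OF cN])
  have Ez1: "Ez 1 = 0" "Nz 1 = 0" "Nz 0 = 0" by (simp_all add: Ez_def Nz_def J_def force_N_0 force_N_pi2)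
  have zd: "(Nz has_real_derivative Ez z) (at z)" "(Ez has_real_derivative - Kz z) (at z)" if z: "z \<in> {0<..<1}" for z
    using z_derivs(1,2)[of z] z at_unit[OF z] by auto
  \<comment> \<open>Second integration, of the radial component, with the pressure and its
    derivative inserted. The constant is the value at z = 1.\<close>
  have E_lin: "E z - l * Ez z + kk * z = kk" if z: "z \<in> {0..1}" for z
  proof -
    have "(\<lambda>z. E z - l * Ez z + kk * z) z = (\<lambda>z. E z - l * Ez z + kk * z) 1"
    proof (rule isconst_unit[OF _ _ z])
      show "continuous_on {0..1} (\<lambda>z. E z - l * Ez z + kk * z)" by (intro continuous_intros cE cEz)
      fix w :: real assume w: "w \<in> {0<..<1}"
      have "((\<lambda>z. ?t z * F1 z + G z * f (arccos z) + 2 * G z) has_real_derivative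
         ?t w * (A2 w + 2 * B1 w + w * B2 w) - 2 * w * F1 w + (f (arccos w))\<^sup>2 + G w * F1 w + 2 * f (arccos w)) (at w)"
        using df[OF w] dG[OF w] unfolding F1_def[abs_def]
        by (auto intro!: derivative_eq_intros A[OF w] B[OF w] simp: algebra_simps power2_eq_square)
      then have "(E has_real_derivative
         ?t w * (A2 w + 2 * B1 w + w * B2 w) - 2 * w * F1 w + (f (arccos w))\<^sup>2 + G w * F1 w + 2 * f (arccos w)) (at w)"
        by (rule tr[OF _ w]) (simp add: E_def F1_eq)
      then have d: "((\<lambda>z. E z - l * Ez z + kk * z) has_real_derivative
         ?t w * (A2 w + 2 * B1 w + w * B2 w) - 2 * w * F1 w + (f (arccos w))\<^sup>2 + G w * F1 w + 2 * f (arccos w) + l * Kz w + kk) (at w)"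
        by (auto intro!: derivative_eq_intros zd[OF w])
      have Kw: "Kz w = X (arccos w) + 2 * Qz w + 2 * C" by (simp add: Kz_def K_eq Qz_def)
      define Ys where "Ys = Y (arccos w) / ?s w"
      have X_eq: "l * X (arccos w) = - (?t w * A2 w - 4 * w * A1 w - 2 * A w) - (A w)\<^sup>2 + B w * (?t w * A1 w - 2 * w * A w)
          - w * P1 w - 2 * P w - l * w * Ys"
        using eR[OF w] H0[OF w] by (simp add: Ys_def algebra_simps)
      have P1_eq: "P1 w = - l * Ys + 2 * A1 w + (?t w * B2 w - 2 * w * B1 w) - B w * (?t w * B1 w - w * B w)"
        using eE[OF w] H0[OF w] by (simp add: Ys_def)
      have tB1: "?t w * B1 w = w * B w - A w" using div[OF w] by simp
      have "?t w * (A2 w + 2 * B1 w + w * B2 w) - 2 * w * F1 w + (f (arccos w))\<^sup>2 + G w * F1 w + 2 * f (arccos w) + l * Kz w + kk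
        = ?t w * A2 w + 2 * (?t w * B1 w) + w * (?t w * B2 w) - 2 * w * (A1 w + B w + w * B1 w) + (A w + w * B w)\<^sup>2
          - B w * (?t w * A1 w + ?t w * B w + w * (?t w * B1 w)) + 2 * (A w + w * B w)
          + l * X (arccos w) + 2 * l * Qz w + 2 * c0"
        unfolding F1_def GB[OF w] fAB[OF w] Kw kk_def by (simp add: algebra_simps)
      also have "\<dots> = 0"
        unfolding X_eq P1_eq P_eq[OF w] fAB[OF w] tB1 A1_eq[OF w] by (simp add: field_simps power2_eq_square)
      finally show "((\<lambda>z. E z - l * Ez z + kk * z) has_real_derivative 0) (at w)" using d by simp
    qed
    then show ?thesis by (simp add: Ez1 E_def G_def)
  qed
  have W_const: "W z - l * Nz z + kk * (1 - z)\<^sup>2 / 2 = 0" if z: "z \<in> {0..1}" for z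
  proof -
    have "(\<lambda>z. W z - l * Nz z + kk * (1 - z)\<^sup>2 / 2) z = (\<lambda>z. W z - l * Nz z + kk * (1 - z)\<^sup>2 / 2) 1"
    proof (rule isconst_unit[OF _ _ z])
      show "continuous_on {0..1} (\<lambda>z. W z - l * Nz z + kk * (1 - z)\<^sup>2 / 2)" by (intro continuous_intros cW cNz) auto
      fix w :: real assume w: "w \<in> {0<..<1}"
      have "(W has_real_derivative ?t w * F1 w + 2 * G w + G w * f (arccos w)) (at w)"
        unfolding W_def[abs_def]
        by (auto intro!: derivative_eq_intros df[OF w] dG[OF w] simp: field_simps power2_eq_square)
      then have "(W has_real_derivative E w) (at w)" unfolding F1_eq[OF w] by (simp add: E_def algebra_simps)
      then have "((\<lambda>z. W z - l * Nz z + kk * (1 - z)\<^sup>2 / 2) has_real_derivative E w - l * Ez w - kk * (1 - w)) (at w)"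
        by (auto intro!: derivative_eq_intros zd[OF w] simp: field_simps)
      moreover have "E w - l * Ez w - kk * (1 - w) = 0" using E_lin[of w] w by (simp add: algebra_simps)
      ultimately show "((\<lambda>z. W z - l * Nz z + kk * (1 - z)\<^sup>2 / 2) has_real_derivative 0) (at w)" by simp
    qed
    then show ?thesis by (simp add: Ez1 W_def G_def)
  qed
  \<comment> \<open>At z = 0, no slip annihilates \<open>W\<close> and the choice of C annihilates
    N, so only kk/2 remains.\<close>
  have kk0: "kk = 0" using W_const[of 0] pi2 by (simp add: W_def G_def Ez1)
  define y where "y z = g (arccos z) * inverse (?s z)" for z
  have yB: "y z = - B z" if "z \<in> {0<..<1}" for z using B_eq[OF that] by (simp add: y_def)
  have tq: "(?t z)\<^sup>2 * q z = Nz z" if "z \<in> {0<..<1}" for z using q_N[of z] that by simp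
  \<comment> \<open>With G = -(1 - z^2) B the identity for \<open>W\<close> is divisible by (1 -
    z^2)^2, which is positive inside the interval.\<close>
  have ric: "- B1 z = l * q z - (y z)\<^sup>2 / 2" if z: "z \<in> {0<..<1}" for z
  proof -
    have tB1: "A z = z * B z - ?t z * B1 z" using div[OF z] by simp
    have "?t z * (A z + z * B z) + 2 * z * (- ?t z * B z) + (- ?t z * B z)\<^sup>2 / 2 = l * ((?t z)\<^sup>2 * q z)"
      using W_const[of z] z unfolding W_def GB[OF z] fAB[OF z] tq[OF z] kk0 by simp
    then have "(?t z)\<^sup>2 * (- B1 z + (B z)\<^sup>2 / 2 - l * q z) = 0"
      unfolding tB1 by (simp add: field_simps power2_eq_square)
    then show ?thesis using sp(3)[OF z] yB[OF z] by simp
  qed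
  have y0: "y 0 = 0" using pi2 by (simp add: y_def)
  have cy: "continuous_on {0..<1} y"
  proof -
    have "continuous_on {0..<1} (\<lambda>z. g (arccos z))" by (rule continuous_on_subset[OF cc(2)]) auto
    then show ?thesis unfolding y_def[abs_def]
      using arccos_facts(4) by (intro continuous_intros) (auto simp: less_le)
  qed
  have dy: "(y has_real_derivative l * q z - (y z)\<^sup>2 / 2) (at z)" if "0 < z" "z < 1" for z
  proof -
    have z: "z \<in> {0<..<1}" using that by simp
    show ?thesis unfolding ric[OF z, symmetric]
      by (rule tr[OF DERIV_minus[OF B(1)[OF z]] z]) (simp add: yB)
  qed
  have yb: "\<bar>y z\<bar> \<le> 2 * k" if "0 \<le> z" "z < 1" for z using gb[OF that] by (simp add: y_def)
  note R = bounded_riccati_unique[OF q_continuous y0 cy dy yb]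
  show "riccati_solvable q l" by (rule R(1))
  fix ys and z :: real assume ys: "riccati_solution q l ys" and z: "z \<in> {0<..<1}"
  have yys: "y z = ys z"
    using R(2)[of z] riccati_solution_unique[OF q_continuous ys, of z] z by simp
  have Bz: "B z = - ys z" using yB[OF z] yys by simp
  have B1z: "B1 z = (ys z)\<^sup>2 / 2 - l * q z" using ric[OF z] yys by simp
  have tB1: "A z = z * B z - ?t z * B1 z" using div[OF z] by simp
  have Az: "A z = profA l ys z" unfolding tB1 Bz B1z profA_def by (simp add: field_simps)
  have Pz: "P z = profP l ys z"
    using P_eq[OF z] kk0 unfolding fAB[OF z] Az Bz profP_def kk_def by simp
  show "H z = 0 \<and> B z = - ys z \<and> A z = profA l ys z \<and> P z = profP l ys z" using H0[OF z] Bz Az Pz by blast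
qed

end

section \<open>From an arbitrary solution to its profiles\<close>

lemma boundary_meridian: "meridian (pi/2) \<in> punctured_boundary"
proof -
  have "frontier half_space = {x. x $ 3 = 0}"
    unfolding frontier_def closure_half_space interior_open[OF open_half_space] by (auto simp: half_space_def)
  then show ?thesis by (auto simp: punctured_boundary_def meridian_def e_rho_def vec_eq_iff forall_3)
qed

lemma C2_on_continuous: "C2_on S f \<Longrightarrow> continuous_on S f" and C1_on_continuous: "C1_on S f \<Longrightarrow> continuous_on S f"
  unfolding C2_on_def C1_on_def has_continuous_derivative_on_def
  by (auto simp: continuous_on_eq_continuous_within intro: has_derivative_continuous)

context angular_force
begin

text \<open>Projecting the field along the meridian onto the spherical frame gives differentiable
  profiles; axisymmetry and homogeneity reconstruct the field from them off the axis. The system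
  evaluated on the meridian becomes the profile system, and the resulting equality with
  \<open>vel\<close> and \<open>pres\<close> extends to the axis and the boundary by
  continuity.\<close>

lemma solution_unique:
  fixes F v :: "real^3 \<Rightarrow> real^3" and p :: "real^3 \<Rightarrow> real"
  assumes F: "\<And>\<rho> \<phi> \<theta>. \<rho> > 0 \<Longrightarrow> \<phi> \<in> {0..pi/2} \<Longrightarrow>
      F (spherical \<rho> \<phi> \<theta>) = (1 / \<rho>^3) *\<^sub>R (X \<phi> *\<^sub>R e_rho \<phi> \<theta> + Y \<phi> *\<^sub>R e_phi \<phi> \<theta>)"
    and sol: "axisymmetric_self_similar_solution F l v p"
  shows "riccati_solvable q l"
    "\<And>ys x. riccati_solution q l ys \<Longrightarrow> x \<in> S3 \<Longrightarrow> v x = vel l ys x \<and> p x = pres l ys x"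
proof -
  have C: "C2_on S3 v" "C1_on S3 p" and NS: "solves_NS F l v p"
    and hom: "\<And>\<mu> x. \<mu> > 0 \<Longrightarrow> x \<in> S3 \<Longrightarrow> v (\<mu> *\<^sub>R x) = (1 / \<mu>) *\<^sub>R v x \<and> p (\<mu> *\<^sub>R x) = (1 / \<mu>^2) * p x"
    using sol unfolding axisymmetric_self_similar_solution_def by auto
  obtain vr vp vt where V: "\<And>\<rho> \<phi> \<theta>. \<rho> > 0 \<Longrightarrow> \<phi> \<in> {0..pi/2} \<Longrightarrow> v (spherical \<rho> \<phi> \<theta>) =
      vr \<rho> \<phi> *\<^sub>R e_rho \<phi> \<theta> + vp \<rho> \<phi> *\<^sub>R e_phi \<phi> \<theta> + vt \<rho> \<phi> *\<^sub>R e_theta \<theta>"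
    using sol unfolding axisymmetric_self_similar_solution_def axisymmetric_vector_def by blast
  obtain sc where sc: "\<And>\<rho> \<phi> \<theta>. \<rho> > 0 \<Longrightarrow> \<phi> \<in> {0..pi/2} \<Longrightarrow> p (spherical \<rho> \<phi> \<theta>) = sc \<rho> \<phi>"
    using sol unfolding axisymmetric_self_similar_solution_def axisymmetric_scalar_def by blast
  obtain d d2 where d: "\<And>\<phi> j. \<phi> \<in> {0..pi/2} \<Longrightarrow> ((\<lambda>\<phi>. v (meridian \<phi>) $ j) has_real_derivative d \<phi> $ j) (at \<phi> within {0..pi/2})"
    "\<And>\<phi> j. \<phi> \<in> {0..pi/2} \<Longrightarrow> ((\<lambda>\<phi>. d \<phi> $ j) has_real_derivative d2 \<phi> $ j) (at \<phi> within {0..pi/2})"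
    using C2_along_meridian[OF C(1)] by metis
  define f where "f \<phi> = v (meridian \<phi>) $ 1 * sin \<phi> + v (meridian \<phi>) $ 3 * cos \<phi>" for \<phi>
  define g where "g \<phi> = v (meridian \<phi>) $ 1 * cos \<phi> - v (meridian \<phi>) $ 3 * sin \<phi>" for \<phi>
  define h where "h \<phi> = v (meridian \<phi>) $ 2" for \<phi>
  define f' where "f' \<phi> = d \<phi> $ 1 * sin \<phi> + d \<phi> $ 3 * cos \<phi> + g \<phi>" for \<phi>
  define g' where "g' \<phi> = d \<phi> $ 1 * cos \<phi> - d \<phi> $ 3 * sin \<phi> - f \<phi>" for \<phi>
  have df: "(f has_real_derivative f' \<phi>) (at \<phi> within {0..pi/2})" if p: "\<phi> \<in> {0..pi/2}" for \<phi>
    unfolding f_def[abs_def] f'_def g_def by (auto intro!: derivative_eq_intros d(1)[OF p] simp: algebra_simps)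
  have dg: "(g has_real_derivative g' \<phi>) (at \<phi> within {0..pi/2})" if p: "\<phi> \<in> {0..pi/2}" for \<phi>
    unfolding g_def[abs_def] g'_def f_def by (auto intro!: derivative_eq_intros d(1)[OF p] simp: algebra_simps)
  have dh: "(h has_real_derivative d \<phi> $ 2) (at \<phi> within {0..pi/2})" if p: "\<phi> \<in> {0..pi/2}" for \<phi>
    unfolding h_def[abs_def] by (rule d(1)[OF p])
  have df': "(f' has_real_derivative (d2 \<phi> $ 1 * sin \<phi> + d \<phi> $ 1 * cos \<phi> + (d2 \<phi> $ 3 * cos \<phi> - d \<phi> $ 3 * sin \<phi>) + g' \<phi>)) (at \<phi> within {0..pi/2})"
    if p: "\<phi> \<in> {0..pi/2}" for \<phi>
    unfolding f'_def[abs_def] by (auto intro!: derivative_eq_intros d(2)[OF p] dg[OF p] simp: algebra_simps)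
  have dg': "(g' has_real_derivative (d2 \<phi> $ 1 * cos \<phi> - d \<phi> $ 1 * sin \<phi> - (d2 \<phi> $ 3 * sin \<phi> + d \<phi> $ 3 * cos \<phi>) - f' \<phi>)) (at \<phi> within {0..pi/2})"
    if p: "\<phi> \<in> {0..pi/2}" for \<phi>
    unfolding g'_def[abs_def] by (auto intro!: derivative_eq_intros d(2)[OF p] df[OF p] simp: algebra_simps)
  have cont: "continuous_on {0..pi/2} f'" "continuous_on {0..pi/2} g'"
    by (rule DERIV_continuous_on, erule df', rule DERIV_continuous_on, erule dg')
  have comp: "vr 1 \<phi> = f \<phi> \<and> vp 1 \<phi> = g \<phi> \<and> vt 1 \<phi> = h \<phi>" if p: "\<phi> \<in> {0..pi/2}" for \<phi>
  proof -
    have "v (meridian \<phi>) = vr 1 \<phi> *\<^sub>R e_rho \<phi> 0 + vp 1 \<phi> *\<^sub>R e_phi \<phi> 0 + vt 1 \<phi> *\<^sub>R e_theta 0"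
      unfolding meridian_spherical by (rule V[OF zero_less_one p])
    then have c: "v (meridian \<phi>) $ 1 = vr 1 \<phi> * sin \<phi> + vp 1 \<phi> * cos \<phi>"
      "v (meridian \<phi>) $ 3 = vr 1 \<phi> * cos \<phi> - vp 1 \<phi> * sin \<phi>" "v (meridian \<phi>) $ 2 = vt 1 \<phi>"
      by (simp_all add: e_rho_def e_phi_vec e_theta_def)
    have "f \<phi> = vr 1 \<phi> * (sin \<phi> * sin \<phi> + cos \<phi> * cos \<phi>)" "g \<phi> = vp 1 \<phi> * (sin \<phi> * sin \<phi> + cos \<phi> * cos \<phi>)"
      unfolding f_def g_def c by (simp_all only: algebra_simps)
    then show ?thesis unfolding sin_mult_sin by (simp add: h_def c)
  qed
  \<comment> \<open>The point on the axis is represented with every \<theta>. Taking \<theta> = 0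
    and \<theta> = \<pi> gives its first velocity component with opposite signs.\<close>
  have g0: "g 0 = 0"
  proof -
    have e: "spherical 1 0 \<theta> = axis 3 1" for \<theta>
      by (simp add: spherical_def e_rho_def vec_eq_iff forall_3 axis_def)
    have "v (axis 3 1) $ 1 = vp 1 0" using V[of 1 0 0] unfolding e by (simp add: e_rho_def e_phi_vec e_theta_def)
    moreover have "v (axis 3 1) $ 1 = - vp 1 0" using V[of 1 0 pi] unfolding e by (simp add: e_rho_def e_phi_vec e_theta_def)
    ultimately show ?thesis using comp[of 0] by simp
  qed
  have "v (meridian (pi/2)) = 0" using NS boundary_meridian unfolding solves_NS_def by blast
  then have pi2: "f (pi/2) = 0" "g (pi/2) = 0" "h (pi/2) = 0" by (simp_all add: f_def g_def h_def)
  define isn where "isn z = inverse (sqrt (1 - z\<^sup>2))" for z :: real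
  define A where "A z = f (arccos z) + z * (g (arccos z) * isn z)" for z
  define B where "B z = (-1) * (g (arccos z) * isn z)" for z
  define H where "H z = h (arccos z) * isn z" for z
  define P where "P z = p (meridian (arccos z))" for z
  have tw: "twice_diff (\<lambda>z. f (arccos z))" "twice_diff (\<lambda>z. g (arccos z))" "twice_diff (\<lambda>z. h (arccos z))" "twice_diff isn"
    unfolding isn_def[abs_def]
    by (rule twice_diff_arccos[OF df df'] twice_diff_arccos[OF dg dg'] twice_diff_arccos[OF dh d(2)] twice_diff_inverse_sin; assumption)+
  have "twice_diff A" "twice_diff B" "twice_diff H"
    unfolding A_def[abs_def] B_def[abs_def] H_def[abs_def]
    by (intro twice_diff_add twice_diff_mult twice_diff_const twice_diff_id tw)+
  then obtain A1 A2 B1 B2 H1 H2 where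
    tA: "\<forall>z\<in>{0<..<1}. (A has_real_derivative A1 z) (at z) \<and> (A1 has_real_derivative A2 z) (at z)" and
    tB: "\<forall>z\<in>{0<..<1}. (B has_real_derivative B1 z) (at z) \<and> (B1 has_real_derivative B2 z) (at z)" and
    tH: "\<forall>z\<in>{0<..<1}. (H has_real_derivative H1 z) (at z) \<and> (H1 has_real_derivative H2 z) (at z)"
    unfolding twice_diff_def by blast
  have dA: "\<And>z. z \<in> {0<..<1} \<Longrightarrow> (A has_real_derivative A1 z) (at z)" "\<And>z. z \<in> {0<..<1} \<Longrightarrow> (A1 has_real_derivative A2 z) (at z)"
    and dB: "\<And>z. z \<in> {0<..<1} \<Longrightarrow> (B has_real_derivative B1 z) (at z)" "\<And>z. z \<in> {0<..<1} \<Longrightarrow> (B1 has_real_derivative B2 z) (at z)"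
    and dH: "\<And>z. z \<in> {0<..<1} \<Longrightarrow> (H has_real_derivative H1 z) (at z)" "\<And>z. z \<in> {0<..<1} \<Longrightarrow> (H1 has_real_derivative H2 z) (at z)"
    using tA tB tH by blast+
  obtain p' where p': "has_continuous_derivative_on p p' S3" using C(2) unfolding C1_on_def by blast
  define P1 where "P1 z = - p' (meridian (arccos z)) (e_phi (arccos z) 0) / sqrt (1 - z\<^sup>2)" for z
  have dP: "(P has_real_derivative P1 z) (at z)" if z: "z \<in> {0<..<1}" for z
  proof -
    have z': "0 \<le> z" "z < 1" using z by auto
    have "((\<lambda>\<phi>. p (meridian \<phi>)) has_real_derivative p' (meridian \<phi>) (e_phi \<phi> 0)) (at \<phi> within {0..pi/2})" if "\<phi> \<in> {0..pi/2}" for \<phi>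
      using along_meridian[OF p' that] by (simp add: has_real_derivative_iff_has_vector_derivative)
    from compose_arccos_deriv[OF this z', unfolded at_unit[OF z]] show ?thesis
      unfolding P_def[abs_def] P1_def by simp
  qed
  have rep: "v x = inorm x *\<^sub>R (A (zc x) *\<^sub>R nvec x + B (zc x) *\<^sub>R axis 3 1 + H (zc x) *\<^sub>R vector [- nvec x $ 2, nvec x $ 1, 0])"
    "p x = (inorm x)\<^sup>2 * P (zc x)" if x: "x \<in> off_axis" for x
  proof -
    note o = off_axis_facts[OF x]
    have n: "norm x > 0" using o(3) by simp
    have z: "zc x < 1" using o(4) by simp
    have ac: "arccos (zc x) \<in> {0..pi/2}" by (rule arccos_mem[OF zc_bounds[OF o(2)]])
    obtain \<theta> where t: "x = spherical (norm x) (arccos (zc x)) \<theta>" by (rule spherical_coordinates[OF o(2)])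
    have x1: "x = norm x *\<^sub>R spherical 1 (arccos (zc x)) \<theta>" using t by (simp add: spherical_def)
    have s1: "spherical 1 (arccos (zc x)) \<theta> \<in> S3" by (rule spherical_in_S3[OF zero_less_one ac])
    have "v x = (1 / norm x) *\<^sub>R v (spherical 1 (arccos (zc x)) \<theta>)" using hom[OF n s1] x1 by metis
    also have "v (spherical 1 (arccos (zc x)) \<theta>) = f (arccos (zc x)) *\<^sub>R e_rho (arccos (zc x)) \<theta>
       + g (arccos (zc x)) *\<^sub>R e_phi (arccos (zc x)) \<theta> + h (arccos (zc x)) *\<^sub>R e_theta \<theta>"
      using V[OF zero_less_one ac] comp[OF ac] by metis
    finally show "v x = inorm x *\<^sub>R (A (zc x) *\<^sub>R nvec x + B (zc x) *\<^sub>R axis 3 1 + H (zc x) *\<^sub>R vector [- nvec x $ 2, nvec x $ 1, 0])"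
      unfolding off_axis_frame[OF o(2) z t] A_def B_def H_def isn_def
      by (simp add: algebra_simps inverse_eq_divide)
    have "p x = (1 / (norm x)\<^sup>2) * p (spherical 1 (arccos (zc x)) \<theta>)" using hom[OF n s1] x1 by metis
    also have "p (spherical 1 (arccos (zc x)) \<theta>) = P (zc x)"
      unfolding P_def meridian_spherical sc[OF zero_less_one ac] ..
    finally show "p x = (inorm x)\<^sup>2 * P (zc x)" by (simp add: power_one_over inverse_eq_divide)
  qed
  have eqs: "A z + (1 - z\<^sup>2) * B1 z - z * B z = 0"
      "- ((1 - z\<^sup>2) * A2 z - 4 * z * A1 z - 2 * A z) - (A z)\<^sup>2 + B z * ((1 - z\<^sup>2) * A1 z - 2 * z * A z)
          - (H z)\<^sup>2 - z * P1 z - 2 * P z = l * (X (arccos z) + z * (Y (arccos z) / sqrt (1 - z\<^sup>2)))"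
      "- 2 * A1 z - ((1 - z\<^sup>2) * B2 z - 2 * z * B1 z) + B z * ((1 - z\<^sup>2) * B1 z - z * B z)
          + z * (H z)\<^sup>2 + P1 z = - l * (Y (arccos z) / sqrt (1 - z\<^sup>2))"
      "- ((1 - z\<^sup>2) * H2 z - 4 * z * H1 z - 2 * H z) + B z * ((1 - z\<^sup>2) * H1 z - 2 * z * H z) = 0"
    if z: "z \<in> {0<..<1}" for z
  proof -
    have z': "0 \<le> z" "z < 1" using z by auto
    note a = arccos_facts[OF z']
    define x where "x = meridian (arccos z)"
    have n: "norm x = 1" "nvec x = x" "zc x = z"
      using spherical_facts[of 1 "arccos z" 0] a(3) by (auto simp: x_def meridian_spherical spherical_def)
    have xc: "x $ 1 = sqrt (1 - z\<^sup>2)" "x $ 2 = 0" "x $ 3 = z"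
      using a(2,3) by (auto simp: x_def meridian_def e_rho_def)
    have x: "x \<in> off_axis" using xc a(4) z by (auto simp: off_axis_def)
    note o = off_axis_facts[OF x]
    note op = NS_operators[OF open_off_axis zero_0_off_axis off_axis_facts(4) dA dB dH dP rep x n(3)[symmetric]]
    have "divergence v x = 0" using NS o(1) unfolding solves_NS_def by blast
    then show "A z + (1 - z\<^sup>2) * B1 z - z * B z = 0" using op(1) n by simp
    have Fx: "F x = (inorm x) ^ 3 *\<^sub>R ((X (arccos z) + z * (Y (arccos z) / sqrt (1 - z\<^sup>2))) *\<^sub>R nvec x
        - (Y (arccos z) / sqrt (1 - z\<^sup>2)) *\<^sub>R axis 3 1)"
      using force_cartesian[OF F o(2) _ n(3)[symmetric] refl] n(3) z' by blast
    have lap: "- laplacian v x + advection v v x + grad p x = l *\<^sub>R F x"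
      using NS o(1) unfolding solves_NS_def by blast
    have "(inorm x) ^ 3 *\<^sub>R ((- ((1 - z\<^sup>2) * A2 z - 4 * z * A1 z - 2 * A z) - (A z)\<^sup>2 + B z * ((1 - z\<^sup>2) * A1 z - 2 * z * A z)
          - (H z)\<^sup>2 - z * P1 z - 2 * P z) *\<^sub>R nvec x
      + (- 2 * A1 z - ((1 - z\<^sup>2) * B2 z - 2 * z * B1 z) + B z * ((1 - z\<^sup>2) * B1 z - z * B z)
          + z * (H z)\<^sup>2 + P1 z) *\<^sub>R axis 3 1
      + (- ((1 - z\<^sup>2) * H2 z - 4 * z * H1 z - 2 * H z) + B z * ((1 - z\<^sup>2) * H1 z - 2 * z * H z))
          *\<^sub>R vector [- nvec x $ 2, nvec x $ 1, 0]) = l *\<^sub>R F x"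
      by (rule trans[OF sym[OF op(2)] lap])
    then have eq: "((- ((1 - z\<^sup>2) * A2 z - 4 * z * A1 z - 2 * A z) - (A z)\<^sup>2 + B z * ((1 - z\<^sup>2) * A1 z - 2 * z * A z)
          - (H z)\<^sup>2 - z * P1 z - 2 * P z) *\<^sub>R x
      + (- 2 * A1 z - ((1 - z\<^sup>2) * B2 z - 2 * z * B1 z) + B z * ((1 - z\<^sup>2) * B1 z - z * B z)
          + z * (H z)\<^sup>2 + P1 z) *\<^sub>R axis 3 1
      + (- ((1 - z\<^sup>2) * H2 z - 4 * z * H1 z - 2 * H z) + B z * ((1 - z\<^sup>2) * H1 z - 2 * z * H z))
          *\<^sub>R vector [- x $ 2, x $ 1, 0])
      = l *\<^sub>R ((X (arccos z) + z * (Y (arccos z) / sqrt (1 - z\<^sup>2))) *\<^sub>R x - (Y (arccos z) / sqrt (1 - z\<^sup>2)) *\<^sub>R axis 3 1)"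
      unfolding Fx n(1,2) by simp
    \<comment> \<open>Coefficients may be compared because x = (s, 0, z) with s > 0, so x, e_3 and
      (0, s, 0) are linearly independent.\<close>
    have gen: "a = l * a' \<and> b = - l * b' \<and> c = 0"
      if "a *\<^sub>R x + b *\<^sub>R axis 3 1 + c *\<^sub>R vector [- x $ 2, x $ 1, 0] = l *\<^sub>R (a' *\<^sub>R x - b' *\<^sub>R axis 3 1)" for a b c a' b'
    proof -
      have e: "(a *\<^sub>R x + b *\<^sub>R axis 3 1 + c *\<^sub>R vector [- x $ 2, x $ 1, 0]) $ j = (l *\<^sub>R (a' *\<^sub>R x - b' *\<^sub>R axis 3 1)) $ j" for j
        using that by simp
      have s0: "sqrt (1 - z\<^sup>2) \<noteq> 0" using a(4) by simp
      have e1: "a * sqrt (1 - z\<^sup>2) = l * a' * sqrt (1 - z\<^sup>2)" using e[of 1] by (simp add: xc axis_def)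
      have e2: "c * sqrt (1 - z\<^sup>2) = 0" using e[of 2] by (simp add: xc axis_def)
      have e3: "a * z + b = l * (a' * z - b')" using e[of 3] by (simp add: xc axis_def)
      have aa: "a = l * a'" using e1 s0 by (metis mult_right_cancel)
      have "c = 0" using e2 s0 by (metis mult_eq_0_iff)
      then show ?thesis using aa e3 by (simp add: algebra_simps)
    qed
    from gen[OF eq] show "- ((1 - z\<^sup>2) * A2 z - 4 * z * A1 z - 2 * A z) - (A z)\<^sup>2 + B z * ((1 - z\<^sup>2) * A1 z - 2 * z * A z)
          - (H z)\<^sup>2 - z * P1 z - 2 * P z = l * (X (arccos z) + z * (Y (arccos z) / sqrt (1 - z\<^sup>2)))"
      "- 2 * A1 z - ((1 - z\<^sup>2) * B2 z - 2 * z * B1 z) + B z * ((1 - z\<^sup>2) * B1 z - z * B z)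
          + z * (H z)\<^sup>2 + P1 z = - l * (Y (arccos z) / sqrt (1 - z\<^sup>2))"
      "- ((1 - z\<^sup>2) * H2 z - 4 * z * H1 z - 2 * H z) + B z * ((1 - z\<^sup>2) * H1 z - 2 * z * H z) = 0" by blast+
  qed
  have AB: "A z = f (arccos z) + z * (g (arccos z) * inverse (sqrt (1 - z\<^sup>2)))"
    "B z = - (g (arccos z) * inverse (sqrt (1 - z\<^sup>2)))" "H z = h (arccos z) * inverse (sqrt (1 - z\<^sup>2))" for z
    by (simp_all add: A_def B_def H_def isn_def)
  note R = profile_riccati[OF df dg dh cont g0 pi2 dA dB dH dP AB eqs]
  have R2: "H z = 0 \<and> B z = - ys z \<and> A z = profA l ys z \<and> P z = profP l ys z"
    if "riccati_solution q l ys" "z \<in> {0<..<1}" for ys z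
    by (rule profile_riccati(2)[OF df dg dh cont g0 pi2 dA dB dH dP AB eqs that])
  show "riccati_solvable q l" by (rule R(1))
  fix ys x assume ys: "riccati_solution q l ys" and x: "x \<in> S3"
  have x3: "x $ 3 \<ge> 0" "x \<noteq> 0" using x by (auto simp: mem_S3)
  have sub: "off_axis \<subseteq> S3" using off_axis_facts(2) by blast
  have half: "1 / 2 \<in> {0<..<1::real}" by simp
  have eq: "v w = vel l ys w \<and> p w = pres l ys w" if w: "w \<in> off_axis" for w
    using R2[OF ys off_axis_facts(4)[OF w]] unfolding rep[OF w] vel_def pres_def by simp
  have "v x - vel l ys x = 0"
    by (rule continuous_zero_off_axis[OF continuous_on_diff[OF C2_on_continuous[OF C(1)] C2_on_continuous[OF vel_Holder(3)[OF ys half]]] sub x _ x3])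
      (simp add: eq)
  moreover have "p x - pres l ys x = 0"
    by (rule continuous_zero_off_axis[OF continuous_on_diff[OF C1_on_continuous[OF C(2)] C1_on_continuous[OF vel_Holder(4)[OF ys half]]] sub x _ x3])
      (simp add: eq)
  ultimately show "v x = vel l ys x \<and> p x = pres l ys x" by simp
qed

text \<open>The relation N = (1 - z^2)^2 q carries no information at z = 1; there the sign is
  inherited from the left by continuity.\<close>

lemma q_sign_at_1:
  assumes "\<And>z. 0 \<le> z \<Longrightarrow> z < 1 \<Longrightarrow> 0 \<le> \<sigma> * q z" "z \<in> {0..1}"
  shows "0 \<le> \<sigma> * q z"
proof (cases "z < 1")
  case True then show ?thesis using assms by simp
next
  case False
  then have z: "z = 1" using assms by simp
  have "(q \<longlongrightarrow> q 1) (at 1 within {0..1})" using q_continuous by (simp add: continuous_on_def)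
  then have "(q \<longlongrightarrow> q 1) (at_left 1)" by (simp add: at_within_Icc_at_left)
  then have "((\<lambda>z. \<sigma> * q z) \<longlongrightarrow> \<sigma> * q 1) (at_left 1)" by (intro tendsto_intros)
  moreover have "eventually (\<lambda>x. 0 \<le> \<sigma> * q x) (at_left (1::real))"
    using eventually_at_left_real[of 0 1] by (rule eventually_mono) (use assms in auto)
  ultimately show ?thesis unfolding z by (rule tendsto_lowerbound) simp
qed

lemma q_cos: assumes "\<phi> \<in> {0..pi/2}" shows "force_N X Y \<phi> = (1 - (cos \<phi>)\<^sup>2)\<^sup>2 * q (cos \<phi>)" "cos \<phi> \<in> {0..1}"
proof -
  show c: "cos \<phi> \<in> {0..1}" using assms cos_ge_zero[of \<phi>] by auto
  show "force_N X Y \<phi> = (1 - (cos \<phi>)\<^sup>2)\<^sup>2 * q (cos \<phi>)"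
    using q_N[OF c] assms arccos_cos[of \<phi>] by (simp add: Nz_def)
qed

lemma q_nonneg:
  assumes "\<And>\<phi>. \<phi> \<in> {0..pi/2} \<Longrightarrow> 0 \<le> \<sigma> * force_N X Y \<phi>" "z \<in> {0..1}"
  shows "0 \<le> \<sigma> * q z"
proof (rule q_sign_at_1[OF _ assms(2)])
  fix z :: real assume z: "0 \<le> z" "z < 1"
  have "0 \<le> \<sigma> * Nz z" using assms(1)[OF arccos_mem[of z]] z by (simp add: Nz_def)
  also have "Nz z = (1 - z\<^sup>2)\<^sup>2 * q z" using q_N[of z] z by simp
  finally have "0 \<le> (1 - z\<^sup>2)\<^sup>2 * (\<sigma> * q z)" by (simp add: mult_ac)
  moreover have "(1 - z\<^sup>2)\<^sup>2 > 0" using arccos_facts(4)[OF z] by simp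
  ultimately show "0 \<le> \<sigma> * q z" by (simp add: zero_le_mult_iff)
qed

lemma q_sign:
  assumes "\<phi> \<in> {0..pi/2}" "0 < \<sigma> * force_N X Y \<phi>"
  shows "0 < \<sigma> * q (cos \<phi>)"
proof -
  have "0 < (1 - (cos \<phi>)\<^sup>2)\<^sup>2 * (\<sigma> * q (cos \<phi>))" using assms q_cos[OF assms(1)] by (simp add: mult_ac)
  then show ?thesis by (metis not_less zero_le_power2 zero_less_mult_iff)
qed

end

theorem theorem1p2:
  fixes F :: "real^3 \<Rightarrow> real^3" and X Y :: "real \<Rightarrow> real"
  assumes F_profiles: "\<And>\<rho> \<phi> \<theta>. \<rho> > 0 \<Longrightarrow> \<phi> \<in> {0..pi/2} \<Longrightarrow>
      F (spherical \<rho> \<phi> \<theta>) = (1 / \<rho>^3) *\<^sub>R (X \<phi> *\<^sub>R e_rho \<phi> \<theta> + Y \<phi> *\<^sub>R e_phi \<phi> \<theta>)"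
    and F_C1: "C1_on punctured_closed_half_space F"
  shows "\<exists>lam_lo lam_hi :: ereal. lam_lo < 0 \<and> 0 < lam_hi \<and>
    (\<forall>lam::real. lam_lo < ereal lam \<and> ereal lam < lam_hi \<longrightarrow>
       (\<exists>u p. axisymmetric_self_similar_solution F lam u p \<and>
          (\<forall>\<alpha>\<in>{0<..<1}. C2_Holder_loc_on \<alpha> punctured_closed_half_space u \<and>
                          C1_Holder_loc_on \<alpha> punctured_closed_half_space p) \<and>
          (\<forall>v q. axisymmetric_self_similar_solution F lam v q \<longrightarrow>
             (\<forall>x\<in>punctured_closed_half_space. v x = u x \<and> q x = p x)))) \<and>
    (\<forall>lam::real. \<not> (lam_lo < ereal lam \<and> ereal lam < lam_hi) \<longrightarrow>
       \<not> (\<exists>u p. axisymmetric_self_similar_solution F lam u p)) \<and>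
    ((\<forall>\<phi>\<in>{0..pi/2}. force_N X Y \<phi> \<ge> 0) \<and> (\<exists>\<phi>\<in>{0..pi/2}. force_N X Y \<phi> \<noteq> 0) \<longrightarrow>
       - \<infinity> < lam_lo \<and> lam_hi = \<infinity>) \<and>
    ((\<forall>\<phi>\<in>{0..pi/2}. force_N X Y \<phi> \<le> 0) \<and> (\<exists>\<phi>\<in>{0..pi/2}. force_N X Y \<phi> \<noteq> 0) \<longrightarrow>
       lam_lo = - \<infinity> \<and> lam_hi < \<infinity>) \<and>
    ((\<exists>\<phi>\<in>{0..pi/2}. force_N X Y \<phi> > 0) \<and> (\<exists>\<phi>\<in>{0..pi/2}. force_N X Y \<phi> < 0) \<longrightarrow>
       - \<infinity> < lam_lo \<and> lam_hi < \<infinity>) \<and>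
    ((\<forall>\<phi>\<in>{0..pi/2}. force_N X Y \<phi> = 0) \<longrightarrow> lam_lo = - \<infinity> \<and> lam_hi = \<infinity>)"
proof -
  obtain d where d: "\<And>\<phi> j. \<phi> \<in> {0..pi/2} \<Longrightarrow> ((\<lambda>\<phi>. F (meridian \<phi>) $ j) has_real_derivative d \<phi> $ j) (at \<phi> within {0..pi/2})"
    and cd: "continuous_on {0..pi/2} d" using C1_along_meridian[OF F_C1] by metis
  \<comment> \<open>The profiles are tied to the force only on [0, \<pi>/2]. Projecting the force
    along the meridian gives functions that agree with them there and whose derivatives come from
    those of F.\<close>
  define Xf where "Xf \<phi> = F (meridian \<phi>) $ 1 * sin \<phi> + F (meridian \<phi>) $ 3 * cos \<phi>" for \<phi>
  define Yf where "Yf \<phi> = F (meridian \<phi>) $ 1 * cos \<phi> - F (meridian \<phi>) $ 3 * sin \<phi>" for \<phi>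
  define X1 where "X1 \<phi> = d \<phi> $ 1 * sin \<phi> + d \<phi> $ 3 * cos \<phi> + Yf \<phi>" for \<phi>
  define Y1 where "Y1 \<phi> = d \<phi> $ 1 * cos \<phi> - d \<phi> $ 3 * sin \<phi> - Xf \<phi>" for \<phi>
  have XY: "Xf \<phi> = X \<phi>" "Yf \<phi> = Y \<phi>" if p: "\<phi> \<in> {0..pi/2}" for \<phi>
  proof -
    have "F (meridian \<phi>) = X \<phi> *\<^sub>R e_rho \<phi> 0 + Y \<phi> *\<^sub>R e_phi \<phi> 0"
      using F_profiles[of 1 \<phi> 0] p unfolding meridian_spherical by simp
    then have c: "F (meridian \<phi>) $ 1 = X \<phi> * sin \<phi> + Y \<phi> * cos \<phi>" "F (meridian \<phi>) $ 3 = X \<phi> * cos \<phi> - Y \<phi> * sin \<phi>"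
      by (simp_all add: e_rho_def e_phi_vec)
    have "Xf \<phi> = X \<phi> * (sin \<phi> * sin \<phi> + cos \<phi> * cos \<phi>)" "Yf \<phi> = Y \<phi> * (sin \<phi> * sin \<phi> + cos \<phi> * cos \<phi>)"
      unfolding Xf_def Yf_def c by (simp_all only: algebra_simps)
    then show "Xf \<phi> = X \<phi>" "Yf \<phi> = Y \<phi>" unfolding sin_mult_sin by simp_all
  qed
  have dX: "(Xf has_real_derivative X1 \<phi>) (at \<phi> within {0..pi/2})" if p: "\<phi> \<in> {0..pi/2}" for \<phi>
    unfolding Xf_def[abs_def] X1_def Yf_def by (auto intro!: derivative_eq_intros d[OF p] simp: algebra_simps)
  have dY: "(Yf has_real_derivative Y1 \<phi>) (at \<phi> within {0..pi/2})" if p: "\<phi> \<in> {0..pi/2}" for \<phi>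
    unfolding Yf_def[abs_def] Y1_def Xf_def by (auto intro!: derivative_eq_intros d[OF p] simp: algebra_simps)
  have cX: "continuous_on {0..pi/2} Xf" and cY: "continuous_on {0..pi/2} Yf"
    by (rule DERIV_continuous_on, erule dX, rule DERIV_continuous_on, erule dY)
  interpret angular_force X Y X1 Y1
  proof
    fix \<phi> :: real assume p: "\<phi> \<in> {0..pi/2}"
    show "(X has_real_derivative X1 \<phi>) (at \<phi> within {0..pi/2})"
      by (rule has_field_derivative_transform_within[OF dX[OF p] zero_less_one p]) (simp add: XY)
    show "(Y has_real_derivative Y1 \<phi>) (at \<phi> within {0..pi/2})"
      by (rule has_field_derivative_transform_within[OF dY[OF p] zero_less_one p]) (simp add: XY)
  next
    show "continuous_on {0..pi/2} X1" "continuous_on {0..pi/2} Y1"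
      unfolding X1_def[abs_def] Y1_def[abs_def] by (intro continuous_intros cd cX cY)+
    have e: "spherical 1 0 \<theta> = axis 3 1" for \<theta>
      by (simp add: spherical_def e_rho_def vec_eq_iff forall_3 axis_def)
    \<comment> \<open>Two values of \<theta> describe the same point of the axis and assign opposite
      signs to its first component.\<close>
    have "F (axis 3 1) $ 1 = Y 0" using F_profiles[of 1 0 0] unfolding e by (simp add: e_rho_def e_phi_vec)
    moreover have "F (axis 3 1) $ 1 = - Y 0" using F_profiles[of 1 0 pi] unfolding e by (simp add: e_rho_def e_phi_vec)
    ultimately show "Y 0 = 0" by simp
  qed
  obtain lo hi :: ereal where lohi: "lo < 0" "0 < hi" and iff: "\<And>l. lo < ereal l \<and> ereal l < hi \<longleftrightarrow> riccati_solvable q l"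
    and lo: "\<And>z. z \<in> {0..1} \<Longrightarrow> q z > 0 \<Longrightarrow> lo > -\<infinity>"
    and hi: "\<And>z. z \<in> {0..1} \<Longrightarrow> q z < 0 \<Longrightarrow> hi < \<infinity>"
    and hi': "(\<And>z. z \<in> {0..1} \<Longrightarrow> q z \<ge> 0) \<Longrightarrow> hi = \<infinity>"
    and lo': "(\<And>z. z \<in> {0..1} \<Longrightarrow> q z \<le> 0) \<Longrightarrow> lo = -\<infinity>"
    by (rule riccati_interval[OF q_continuous]) blast
  have lo1: "lo > -\<infinity>" if "\<phi> \<in> {0..pi/2}" "force_N X Y \<phi> > 0" for \<phi>
    using lo[OF q_cos(2)[OF that(1)]] q_sign[of \<phi> 1] that by simp
  have hi1: "hi < \<infinity>" if "\<phi> \<in> {0..pi/2}" "force_N X Y \<phi> < 0" for \<phi>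
    using hi[OF q_cos(2)[OF that(1)]] q_sign[of \<phi> "-1"] that by simp
  have hi2: "hi = \<infinity>" if "\<forall>\<phi>\<in>{0..pi/2}. force_N X Y \<phi> \<ge> 0"
    by (rule hi') (use q_nonneg[of 1] that in simp)
  have lo2: "lo = -\<infinity>" if "\<forall>\<phi>\<in>{0..pi/2}. force_N X Y \<phi> \<le> 0"
    by (rule lo') (use q_nonneg[of "-1"] that in simp)
  show ?thesis
  proof (rule exI[of _ lo], rule exI[of _ hi], intro conjI lohi allI impI)
    fix l :: real assume "lo < ereal l \<and> ereal l < hi"
    then obtain y where y: "riccati_solution q l y" using iff unfolding riccati_solvable_def by blast
    show "\<exists>u p. axisymmetric_self_similar_solution F l u p \<and>
          (\<forall>\<alpha>\<in>{0<..<1}. C2_Holder_loc_on \<alpha> S3 u \<and> C1_Holder_loc_on \<alpha> S3 p) \<and>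
          (\<forall>v q. axisymmetric_self_similar_solution F l v q \<longrightarrow> (\<forall>x\<in>S3. v x = u x \<and> q x = p x))"
      using vel_solution[OF y F_profiles F_C1] vel_Holder(1,2)[OF y] solution_unique(2)[OF F_profiles _ y] by blast
  next
    fix l :: real assume "\<not> (lo < ereal l \<and> ereal l < hi)"
    then show "\<not> (\<exists>u p. axisymmetric_self_similar_solution F l u p)"
      using iff solution_unique(1)[OF F_profiles] by blast
  next
    assume a: "(\<forall>\<phi>\<in>{0..pi/2}. force_N X Y \<phi> \<ge> 0) \<and> (\<exists>\<phi>\<in>{0..pi/2}. force_N X Y \<phi> \<noteq> 0)"
    then show "- \<infinity> < lo" using lo1 by (metis less_le)
    show "hi = \<infinity>" using hi2 a by blast
  next
    assume a: "(\<forall>\<phi>\<in>{0..pi/2}. force_N X Y \<phi> \<le> 0) \<and> (\<exists>\<phi>\<in>{0..pi/2}. force_N X Y \<phi> \<noteq> 0)"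
    then show "hi < \<infinity>" using hi1 by (metis less_le)
    show "lo = - \<infinity>" using lo2 a by blast
  next
    assume a: "(\<exists>\<phi>\<in>{0..pi/2}. force_N X Y \<phi> > 0) \<and> (\<exists>\<phi>\<in>{0..pi/2}. force_N X Y \<phi> < 0)"
    then show "- \<infinity> < lo" "hi < \<infinity>" using lo1 hi1 by blast+
  next
    assume a: "\<forall>\<phi>\<in>{0..pi/2}. force_N X Y \<phi> = 0"
    then show "lo = - \<infinity>" "hi = \<infinity>" using lo2 hi2 by auto
  qed
qed

end
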